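(* The problem of deciding, for a given finite graph $\mathsf{G}$, a state $s$ of $\mathsf{G}$, and a one-dimensional variance-stability objective $(\varrho,b,c)$, whether there exists a strategy achieving $(\varrho,b,c)$ in $s$, is in $\mathsf{NP}$. Further, such a strategy may require infinite memory: there exist a finite graph $\mathsf{G}$, a state $s$ and a one-dimensional variance-stability objective $(\varrho,b,c)$ such that some strategy achieves $(\varrho,b,c)$ in $s$, but no finite-memory strategy does.
   Context: A graph is $\mathsf{G}=(S,E)$ with finite non-empty state set $S$ and edges $E\subseteq S\times S$, each state having an outgoing edge (a game with only Player $\Box$). A strategy is a function $\sigma:S^*S\to S$ with $(s,\sigma(hs))\in E$; from an initial state $s$ it induces a unique run (infinite path) $\lambda=s_0s_1\dots$ with $s_0=s$, and it achieves an objective (set of runs) in $s$ if this run belongs to the objective. A strategy is finite-memory if it can be implemented by a finite automaton reading the history (finite set of memory states with an update function and a next-state function depending on current state and memory). A one-dimensional reward function is $\varrho:S\to\mathbb{N}_0$. For a run $\lambda=s_0s_1\dots$, $\mathit{mp}_\varrho(\lambda)=\liminf_{n\to\infty}\frac1{n+1}\sum_{i=0}^n\varrho(s_i)$ and $\mathit{va}_\varrho(\lambda)=\limsup_{n\to\infty}\frac1{n+1}\sum_{i=0}^n(\varrho(s_i)-\mathit{mp}_\varrho(\lambda))^2$. A variance-stability objective $(\varrho,b,c)$ with $b,c\in\mathbb{Q}$ is the set of runs $\lambda$ with $\mathit{mp}_\varrho(\lambda)\ge b$ and $\mathit{va}_\varrho(\lambda)\le c$. *)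

theory Defs
  imports "HOL-Analysis.Analysis" "HOL-Computational_Algebra.Polynomial"
begin

section \<open>Graphs, strategies and variance-stability objectives\<close>

record 's graph =
  states :: "'s set"
  edges :: "('s \<times> 's) set"

definition is_graph :: "'s graph \<Rightarrow> bool" where
  "is_graph G \<longleftrightarrow> finite (states G) \<and> states G \<noteq> {} \<and>
     edges G \<subseteq> states G \<times> states G \<and> (\<forall>s\<in>states G. \<exists>t. (s, t) \<in> edges G)"

definition runs :: "'s graph \<Rightarrow> (nat \<Rightarrow> 's) set" where
  "runs G = {r. r 0 \<in> states G \<and> (\<forall>i. (r i, r (Suc i)) \<in> edges G)}"

text \<open>A strategy is applied to non-empty histories \<open>h @ [s]\<close>; its value on the empty list is
  irrelevant.\<close>

definition strategy :: "'s graph \<Rightarrow> ('s list \<Rightarrow> 's) \<Rightarrow> bool" where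
  "strategy G \<sigma> \<longleftrightarrow>
     (\<forall>h s. set h \<subseteq> states G \<longrightarrow> s \<in> states G \<longrightarrow> (s, \<sigma> (h @ [s])) \<in> edges G)"

primrec history :: "('s list \<Rightarrow> 's) \<Rightarrow> 's \<Rightarrow> nat \<Rightarrow> 's list" where
  "history \<sigma> s 0 = [s]"
| "history \<sigma> s (Suc n) = history \<sigma> s n @ [\<sigma> (history \<sigma> s n)]"

definition induced_run :: "('s list \<Rightarrow> 's) \<Rightarrow> 's \<Rightarrow> nat \<Rightarrow> 's" where
  "induced_run \<sigma> s n = last (history \<sigma> s n)"

definition achieves :: "('s list \<Rightarrow> 's) \<Rightarrow> (nat \<Rightarrow> 's) set \<Rightarrow> 's \<Rightarrow> bool" where
  "achieves \<sigma> Obj s \<longleftrightarrow> induced_run \<sigma> s \<in> Obj"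

text \<open>The memory is updated by reading the states visited before the current one; the move then
  depends on the memory and on the current state. Memory states are natural numbers, which is no
  restriction for finite memory.\<close>

definition finite_memory :: "'s graph \<Rightarrow> ('s list \<Rightarrow> 's) \<Rightarrow> bool" where
  "finite_memory G \<sigma> \<longleftrightarrow>
     (\<exists>(M :: nat set) m0 upd nxt. finite M \<and> m0 \<in> M \<and>
        (\<forall>m\<in>M. \<forall>s\<in>states G. upd m s \<in> M) \<and>
        (\<forall>h s. set h \<subseteq> states G \<longrightarrow> s \<in> states G \<longrightarrow> \<sigma> (h @ [s]) = nxt (foldl upd m0 h) s))"

text \<open>\<open>liminf\<close> and \<open>limsup\<close> live in complete lattices, hence the detour through extended reals.
  On runs of a finite graph the averages are bounded, so both limits are finite and
  \<^const>\<open>real_of_ereal\<close> does not alter them.\<close>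

definition mp :: "('s \<Rightarrow> nat) \<Rightarrow> (nat \<Rightarrow> 's) \<Rightarrow> real" where
  "mp \<rho> r = real_of_ereal (liminf (\<lambda>n. ereal (1 / real (n + 1) * (\<Sum>i\<le>n. real (\<rho> (r i))))))"

definition va :: "('s \<Rightarrow> nat) \<Rightarrow> (nat \<Rightarrow> 's) \<Rightarrow> real" where
  "va \<rho> r = real_of_ereal
     (limsup (\<lambda>n. ereal (1 / real (n + 1) * (\<Sum>i\<le>n. (real (\<rho> (r i)) - mp \<rho> r)\<^sup>2))))"

definition variance_stability ::
    "'s graph \<Rightarrow> ('s \<Rightarrow> nat) \<Rightarrow> rat \<Rightarrow> rat \<Rightarrow> (nat \<Rightarrow> 's) set" where
  "variance_stability G \<rho> b c = {r \<in> runs G. mp \<rho> r \<ge> of_rat b \<and> va \<rho> r \<le> of_rat c}"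


section \<open>Turing machines and NP\<close>

text \<open>Deterministic multi-tape machines with two-way infinite tapes. Control states and tape
  symbols are initial segments of the natural numbers, and \<open>0\<close> is the blank. The transition
  function maps a control state and the list of scanned symbols (one per tape) to the new control
  state and the list of symbols to write with the head movements. Well-formedness keeps it inside
  a finite domain, so only a finite table of it is ever used.\<close>

datatype move = MoveLeft | Stay | MoveRight

record tm =
  tapes :: nat
  nstates :: nat
  nsymbols :: nat
  start :: nat
  accept :: nat
  reject :: nat
  delta :: "nat \<Rightarrow> nat list \<Rightarrow> nat \<times> (nat \<times> move) list"

definition wf_tm :: "tm \<Rightarrow> bool" where
  "wf_tm M \<longleftrightarrow> tapes M \<ge> 2 \<and> nsymbols M \<ge> 3 \<and>
     start M < nstates M \<and> accept M < nstates M \<and> reject M < nstates M \<and> accept M \<noteq> reject M \<and>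
     (\<forall>q < nstates M. \<forall>ss. length ss = tapes M \<and> (\<forall>a\<in>set ss. a < nsymbols M) \<longrightarrow>
        (case delta M q ss of (q', as) \<Rightarrow>
           q' < nstates M \<and> length as = tapes M \<and> (\<forall>(a, d)\<in>set as. a < nsymbols M)))"

type_synonym tape = "(int \<Rightarrow> nat) \<times> int"
type_synonym config = "nat \<times> tape list"

fun read :: "tape \<Rightarrow> nat" where
  "read (f, i) = f i"

fun offset :: "move \<Rightarrow> int" where
  "offset MoveLeft = - 1"
| "offset Stay = 0"
| "offset MoveRight = 1"

fun act :: "nat \<times> move \<Rightarrow> tape \<Rightarrow> tape" where
  "act (a, d) (f, i) = (f(i := a), i + offset d)"

fun step :: "tm \<Rightarrow> config \<Rightarrow> config" where
  "step M (q, ts) =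
     (if q = accept M \<or> q = reject M then (q, ts)
      else (case delta M q (map read ts) of (q', as) \<Rightarrow> (q', map2 act as ts)))"

definition tape_of :: "bool list \<Rightarrow> tape" where
  "tape_of w =
     (\<lambda>i. if 0 \<le> i \<and> i < int (length w) then (if w ! nat i then 2 else 1) else 0, 0)"

text \<open>The input is on the first tape and the certificate on the second one.\<close>

definition init :: "tm \<Rightarrow> bool list \<Rightarrow> bool list \<Rightarrow> config" where
  "init M x u = (start M, tape_of x # tape_of u # replicate (tapes M - 2) (tape_of []))"

text \<open>Halting configurations are fixed points of \<^const>\<open>step\<close>, so being in a halting state after
  exactly \<open>t\<close> steps means having halted within \<open>t\<close> steps.\<close>

definition halts_within :: "tm \<Rightarrow> bool list \<Rightarrow> bool list \<Rightarrow> nat \<Rightarrow> bool" where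
  "halts_within M x u t \<longleftrightarrow> fst ((step M ^^ t) (init M x u)) \<in> {accept M, reject M}"

definition accepts :: "tm \<Rightarrow> bool list \<Rightarrow> bool list \<Rightarrow> bool" where
  "accepts M x u \<longleftrightarrow> (\<exists>t. fst ((step M ^^ t) (init M x u)) = accept M)"

definition NP :: "bool list set set" where
  "NP = {L. \<exists>M (p :: nat poly) (t :: nat poly). wf_tm M \<and>
     (\<forall>x u. length u \<le> poly p (length x) \<longrightarrow> halts_within M x u (poly t (length x))) \<and>
     (\<forall>x. x \<in> L \<longleftrightarrow> (\<exists>u. length u \<le> poly p (length x) \<and> accepts M x u))}"


section \<open>The decision problem\<close>

text \<open>Input graphs have state set \<open>{..<n}\<close>. An instance is written as a sequence of bit strings:
  the \<open>n\<close> rows of the adjacency matrix, the initial state, the \<open>n\<close> rewards, and for each of the two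
  rational bounds the signed numerator and the denominator; numbers are in binary, least
  significant bit first. The sequence becomes a single bit string by writing a bit \<open>v\<close> as \<open>1v\<close>
  and ending each component with \<open>00\<close>.\<close>

fun nat_bits :: "nat \<Rightarrow> bool list" where
  "nat_bits n = (if n = 0 then [] else odd n # nat_bits (n div 2))"

declare nat_bits.simps [simp del]

definition int_bits :: "int \<Rightarrow> bool list" where
  "int_bits k = (k < 0) # nat_bits (nat \<bar>k\<bar>)"

definition rat_fields :: "rat \<Rightarrow> bool list list" where
  "rat_fields q = (case quotient_of q of (k, d) \<Rightarrow> [int_bits k, nat_bits (nat d)])"

definition encode_field :: "bool list \<Rightarrow> bool list" where
  "encode_field w = concat (map (\<lambda>v. [True, v]) w) @ [False, False]"

definition instance_fields ::
    "nat \<Rightarrow> (nat \<times> nat) set \<Rightarrow> nat \<Rightarrow> (nat \<Rightarrow> nat) \<Rightarrow> rat \<Rightarrow> rat \<Rightarrow> bool list list" where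
  "instance_fields n E s \<rho> b c =
     map (\<lambda>i. map (\<lambda>j. (i, j) \<in> E) [0..<n]) [0..<n] @ [nat_bits s] @
     map (\<lambda>i. nat_bits (\<rho> i)) [0..<n] @ rat_fields b @ rat_fields c"

definition encode_instance ::
    "nat \<Rightarrow> (nat \<times> nat) set \<Rightarrow> nat \<Rightarrow> (nat \<Rightarrow> nat) \<Rightarrow> rat \<Rightarrow> rat \<Rightarrow> bool list" where
  "encode_instance n E s \<rho> b c = concat (map encode_field (instance_fields n E s \<rho> b c))"

definition variance_stability_problem :: "bool list set" where
  "variance_stability_problem =
     {encode_instance n E s \<rho> b c | n E s \<rho> b c.
        (let G = \<lparr>states = {..<n}, edges = E\<rparr> in
         is_graph G \<and> s \<in> states G \<and>
         (\<exists>\<sigma>. strategy G \<sigma> \<and> achieves \<sigma> (variance_stability G \<rho> b c) s))}"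

text \<open>Distinct instances have distinct encodings.\<close>

lemma nat_bits_0: "nat_bits 0 = []"
  by (subst nat_bits.simps) simp

lemma nat_bits_pos: "n > 0 \<Longrightarrow> nat_bits n = odd n # nat_bits (n div 2)"
  by (subst nat_bits.simps) simp

lemma nat_bits_inject: "nat_bits m = nat_bits n \<Longrightarrow> m = n"
proof (induction m arbitrary: n rule: less_induct)
  case (less m)
  consider "m = 0" "n = 0" | "m = 0" "n > 0" | "m > 0" "n = 0" | "m > 0" "n > 0"
    by fastforce
  then show ?case
  proof cases
    case 4
    then have eqs: "odd m = odd n" "nat_bits (m div 2) = nat_bits (n div 2)"
      using less.prems by (simp_all add: nat_bits_pos)
    have "m div 2 = n div 2"
      using eqs 4 by (intro less.IH) simp_all
    moreover have "m mod 2 = n mod 2"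
      using eqs by (simp add: mod_2_eq_odd)
    ultimately show ?thesis
      by (metis div_mult_mod_eq)
  qed (use less.prems in \<open>simp_all add: nat_bits_0 nat_bits_pos\<close>)
qed

lemma rat_fields_inject: "rat_fields p = rat_fields q \<Longrightarrow> p = q"
proof -
  assume eq: "rat_fields p = rat_fields q"
  obtain k d where p: "quotient_of p = (k, d)" by force
  obtain k' d' where q: "quotient_of q = (k', d')" by force
  have "d > 0" "d' > 0"
    using quotient_of_denom_pos p q by auto
  moreover have "nat_bits (nat d) = nat_bits (nat d')"
    "nat_bits (nat \<bar>k\<bar>) = nat_bits (nat \<bar>k'\<bar>)" and sgn: "(k < 0) = (k' < 0)"
    using eq p q by (simp_all add: rat_fields_def int_bits_def)
  then have "nat d = nat d'" "nat \<bar>k\<bar> = nat \<bar>k'\<bar>"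
    by (blast dest: nat_bits_inject)+
  ultimately have "d = d'" "k = k'"
    using sgn by linarith+
  then have "quotient_of p = quotient_of q"
    using p q by simp
  then show ?thesis
    by (rule quotient_of_inject)
qed

lemma encode_field_inject:
  "encode_field v @ x = encode_field w @ y \<Longrightarrow> v = w \<and> x = y"
proof (induction v arbitrary: w)
  case Nil
  then show ?case by (cases w) (auto simp: encode_field_def)
next
  case (Cons a v)
  then show ?case by (cases w) (auto simp: encode_field_def)
qed

lemma concat_encode_field_inject:
  "concat (map encode_field vs) = concat (map encode_field ws) \<Longrightarrow> vs = ws"
proof (induction vs arbitrary: ws)
  case Nil
  then show ?case by (cases ws) (auto simp: encode_field_def)
next
  case (Cons v vs)
  then obtain w ws' where ws: "ws = w # ws'"
    by (cases ws) (auto simp: encode_field_def)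
  then show ?case
    using Cons.IH[of ws'] Cons.prems
      encode_field_inject[of v "concat (map encode_field vs)" w "concat (map encode_field ws')"]
    by simp
qed

lemma encode_instance_inject:
  assumes eq: "encode_instance n E s \<rho> b c = encode_instance n' E' s' \<rho>' b' c'"
    and G: "is_graph \<lparr>states = {..<n}, edges = E\<rparr>"
    and G': "is_graph \<lparr>states = {..<n'}, edges = E'\<rparr>"
  shows "n = n' \<and> E = E' \<and> s = s' \<and> (\<forall>i<n. \<rho> i = \<rho>' i) \<and> b = b' \<and> c = c'"
proof -
  have fields: "instance_fields n E s \<rho> b c = instance_fields n' E' s' \<rho>' b' c'"
    using eq unfolding encode_instance_def by (rule concat_encode_field_inject)
  have len: "length (rat_fields q) = 2" for q
    by (auto simp: rat_fields_def split: prod.splits)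
  have "length (instance_fields n E s \<rho> b c) = length (instance_fields n' E' s' \<rho>' b' c')"
    using fields by simp
  then have n: "n = n'"
    by (simp add: instance_fields_def len)
  have rows: "map (\<lambda>i. map (\<lambda>j. (i, j) \<in> E) [0..<n]) [0..<n] =
      map (\<lambda>i. map (\<lambda>j. (i, j) \<in> E') [0..<n]) [0..<n]"
    and s: "nat_bits s = nat_bits s'"
    and rew: "map (\<lambda>i. nat_bits (\<rho> i)) [0..<n] = map (\<lambda>i. nat_bits (\<rho>' i)) [0..<n]"
    and bc: "rat_fields b = rat_fields b'" "rat_fields c = rat_fields c'"
    using fields n by (simp_all add: instance_fields_def len)
  have "(i, j) \<in> E \<longleftrightarrow> (i, j) \<in> E'" if "i < n" "j < n" for i j
    using rows that by simp
  moreover have "E \<subseteq> {..<n} \<times> {..<n}" "E' \<subseteq> {..<n} \<times> {..<n}"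
    using G G' n by (simp_all add: is_graph_def)
  ultimately have "E = E'"
    by (auto 0 3)
  moreover have "\<forall>i<n. \<rho> i = \<rho>' i"
    using rew by (auto intro: nat_bits_inject)
  ultimately show ?thesis
    using n nat_bits_inject[OF s] bc[THEN rat_fields_inject] by simp
qed

end

theory Submission imports Defs
begin

text \<open>Let \<open>m\<close> be the mean payoff of a run with \<open>m \<ge> b\<close>. The variance is concave in the pair of the
  first two moments, and the moments of long finite walks are, up to a bounded error, mixtures of
  those of simple cycles. Hence the objective is achievable iff, among the pairs of mutually
  reachable simple cycles that are reachable from \<open>s\<close>, some mixture with non-negative integer weights
  has mean at least \<open>b\<close> and variance at most \<open>c\<close>: either one cycle alone or a mixture of two cycles
  with mean exactly \<open>b\<close>. Switching between the cycles ever more rarely realizes the mixture; where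
  switching has a cost, no ultimately periodic run does.

  Two cycles, connecting walks and the weights form a certificate of polynomial size. For membership
  in NP, functions on bit strings computed by stack programs in polynomial time are shown to be
  closed under bounded recursion; a tape with its head on the topmost symbol is a stack, and the
  residual programs of a stack program serve as control states of a Turing machine.\<close>

section \<open>Stack programs and Turing machines\<close>

text \<open>Mean payoff is a lower limit and variance an upper limit around it, so a run need not
  have frequencies, and no limit point of its moments is extracted. Instead, the absence of a
  certificate is turned into one linear weight on states that is non-negative on every short closed
  walk; its sums along a run are bounded below, which forces the variance above \<open>c\<close>.
  The pairs of moments with variance at most \<open>c\<close> do not form a convex set, but on the
  part of a segment with mean at least \<open>b\<close> the concave variance is smallest at an end:
  a cycle, or the point with mean \<open>b\<close>. This is why two cycles suffice and why their
  weights have a closed form of polynomial bit length. On the complexity side the obstacle is that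
  NP refers to concrete machines. Closure rules reduce the verifier to an ordinary formula with
  bounded quantifiers and sums; the only obligation that is not syntactic is the length bound on
  intermediate values of a recursion. Signs and fractions are cleared by cross multiplication, so
  that the verifier computes with natural numbers only.\<close>

datatype com =
    SKIP
  | Push nat bool
  | Wr nat bool
  | Pop nat
  | Seq com com (infixr ";;" 60)
  | Case nat com com com
  | While nat com

type_synonym store = "nat \<Rightarrow> bool list"

fun regs :: "com \<Rightarrow> nat set" where
  "regs SKIP = {}"
| "regs (Push r b) = {r}"
| "regs (Wr r b) = {r}"
| "regs (Pop r) = {r}"
| "regs (c ;; d) = regs c \<union> regs d"
| "regs (Case r c0 c1 c2) = insert r (regs c0 \<union> regs c1 \<union> regs c2)"
| "regs (While r c) = insert r (regs c)"

lemma finite_regs: "finite (regs c)"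
  by (induction c) auto

definition symbol :: "bool \<Rightarrow> nat" where
  "symbol b = (if b then 2 else 1)"

text \<open>One machine step: the residual command, and the tape acted on with its action. A push takes
  two steps, the second of which is \<^const>\<open>Wr\<close>.\<close>

fun ctl :: "com \<Rightarrow> (nat \<Rightarrow> nat) \<Rightarrow> com \<times> nat \<times> nat \<times> move" where
  "ctl SKIP g = (SKIP, 0, g 0, Stay)"
| "ctl (Push r b) g = (Wr r b, r, g r, MoveLeft)"
| "ctl (Wr r b) g = (SKIP, r, symbol b, Stay)"
| "ctl (Pop r) g = (SKIP, r, 0, if g r = 0 then Stay else MoveRight)"
| "ctl (c ;; d) g =
     (if c = SKIP then (d, 0, g 0, Stay) else (case ctl c g of (c', a) \<Rightarrow> (c' ;; d, a)))"
| "ctl (Case r c0 c1 c2) g = (if g r = 0 then c0 else if g r = 1 then c1 else c2, r, g r, Stay)"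
| "ctl (While r c) g = (if g r = 0 then SKIP else c ;; While r c, r, g r, Stay)"

text \<open>A finite set that contains the command and is closed under \<open>ctl\<close>. Loops
  keep it finite: unfolding \<open>While r c\<close> only prefixes residuals of the body to the same
  \<open>While r c\<close>, which is then met again.\<close>

fun residuals :: "com \<Rightarrow> com set" where
  "residuals SKIP = {SKIP}"
| "residuals (Push r b) = {Push r b, Wr r b, SKIP}"
| "residuals (Wr r b) = {Wr r b, SKIP}"
| "residuals (Pop r) = {Pop r, SKIP}"
| "residuals (c ;; d) = (\<lambda>c'. c' ;; d) ` residuals c \<union> residuals d"
| "residuals (Case r c0 c1 c2) =
     insert (Case r c0 c1 c2) (residuals c0 \<union> residuals c1 \<union> residuals c2)"
| "residuals (While r c) = {While r c, SKIP} \<union> (\<lambda>c'. c' ;; While r c) ` residuals c"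

lemma finite_residuals: "finite (residuals c)"
  by (induction c) auto

lemma residuals_refl: "c \<in> residuals c"
  by (induction c) auto

lemma residuals_step: "c' \<in> residuals c \<Longrightarrow> fst (ctl c' g) \<in> residuals c"
proof (induction c arbitrary: c')
  case (Seq c d)
  from Seq.prems consider (L) c1 where "c' = c1 ;; d" "c1 \<in> residuals c" | (R) "c' \<in> residuals d"
    by auto
  then show ?case
  proof cases
    case L
    then show ?thesis
      using Seq.IH(1)[OF L(2)] residuals_refl[of d] by (auto split: prod.splits)
  qed (use Seq.IH(2) in auto)
next
  case (While r c)
  from While.prems consider (A) "c' = While r c" | (B) "c' = SKIP"
    | (C) c1 where "c' = c1 ;; While r c" "c1 \<in> residuals c"
    by auto
  then show ?case
  proof cases
    case C
    then show ?thesis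
      using While.IH[OF C(2)] by (auto split: prod.splits)
  qed (use residuals_refl[of c] in auto)
next
  case (Case r c0 c1 c2)
  then show ?case
    using residuals_refl[of c0] residuals_refl[of c1] residuals_refl[of c2] by auto
qed auto

lemma residuals_regs: "c' \<in> residuals c \<Longrightarrow> regs c' \<subseteq> regs c"
  by (induction c arbitrary: c') fastforce+

text \<open>The head stands on the top of the stack, and a blank marks the bottom. Cells left of the
  head are unconstrained, because a push overwrites the cell it enters.\<close>

definition tape_rep :: "tape \<Rightarrow> bool list \<Rightarrow> bool" where
  "tape_rep T w \<longleftrightarrow>
     (\<forall>j. fst T (snd T + int j) = (if j < length w then symbol (w ! j) else 0))"

definition rep :: "nat \<Rightarrow> tape list \<Rightarrow> store \<Rightarrow> bool" where
  "rep K ts s \<longleftrightarrow> length ts = K \<and> (\<forall>r<K. tape_rep (ts ! r) (s r))"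

definition cstep :: "com \<times> tape list \<Rightarrow> com \<times> tape list \<Rightarrow> bool" where
  "cstep x y \<longleftrightarrow> (case x of (c, ts) \<Rightarrow> c \<noteq> SKIP \<and>
     (case ctl c (\<lambda>i. read (ts ! i)) of (c', r, a) \<Rightarrow> y = (c', ts[r := act a (ts ! r)])))"

lemma read_tape_rep: "tape_rep T w \<Longrightarrow> read T = (case w of [] \<Rightarrow> 0 | b # _ \<Rightarrow> symbol b)"
  by (cases T) (auto simp: tape_rep_def split: list.splits dest: spec[of _ 0])

lemma act_stay: "act (read T, Stay) T = T"
  by (cases T) auto

lemma tape_rep_push:
  assumes "tape_rep T w"
  shows "tape_rep (act (symbol b, Stay) (act (read T, MoveLeft) T)) (b # w)"
proof (cases T)
  case (Pair f i)
  have h: "f (i + int j) = (if j < length w then symbol (w ! j) else 0)" for j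
    using assms Pair by (simp add: tape_rep_def)
  have "((f(i := f i)) (i - 1 := symbol b)) (i - 1 + int j) =
      (if j < length (b # w) then symbol ((b # w) ! j) else 0)" for j
  proof (cases j)
    case (Suc k)
    have "i - 1 + int j = i + int k" using Suc by simp
    then show ?thesis using h[of k] Suc by simp
  qed simp
  then show ?thesis
    using Pair by (simp add: tape_rep_def)
qed

lemma tape_rep_pop:
  assumes "tape_rep T w"
  shows "tape_rep (act (0, if read T = 0 then Stay else MoveRight) T) (tl w)"
proof (cases T)
  case (Pair f i)
  have h: "f (i + int j) = (if j < length w then symbol (w ! j) else 0)" for j
    using assms Pair by (simp add: tape_rep_def)
  show ?thesis
  proof (cases w)
    case Nil
    then show ?thesis using h h[of 0] Pair by (simp add: tape_rep_def)
  next
    case (Cons b v)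
    have "f i \<noteq> 0" using h[of 0] Cons by (simp add: symbol_def)
    moreover have "f (i + 1 + int j) = (if j < length v then symbol (v ! j) else 0)" for j
      using h[of "Suc j"] Cons by (simp add: algebra_simps)
    ultimately show ?thesis using Cons Pair by (simp add: tape_rep_def)
  qed
qed

lemma rep_update:
  "rep K ts s \<Longrightarrow> r < K \<Longrightarrow> tape_rep T w \<Longrightarrow> rep K (ts[r := T]) (s(r := w))"
  by (auto simp: rep_def nth_list_update)

lemma cstep_Seq: "cstep (c, ts) (c', ts') \<Longrightarrow> cstep (c ;; d, ts) (c' ;; d, ts')"
  by (auto simp: cstep_def split: prod.splits)

lemma csteps_Seq: "(cstep ^^ t) (c, ts) (c', ts') \<Longrightarrow> (cstep ^^ t) (c ;; d, ts) (c' ;; d, ts')"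
proof (induction t arbitrary: c' ts')
  case (Suc t)
  then obtain y where y: "(cstep ^^ t) (c, ts) y" "cstep y (c', ts')" by auto
  obtain c1 ts1 where "y = (c1, ts1)" by fastforce
  with y Suc.IH cstep_Seq show ?case by fastforce
qed auto

lemma csteps_add: "(cstep ^^ m) x y \<Longrightarrow> (cstep ^^ n) y z \<Longrightarrow> (cstep ^^ (m + n)) x z"
  by (auto simp: relpowp_add)

lemma csteps_one: "cstep x y \<Longrightarrow> (cstep ^^ 1) x y"
  by (simp add: relpowp_1 del: One_nat_def)

lemma csteps_Seq_trans:
  assumes "(cstep ^^ t) (c, ts) (SKIP, ts')" "(cstep ^^ t') (d, ts') z"
  shows "(cstep ^^ (t + 1 + t')) (c ;; d, ts) z"
proof -
  have "cstep (SKIP ;; d, ts') (d, ts')"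
    by (simp add: cstep_def act_stay)
  then have "(cstep ^^ (1 + t')) (SKIP ;; d, ts') z"
    using assms(2) by (blast intro: csteps_add csteps_one)
  then have "(cstep ^^ (t + (1 + t'))) (c ;; d, ts) z"
    by (rule csteps_add[OF csteps_Seq[OF assms(1)]])
  then show ?thesis
    by (simp only: add.assoc)
qed

text \<open>Total correctness with a time bound. Every number \<open>K\<close> of tapes that covers
  the registers is allowed, so that programs compose before the machine is fixed.\<close>

definition exec :: "com \<Rightarrow> store \<Rightarrow> nat \<Rightarrow> store \<Rightarrow> bool" where
  "exec c s t s' \<longleftrightarrow> (\<forall>K ts. regs c \<subseteq> {..<K} \<longrightarrow> rep K ts s \<longrightarrow>
     (\<exists>n ts'. n \<le> t \<and> rep K ts' s' \<and> (cstep ^^ n) (c, ts) (SKIP, ts')))"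

lemma execI:
  assumes "\<And>K ts. regs c \<subseteq> {..<K} \<Longrightarrow> rep K ts s \<Longrightarrow>
    \<exists>n ts'. n \<le> t \<and> rep K ts' s' \<and> (cstep ^^ n) (c, ts) (SKIP, ts')"
  shows "exec c s t s'"
  unfolding exec_def using assms by blast

lemma execE:
  assumes "exec c s t s'" "regs c \<subseteq> {..<K}" "rep K ts s"
  obtains n ts' where "n \<le> t" "rep K ts' s'" "(cstep ^^ n) (c, ts) (SKIP, ts')"
  using assms unfolding exec_def by blast

lemma exec_mono: "exec c s t s' \<Longrightarrow> t \<le> t' \<Longrightarrow> exec c s t' s'"
  unfolding exec_def by (meson le_trans)

lemma exec_SKIP: "exec SKIP s t s"
  by (rule execI, rule exI[of _ 0]) auto

lemma exec_Push:
  assumes s': "s' = s(r := b # s r)" and t: "2 \<le> t"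
  shows "exec (Push r b) s t s'"
proof (rule execI)
  fix K ts assume K: "regs (Push r b) \<subseteq> {..<K}" "rep K ts s"
  let ?T1 = "act (read (ts ! r), MoveLeft) (ts ! r)"
  let ?T2 = "act (symbol b, Stay) ?T1"
  have r: "r < K" "r < length ts" "tape_rep (ts ! r) (s r)"
    using K by (auto simp: rep_def)
  have "cstep (Push r b, ts) (Wr r b, ts[r := ?T1])"
    "cstep (Wr r b, ts[r := ?T1]) (SKIP, ts[r := ?T2])"
    using r by (simp_all add: cstep_def)
  then have "(cstep ^^ (1 + 1)) (Push r b, ts) (SKIP, ts[r := ?T2])"
    by (blast intro: csteps_add csteps_one)
  moreover have "rep K (ts[r := ?T2]) s'"
    unfolding s' using K(2) r by (intro rep_update tape_rep_push)
  moreover have "1 + 1 \<le> t" using t by simp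
  ultimately show "\<exists>n ts'. n \<le> t \<and> rep K ts' s' \<and> (cstep ^^ n) (Push r b, ts) (SKIP, ts')"
    by blast
qed

lemma exec_Pop:
  assumes s': "s' = s(r := tl (s r))" and t: "1 \<le> t"
  shows "exec (Pop r) s t s'"
proof (rule execI)
  fix K ts assume K: "regs (Pop r) \<subseteq> {..<K}" "rep K ts s"
  let ?T = "act (0, if read (ts ! r) = 0 then Stay else MoveRight) (ts ! r)"
  have r: "r < K" "tape_rep (ts ! r) (s r)"
    using K by (auto simp: rep_def)
  have "cstep (Pop r, ts) (SKIP, ts[r := ?T])"
    by (simp add: cstep_def)
  moreover have "rep K (ts[r := ?T]) s'"
    unfolding s' using K(2) r by (intro rep_update tape_rep_pop)
  ultimately show "\<exists>n ts'. n \<le> t \<and> rep K ts' s' \<and> (cstep ^^ n) (Pop r, ts) (SKIP, ts')"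
    using t csteps_one by blast
qed

lemma exec_Seq:
  assumes c: "exec c s t1 s'" and d: "exec d s' t2 s''" and t: "t1 + 1 + t2 \<le> t"
  shows "exec (c ;; d) s t s''"
proof (rule execI)
  fix K ts assume K: "regs (c ;; d) \<subseteq> {..<K}" "rep K ts s"
  obtain n1 ts1 where 1: "n1 \<le> t1" "rep K ts1 s'" "(cstep ^^ n1) (c, ts) (SKIP, ts1)"
    using K by (auto intro: execE[OF c])
  obtain n2 ts2 where 2: "n2 \<le> t2" "rep K ts2 s''" "(cstep ^^ n2) (d, ts1) (SKIP, ts2)"
    using K 1(2) by (auto intro: execE[OF d])
  have "n1 + 1 + n2 \<le> t" using 1(1) 2(1) t by linarith
  then show "\<exists>n ts'. n \<le> t \<and> rep K ts' s'' \<and> (cstep ^^ n) (c ;; d, ts) (SKIP, ts')"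
    using csteps_Seq_trans[OF 1(3) 2(3)] 2(2) by blast
qed

text \<open>Common part of the rules for \<open>Case\<close> and \<open>While\<close>: a step that
  selects the next command and leaves all tapes as they are.\<close>

lemma exec_step:
  assumes st: "\<And>K ts. regs c \<subseteq> {..<K} \<Longrightarrow> rep K ts s \<Longrightarrow> cstep (c, ts) (d, ts)"
    and d: "exec d s t1 s'" "regs d \<subseteq> regs c" and t: "1 + t1 \<le> t"
  shows "exec c s t s'"
proof (rule execI)
  fix K ts assume K: "regs c \<subseteq> {..<K}" "rep K ts s"
  obtain n ts' where 1: "n \<le> t1" "rep K ts' s'" "(cstep ^^ n) (d, ts) (SKIP, ts')"
    using execE[OF d(1) order_trans[OF d(2) K(1)] K(2)] .
  have "1 + n \<le> t" using 1(1) t by linarith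
  then show "\<exists>n ts'. n \<le> t \<and> rep K ts' s' \<and> (cstep ^^ n) (c, ts) (SKIP, ts')"
    using csteps_add[OF csteps_one[OF st[OF K]] 1(3)] 1(2) by blast
qed

lemma read_rep:
  "rep K ts s \<Longrightarrow> r < K \<Longrightarrow> read (ts ! r) = (case s r of [] \<Rightarrow> 0 | b # _ \<Rightarrow> symbol b)"
  by (simp add: rep_def read_tape_rep)

lemma exec_Case:
  assumes "s r = [] \<Longrightarrow> exec c0 s t1 s'" "\<And>w. s r = False # w \<Longrightarrow> exec c1 s t1 s'"
    "\<And>w. s r = True # w \<Longrightarrow> exec c2 s t1 s'" "1 + t1 \<le> t"
  shows "exec (Case r c0 c1 c2) s t s'"
proof (rule exec_step)
  let ?d = "case s r of [] \<Rightarrow> c0 | b # _ \<Rightarrow> if b then c2 else c1"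
  show "cstep (Case r c0 c1 c2, ts) (?d, ts)" if "regs (Case r c0 c1 c2) \<subseteq> {..<K}" "rep K ts s" for K ts
    using read_rep[OF that(2), of r] that(1) act_stay[of "ts ! r"]
    by (auto simp: cstep_def symbol_def split: list.splits)
  show "exec ?d s t1 s'" using assms(1-3) by (auto split: list.splits)
  show "regs ?d \<subseteq> regs (Case r c0 c1 c2)" by (auto split: list.splits if_splits)
qed (rule assms(4))

lemma exec_While_Nil:
  assumes "s r = []" "1 \<le> t"
  shows "exec (While r c) s t s"
proof (rule exec_step)
  show "cstep (While r c, ts) (SKIP, ts)" if "regs (While r c) \<subseteq> {..<K}" "rep K ts s" for K ts
    using read_rep[OF that(2), of r] that(1) act_stay[of "ts ! r"] assms(1) by (simp add: cstep_def)
qed (use assms(2) in \<open>auto intro: exec_SKIP[of _ 0]\<close>)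

lemma exec_While_step:
  assumes "s r \<noteq> []" "exec c s t1 s'" "exec (While r c) s' t2 s''" "1 + (t1 + 1 + t2) \<le> t"
  shows "exec (While r c) s t s''"
proof (rule exec_step)
  show "cstep (While r c, ts) (c ;; While r c, ts)" if "regs (While r c) \<subseteq> {..<K}" "rep K ts s" for K ts
    using read_rep[OF that(2), of r] that(1) act_stay[of "ts ! r"] assms(1)
    by (auto simp: cstep_def symbol_def split: list.splits)
  show "exec (c ;; While r c) s (t1 + 1 + t2) s''"
    using assms(2,3) order_refl by (rule exec_Seq)
qed (use assms(4) in auto)

lemma ctl_wf:
  assumes "ctl c g = (c', r, a, d)" "c \<noteq> SKIP" "regs c \<subseteq> {..<K}" "\<forall>i<K. g i < 3" "0 < K"
  shows "r < K \<and> a < 3"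
  using assms
proof (induction c arbitrary: c')
  case (Seq c1 c2)
  then show ?case by (auto split: if_splits prod.splits)
qed (auto simp: symbol_def split: if_splits)

section \<open>Compilation of stack programs into Turing machines\<close>

definition enum :: "com \<Rightarrow> com \<Rightarrow> nat" where
  "enum c0 = (SOME h. bij_betw h (residuals c0) {0..<card (residuals c0)})"

lemma enum: "bij_betw (enum c0) (residuals c0) {0..<card (residuals c0)}"
  unfolding enum_def by (rule someI_ex[OF ex_bij_betw_finite_nat[OF finite_residuals]])

text \<open>Numbers below \<open>N\<close> are residual programs, \<open>N\<close> and
  \<open>N + 1\<close> the halting states. From the residual \<open>SKIP\<close> one further step
  turns the top of register \<open>out\<close> into the verdict; this is the extra step in
  \<open>tm_of_correct\<close>.\<close>

definition tm_of :: "com \<Rightarrow> nat \<Rightarrow> nat \<Rightarrow> tm" where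
  "tm_of c0 K out = (let N = card (residuals c0) in
     \<lparr>tapes = K, nstates = N + 2, nsymbols = 3, start = enum c0 c0, accept = N, reject = N + 1,
      delta = (\<lambda>q ss.
        if q < N then
          (let c = inv_into (residuals c0) (enum c0) q; stay = map (\<lambda>a. (a, Stay)) ss in
           if c = SKIP then (if ss ! out = 0 then N + 1 else N, stay)
           else (case ctl c (\<lambda>i. ss ! i) of (c', r, a) \<Rightarrow> (enum c0 c', stay[r := a])))
        else (q, map (\<lambda>a. (a, Stay)) ss))\<rparr>)"

lemma enum_less: "c \<in> residuals c0 \<Longrightarrow> enum c0 c < card (residuals c0)"
  using bij_betwE[OF enum, of c0] by auto

lemma inv_enum: "c \<in> residuals c0 \<Longrightarrow> inv_into (residuals c0) (enum c0) (enum c0 c) = c"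
  using enum bij_betw_imp_inj_on inv_into_f_f by metis

lemma inv_enum_in: "q < card (residuals c0) \<Longrightarrow> inv_into (residuals c0) (enum c0) q \<in> residuals c0"
  using enum[of c0] by (metis atLeastLessThan_iff bij_betw_imp_surj_on inv_into_into le0)

lemma wf_tm_of:
  assumes "regs c0 \<subseteq> {..<K}" "2 \<le> K" "out < K"
  shows "wf_tm (tm_of c0 K out)"
proof -
  let ?N = "card (residuals c0)"
  have main: "case delta (tm_of c0 K out) q ss of (q', as) \<Rightarrow>
      q' < ?N + 2 \<and> length as = K \<and> (\<forall>(a, d)\<in>set as. a < 3)"
    if "q < ?N + 2" "length ss = K" "\<forall>a\<in>set ss. a < 3" for q ss
  proof (cases "q < ?N")
    case True
    define c where "c = inv_into (residuals c0) (enum c0) q"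
    have c: "c \<in> residuals c0" using inv_enum_in[OF True] by (simp add: c_def)
    show ?thesis
    proof (cases "c = SKIP")
      case T: True
      then show ?thesis using that True by (auto simp: tm_of_def Let_def c_def)
    next
      case False
      obtain c' r a d where ct: "ctl c (\<lambda>i. ss ! i) = (c', r, a, d)" by (metis surj_pair)
      have "r < K \<and> a < 3"
        using ct False residuals_regs[OF c] assms that by (intro ctl_wf[of c]) auto
      moreover have "c' \<in> residuals c0" using residuals_step[OF c, of "\<lambda>i. ss ! i"] ct by simp
      then have "enum c0 c' < ?N" by (rule enum_less)
      ultimately show ?thesis
        using that True False ct set_update_subset_insert
        by (fastforce simp: tm_of_def Let_def c_def[symmetric])
    qed
  next
    case False
    then show ?thesis using that by (auto simp: tm_of_def Let_def)
  qed
  show ?thesis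
    unfolding wf_tm_def using main assms enum_less[OF residuals_refl[of c0]]
    by (auto simp: tm_of_def Let_def)
qed

lemma step_tm_of:
  assumes c: "c \<in> residuals c0" and st: "cstep (c, ts) (c', ts')"
    and K: "regs c0 \<subseteq> {..<K}" "length ts = K" "0 < K" "\<forall>i<K. read (ts ! i) < 3"
  shows "step (tm_of c0 K out) (enum c0 c, ts) = (enum c0 c', ts') \<and> c' \<in> residuals c0"
proof -
  let ?N = "card (residuals c0)"
  have ns: "c \<noteq> SKIP" using st by (simp add: cstep_def)
  obtain r a d where ct: "ctl c (\<lambda>i. read (ts ! i)) = (c', r, a, d)"
    and ts': "ts' = ts[r := act (a, d) (ts ! r)]"
    using st by (auto simp: cstep_def split: prod.splits)
  have r: "r < K" using ctl_wf[OF ct ns _ K(4)] residuals_regs[OF c] K by auto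
  have c': "c' \<in> residuals c0" using residuals_step[OF c, of "\<lambda>i. read (ts ! i)"] ct by simp
  have regs: "regs c \<subseteq> {..<K}" using residuals_regs[OF c] K by auto
  \<comment> \<open>The action depends only on the symbols of the registers of the command and, for
    steps that concern no register, on tape 0; here \<open>0 < K\<close> enters.\<close>
  have ctl_cong: "ctl d g = ctl d g'" if "regs d \<subseteq> {..<K}" "\<forall>i<K. g i = g' i" for d g g'
    using that K(3) by (induction d) auto
  have ct2: "ctl c (\<lambda>i. map read ts ! i) = (c', r, a, d)"
    using ct ctl_cong[OF regs, of "\<lambda>i. map read ts ! i" "\<lambda>i. read (ts ! i)"] K by simp
  have upd: "map2 act ((map (\<lambda>a. (a, Stay)) (map read ts))[r := (a, d)]) ts = ts'"
    unfolding ts' using r K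
    by (intro nth_equalityI) (auto simp: act_stay nth_list_update simp del: act.simps)
  have q: "enum c0 c < ?N" by (rule enum_less[OF c])
  have "delta (tm_of c0 K out) (enum c0 c) (map read ts) =
      (enum c0 c', (map (\<lambda>a. (a, Stay)) (map read ts))[r := (a, d)])"
    using q ns ct2 inv_enum[OF c] by (simp add: tm_of_def Let_def)
  then show ?thesis
    using q upd c' by (simp add: tm_of_def Let_def)
qed

lemma csteps_tm_of:
  assumes "(cstep ^^ t) (c0, ts) (c', ts')" and K: "regs c0 \<subseteq> {..<K}" "0 < K"
    and ts: "length ts = K" "\<forall>T\<in>set ts. \<forall>i. fst T i < 3"
  shows "(step (tm_of c0 K out) ^^ t) (enum c0 c0, ts) = (enum c0 c', ts') \<and> c' \<in> residuals c0 \<and>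
    length ts' = K \<and> (\<forall>T\<in>set ts'. \<forall>i. fst T i < 3)"
  using assms(1)
proof (induction t arbitrary: c' ts')
  case 0
  then show ?case using ts residuals_refl by auto
next
  case (Suc t)
  then obtain c1 ts1 where y: "(cstep ^^ t) (c0, ts) (c1, ts1)" and st: "cstep (c1, ts1) (c', ts')"
    by auto
  note IH = Suc.IH[OF y]
  have rd: "\<forall>i<K. read (ts1 ! i) < 3"
    using IH by (metis fst_conv nth_mem read.elims)
  have s: "step (tm_of c0 K out) (enum c0 c1, ts1) = (enum c0 c', ts') \<and> c' \<in> residuals c0"
    using IH st K rd by (intro step_tm_of) auto
  obtain r a d where ct: "ctl c1 (\<lambda>i. read (ts1 ! i)) = (c', r, a, d)"
    and ts': "ts' = ts1[r := act (a, d) (ts1 ! r)]" and ns: "c1 \<noteq> SKIP"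
    using st by (auto simp: cstep_def split: prod.splits)
  have ra: "r < K" "a < 3" 
    using ctl_wf[OF ct ns _ rd] residuals_regs[of c1 c0] IH K by auto
  have "\<forall>i. fst (act (a, d) (ts1 ! r)) i < 3"
    using IH ra nth_mem[of r ts1] by (cases "ts1 ! r") fastforce
  then have "\<forall>T\<in>set ts'. \<forall>i. fst T i < 3"
    using IH set_update_subset_insert[of ts1 r] unfolding ts' by blast
  then show ?case using s IH ts' by simp
qed

lemma step_halted:
  "fst x = accept M \<or> fst x = reject M \<Longrightarrow> (step M ^^ t) x = x"
  by (induction t) (cases x, auto)+

lemma tm_of_correct:
  fixes x u :: "bool list"
  defines "s0 \<equiv> (\<lambda>i. if i = 0 then x else if i = 1 then u else [])"
  assumes ex: "exec c0 s0 t s'" and K: "regs c0 \<subseteq> {..<K}" "2 \<le> K" "out < K"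
  shows "\<exists>n\<le>t. halts_within (tm_of c0 K out) x u (n + 1)"
    and "accepts (tm_of c0 K out) x u \<longleftrightarrow> s' out \<noteq> []"
proof -
  let ?M = "tm_of c0 K out" and ?N = "card (residuals c0)"
  define ts where "ts = tape_of x # tape_of u # replicate (K - 2) (tape_of [])"
  have tr: "tape_rep (tape_of w) w" for w
    by (auto simp: tape_rep_def tape_of_def symbol_def)
  have rep: "rep K ts s0"
    using tr K by (auto simp: rep_def ts_def s0_def nth_Cons')
  obtain n ts' where n: "n \<le> t" and ts': "rep K ts' s'" "(cstep ^^ n) (c0, ts) (SKIP, ts')"
    using execE[OF ex K(1) rep] .
  have 1: "(step ?M ^^ n) (init ?M x u) = (enum c0 SKIP, ts')" "SKIP \<in> residuals c0" "length ts' = K"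
    using csteps_tm_of[OF ts'(2) K(1), of out] K
    by (auto simp: init_def ts_def tape_of_def tm_of_def Let_def)
  have q: "enum c0 SKIP < ?N" by (rule enum_less[OF 1(2)])
  have rd: "read (ts' ! out) = 0 \<longleftrightarrow> s' out = []"
    using ts'(1) K read_tape_rep[of "ts' ! out" "s' out"]
    by (auto simp: rep_def symbol_def split: list.splits)
  have out: "map read ts' ! out = read (ts' ! out)" using 1(3) K by simp
  define h where "h = (if s' out = [] then ?N + 1 else ?N)"
  have "fst (delta ?M (enum c0 SKIP) (map read ts')) = h"
    using q inv_enum[OF 1(2)] rd out by (simp add: tm_of_def Let_def h_def)
  moreover have "accept ?M = ?N" "reject ?M = ?N + 1" by (simp_all add: tm_of_def Let_def)
  ultimately have fin: "fst ((step ?M ^^ (n + 1)) (init ?M x u)) = h"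
    using 1(1) q by (auto split: prod.splits)
  have halt: "h = accept ?M \<or> h = reject ?M"
    by (auto simp: h_def tm_of_def Let_def)
  then show "\<exists>n\<le>t. halts_within ?M x u (n + 1)"
    using fin n unfolding halts_within_def by (intro exI[of _ n]) simp
  \<comment> \<open>Halting configurations are fixed points and iterates commute, so an accepting
    time and time \<open>n + 1\<close> give the same configuration.\<close>
  have "s' out \<noteq> []" if a: "fst ((step ?M ^^ t1) (init ?M x u)) = accept ?M" for t1
  proof -
    have "(step ?M ^^ (n + 1)) ((step ?M ^^ t1) (init ?M x u)) = (step ?M ^^ t1) (init ?M x u)"
      by (rule step_halted) (use a in simp)
    moreover have "(step ?M ^^ t1) ((step ?M ^^ (n + 1)) (init ?M x u)) = (step ?M ^^ (n + 1)) (init ?M x u)"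
      by (rule step_halted) (use fin halt in simp)
    ultimately have "h = accept ?M"
      using fin a by (metis add.commute comp_apply funpow_add)
    then show ?thesis by (auto simp: h_def tm_of_def Let_def split: if_splits)
  qed
  moreover have "h = accept ?M" if "s' out \<noteq> []"
    using that by (simp add: h_def tm_of_def Let_def)
  ultimately show "accepts ?M x u \<longleftrightarrow> s' out \<noteq> []"
    unfolding accepts_def using fin by blast
qed

text \<open>The stores \<open>S i\<close> form a loop invariant with a counter. A round costs two
  steps beyond its body, one for the test and one for discarding the finished \<open>SKIP\<close>;
  the last \<open>+ 1\<close> is the failing test.\<close>

lemma exec_While:
  assumes "\<And>i. i < n \<Longrightarrow> S i r \<noteq> []" "\<And>i. i < n \<Longrightarrow> exec c (S i) B (S (Suc i))" "S n r = []"
    "n * (B + 2) + 1 \<le> t"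
  shows "exec (While r c) (S 0) t (S n)"
proof -
  have "exec (While r c) (S i) ((n - i) * (B + 2) + 1) (S n)" if "i \<le> n" for i
    using that
  proof (induction i rule: inc_induct)
    case base
    then show ?case using assms(3) by (intro exec_While_Nil) simp_all
  next
    case (step i)
    have "n - i = Suc (n - Suc i)" using step by simp
    then have "1 + (B + 1 + ((n - Suc i) * (B + 2) + 1)) \<le> (n - i) * (B + 2) + 1" by simp
    with assms(1,2)[OF step(2)] step.IH show ?case by (rule exec_While_step)
  qed
  from this[of 0] show ?thesis using assms(4) exec_mono by force
qed

section \<open>Clearing, moving and copying registers\<close>

definition clear :: "nat \<Rightarrow> com" where
  "clear r = While r (Pop r)"

lemma exec_clear:
  assumes "s' = s(r := [])" "3 * length (s r) + 1 \<le> t"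
  shows "exec (clear r) s t s'"
proof -
  have "exec (While r (Pop r)) ((\<lambda>i. s(r := drop i (s r))) 0) t ((\<lambda>i. s(r := drop i (s r))) (length (s r)))"
    by (rule exec_While[where B = 1]) (use assms in \<open>auto intro!: exec_Pop simp: drop_Suc tl_drop\<close>)
  then show ?thesis using assms by (simp add: clear_def)
qed

definition pour :: "nat \<Rightarrow> nat \<Rightarrow> com" where
  "pour a b = While a (Case a SKIP (Pop a ;; Push b False) (Pop a ;; Push b True))"

definition pour2 :: "nat \<Rightarrow> nat \<Rightarrow> nat \<Rightarrow> com" where
  "pour2 a b c = While a (Case a SKIP (Pop a ;; Push b False ;; Push c False)
     (Pop a ;; Push b True ;; Push c True))"

lemma rev_take_Suc: "drop i w = x # v \<Longrightarrow> rev (take (Suc i) w) = x # rev (take i w) \<and> drop (Suc i) w = v"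
  by (metis Cons_nth_drop_Suc drop_eq_Nil2 leI list.distinct(1) list.inject rev.simps(2) rev_rev_ident
      rev_swap take_Suc_conv_app_nth)

lemma exec_pop_push:
  assumes "a \<noteq> b" "s a = x # v" "s' = s(a := v, b := x # s b)"
  shows "exec (Pop a ;; Push b x) s 4 s'"
  by (rule exec_Seq[OF exec_Pop[OF refl order_refl] exec_Push[OF _ order_refl]])
    (use assms(1,2) in \<open>simp_all add: assms(3)\<close>)

lemma exec_pop_push2:
  assumes "a \<noteq> b" "a \<noteq> c" "b \<noteq> c" "s a = x # v" "s' = s(a := v, b := x # s b, c := x # s c)"
  shows "exec (Pop a ;; Push b x ;; Push c x) s 7 s'"
  by (rule exec_Seq[OF exec_Pop[OF refl order_refl]
        exec_Seq[OF exec_Push[OF refl order_refl] exec_Push[OF _ order_refl] order_refl]])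
    (use assms(1-4) in \<open>simp_all add: assms(5)\<close>)

lemma exec_pour:
  assumes "a \<noteq> b" "s' = s(a := [], b := rev (s a) @ s b)" "7 * length (s a) + 1 \<le> t"
  shows "exec (pour a b) s t s'"
proof -
  define S where "S = (\<lambda>i. s(a := drop i (s a), b := rev (take i (s a)) @ s b))"
  have "exec (pour a b) (S 0) t (S (length (s a)))"
    unfolding pour_def
  proof (rule exec_While[where B = 5])
    fix i assume i: "i < length (s a)"
    show ne: "S i a \<noteq> []" using i assms by (simp add: S_def)
    have st: "S i a = x # v \<Longrightarrow> S (Suc i) = (S i)(a := v, b := x # S i b)" for x v
      using assms(1) rev_take_Suc[of i "s a" x v] by (auto simp: S_def fun_eq_iff)
    show "exec (Case a SKIP (Pop a ;; Push b False) (Pop a ;; Push b True)) (S i) 5 (S (Suc i))"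
    proof (rule exec_Case[where ?t1.0 = 4])
      show "exec (Pop a ;; Push b False) (S i) 4 (S (Suc i))" if "S i a = False # w" for w
        using st that assms(1) by (intro exec_pop_push)
      show "exec (Pop a ;; Push b True) (S i) 4 (S (Suc i))" if "S i a = True # w" for w
        using st that assms(1) by (intro exec_pop_push)
    qed (use ne in auto)
  qed (use assms in \<open>simp_all add: S_def\<close>)
  moreover have "S 0 = s" "S (length (s a)) = s'" using assms by (auto simp: S_def)
  ultimately show ?thesis by simp
qed

lemma exec_pour2:
  assumes "a \<noteq> b" "a \<noteq> c" "b \<noteq> c" "s' = s(a := [], b := rev (s a) @ s b, c := rev (s a) @ s c)"
    "10 * length (s a) + 1 \<le> t"
  shows "exec (pour2 a b c) s t s'"
proof -
  define S where "S = (\<lambda>i. s(a := drop i (s a), b := rev (take i (s a)) @ s b, c := rev (take i (s a)) @ s c))"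
  have "exec (pour2 a b c) (S 0) t (S (length (s a)))"
    unfolding pour2_def
  proof (rule exec_While[where B = 8])
    fix i assume i: "i < length (s a)"
    show ne: "S i a \<noteq> []" using i assms by (simp add: S_def)
    have st: "S i a = x # v \<Longrightarrow> S (Suc i) = (S i)(a := v, b := x # S i b, c := x # S i c)" for x v
      using assms(1-3) rev_take_Suc[of i "s a" x v] by (auto simp: S_def fun_eq_iff)
    show "exec (Case a SKIP (Pop a ;; Push b False ;; Push c False)
        (Pop a ;; Push b True ;; Push c True)) (S i) 8 (S (Suc i))"
    proof (rule exec_Case[where ?t1.0 = 7])
      show "exec (Pop a ;; Push b False ;; Push c False) (S i) 7 (S (Suc i))" if "S i a = False # w" for w
        using st that assms(1-3) by (intro exec_pop_push2)
      show "exec (Pop a ;; Push b True ;; Push c True) (S i) 7 (S (Suc i))" if "S i a = True # w" for w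
        using st that assms(1-3) by (intro exec_pop_push2)
    qed (use ne in auto)
  qed (use assms in \<open>simp_all add: S_def\<close>)
  moreover have "S 0 = s" "S (length (s a)) = s'" using assms by (auto simp: S_def)
  ultimately show ?thesis by simp
qed

text \<open>A pour reverses a stack, so two of them preserve the order; the second one refills the
  source together with the copy.\<close>

lemma exec_copy:
  assumes "a \<noteq> b" "a \<noteq> c" "b \<noteq> c" "s b = []" "s c = []" "s' = s(b := s a)"
    "17 * length (s a) + 3 \<le> t"
  shows "exec (pour a c ;; pour2 c a b) s t s'"
proof (rule exec_Seq)
  let ?s = "s(a := [], c := rev (s a) @ s c)"
  show "exec (pour a c) s (7 * length (s a) + 1) ?s"
    using assms(2) by (rule exec_pour) simp_all
  have "s' = ?s(c := [], a := rev (?s c) @ ?s a, b := rev (?s c) @ ?s b)"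
    unfolding assms(6) by (rule ext) (use assms(1-5) in auto)
  then show "exec (pour2 c a b) ?s (10 * length (s a) + 1) s'"
    using assms(1-5) by (intro exec_pour2) simp_all
qed (use assms(7) in simp)

lemma exec_move:
  assumes "a \<noteq> b" "a \<noteq> c" "b \<noteq> c" "s b = []" "s c = []" "s' = s(a := [], b := s a)"
    "14 * length (s a) + 3 \<le> t"
  shows "exec (pour a c ;; pour c b) s t s'"
proof (rule exec_Seq)
  let ?s = "s(a := [], c := rev (s a) @ s c)"
  show "exec (pour a c) s (7 * length (s a) + 1) ?s"
    using assms(2) by (rule exec_pour) simp_all
  have "s' = ?s(c := [], b := rev (?s c) @ ?s b)"
    unfolding assms(6) by (rule ext) (use assms(1-5) in auto)
  then show "exec (pour c b) ?s (7 * length (s a) + 1) s'"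
    using assms(1-5) by (intro exec_pour) simp_all
qed (use assms(7) in simp)

section \<open>Polynomial-time functions\<close>

lemma poly_nat_mono: "m \<le> n \<Longrightarrow> poly (p :: nat poly) m \<le> poly p n"
  by (induction p) (auto intro!: add_mono mult_mono)

lemma poly_nat_le_pcompose: "m \<le> poly q n \<Longrightarrow> poly p m \<le> poly (pcompose p q :: nat poly) n"
  by (simp add: poly_pcompose poly_nat_mono)

section \<open>Polynomial bounds in finitely many variables\<close>

type_synonym env = "nat \<Rightarrow> bool list"

text \<open>An environment has infinitely many variables, but a function of interest depends on
  finitely many; a bound therefore refers to the first \<open>k\<close> only.\<close>

definition upto_bound :: "nat \<Rightarrow> env \<Rightarrow> nat \<Rightarrow> bool" where
  "upto_bound k e n \<longleftrightarrow> (\<forall>i<k. length (e i) \<le> n)"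

definition pbound :: "(env \<Rightarrow> nat) \<Rightarrow> bool" where
  "pbound B \<longleftrightarrow> (\<exists>k (p :: nat poly). \<forall>e n. upto_bound k e n \<longrightarrow> B e \<le> poly p n)"

lemma upto_bound_mono: "upto_bound k e n \<Longrightarrow> k' \<le> k \<Longrightarrow> n \<le> n' \<Longrightarrow> upto_bound k' e n'"
  unfolding upto_bound_def by (meson le_trans less_le_trans)

lemma pbound_const: "pbound (\<lambda>_. c)"
  unfolding pbound_def by (rule exI[of _ 0], rule exI[of _ "[:c:]"]) simp

lemma pbound_binop:
  assumes "pbound A" "pbound B"
    and h: "\<And>p q :: nat poly. \<exists>r. \<forall>n. h (poly p n) (poly q n) \<le> poly r n"
    and mono: "\<And>x x' y y' :: nat. x \<le> x' \<Longrightarrow> y \<le> y' \<Longrightarrow> h x y \<le> h x' y'"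
  shows "pbound (\<lambda>e. h (A e) (B e))"
proof -
  obtain k p k' q where pq: "\<And>e n. upto_bound k e n \<Longrightarrow> A e \<le> poly p n"
    "\<And>e n. upto_bound k' e n \<Longrightarrow> B e \<le> poly q n"
    using assms unfolding pbound_def by blast
  obtain r where r: "\<And>n. h (poly p n) (poly q n) \<le> poly r n" using h by blast
  have "h (A e) (B e) \<le> poly r n" if "upto_bound (max k k') e n" for e n
    using upto_bound_mono[OF that] by (intro order_trans[OF mono[OF pq] r]) simp_all
  then show ?thesis unfolding pbound_def by blast
qed

lemma pbound_add: "pbound A \<Longrightarrow> pbound B \<Longrightarrow> pbound (\<lambda>e. A e + B e)"
  by (rule pbound_binop) (auto intro: exI[of _ "_ + _"] add_mono)

lemma pbound_mult: "pbound A \<Longrightarrow> pbound B \<Longrightarrow> pbound (\<lambda>e. A e * B e)"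
  by (rule pbound_binop) (auto intro: exI[of _ "_ * _"] mult_mono)

lemma pbound_mono: "pbound A \<Longrightarrow> (\<And>e. B e \<le> A e) \<Longrightarrow> pbound B"
  unfolding pbound_def by (meson le_trans)

text \<open>The program is required for every assignment \<open>loc\<close> of registers to variables and every choice
  of the output register \<open>m\<close> above them, with the registers from \<open>m\<close> on as scratch space: this makes
  programs composable.\<close>

definition realizes :: "(env \<Rightarrow> bool list) \<Rightarrow> (env \<Rightarrow> nat) \<Rightarrow> bool" where
  "realizes f A \<longleftrightarrow> (\<forall>loc m. (\<forall>i. loc i < m) \<longrightarrow> (\<exists>c. \<forall>s. (\<forall>j\<ge>m. s j = []) \<longrightarrow>
     exec c s (A (s \<circ> loc)) (s(m := f (s \<circ> loc)))))"

definition ptime :: "(env \<Rightarrow> bool list) \<Rightarrow> bool" where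
  "ptime f \<longleftrightarrow> pbound (\<lambda>e. length (f e)) \<and> (\<exists>A. pbound A \<and> realizes f A)"

lemma pbound_ptime: "ptime f \<Longrightarrow> pbound (\<lambda>e. length (f e))"
  by (simp add: ptime_def)

lemma ptimeI:
  assumes "pbound (\<lambda>e. length (f e))" "pbound A"
    and "\<And>loc m. (\<forall>i. loc i < m) \<Longrightarrow>
      \<exists>c. \<forall>s. (\<forall>j\<ge>m. s j = []) \<longrightarrow> exec c s (A (s \<circ> loc)) (s(m := f (s \<circ> loc)))"
  shows "ptime f"
  using assms unfolding ptime_def realizes_def by blast

lemma realizesE:
  assumes "realizes f A" "\<forall>i. loc i < m"
  obtains c where "\<And>s. (\<forall>j\<ge>m. s j = []) \<Longrightarrow> exec c s (A (s \<circ> loc)) (s(m := f (s \<circ> loc)))"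
  using assms unfolding realizes_def by blast

text \<open>Output length and running time are bounded separately in \<open>ptime\<close>; their sum
  serves as both bounds in the constructions below.\<close>

lemma ptimeE:
  assumes "ptime f"
  obtains A where "pbound A" "\<And>e. length (f e) \<le> A e" "realizes f A"
proof -
  obtain A where A: "pbound A" "realizes f A"
    using assms unfolding ptime_def by blast
  show thesis
  proof (rule that[of "\<lambda>e. length (f e) + A e"])
    show "pbound (\<lambda>e. length (f e) + A e)"
      by (intro pbound_add pbound_ptime assms A)
    show "realizes f (\<lambda>e. length (f e) + A e)"
      using A(2) unfolding realizes_def by (meson exec_mono le_add2)
  qed simp
qed

section \<open>Closure properties of polynomial-time functions\<close>

lemma pbound_var: "pbound (\<lambda>e. length (e i))"
  unfolding pbound_def upto_bound_def
  by (rule exI[of _ "Suc i"], rule exI[of _ "[:0, 1:]"]) simp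

lemma ptime_var: "ptime (\<lambda>e. e i)"
proof (rule ptimeI[where A = "\<lambda>e. 17 * length (e i) + 3"])
  fix loc :: "nat \<Rightarrow> nat" and m assume "\<forall>j. loc j < m"
  then have "loc i < m" by blast
  then show "\<exists>c. \<forall>s. (\<forall>j\<ge>m. s j = []) \<longrightarrow> exec c s (17 * length ((s \<circ> loc) i) + 3) (s(m := (s \<circ> loc) i))"
    by (intro exI[of _ "pour (loc i) (Suc m) ;; pour2 (Suc m) (loc i) m"] allI impI exec_copy) auto
qed (intro pbound_add pbound_mult pbound_const pbound_var)+

lemma ptime_Nil: "ptime (\<lambda>_. [])"
  by (rule ptimeI[where A = "\<lambda>_. 0"])
    (auto intro!: pbound_const exI[of _ SKIP] simp: exec_SKIP fun_upd_idem)

lemma ptime_post: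
  assumes f: "ptime f" and d: "\<And>m s. exec (d m) s 2 (s(m := h (s m)))" and h: "\<And>w. length (h w) \<le> length w + 1"
  shows "ptime (\<lambda>e. h (f e))"
  using f
proof (rule ptimeE)
  fix A assume A: "pbound A" and c: "realizes f A"
  show ?thesis
  proof (rule ptimeI)
    show "pbound (\<lambda>e. length (h (f e)))"
      by (rule pbound_mono[OF pbound_add[OF pbound_ptime[OF f] pbound_const[of 1]]]) (rule h)
    show "pbound (\<lambda>e. A e + 1 + 2)" by (intro pbound_add pbound_const A)
    fix loc :: "nat \<Rightarrow> nat" and m assume "\<forall>i. loc i < m"
    from c this obtain c where
      c: "\<And>s. (\<forall>j\<ge>m. s j = []) \<Longrightarrow> exec c s (A (s \<circ> loc)) (s(m := f (s \<circ> loc)))"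
      by (rule realizesE) (rule that)
    show "\<exists>c. \<forall>s. (\<forall>j\<ge>m. s j = []) \<longrightarrow> exec c s (A (s \<circ> loc) + 1 + 2) (s(m := h (f (s \<circ> loc))))"
    proof (intro exI[of _ "c ;; d m"] allI impI)
      fix s :: store assume "\<forall>j\<ge>m. s j = []"
      from exec_Seq[OF c[OF this] d[of m] order_refl]
      show "exec (c ;; d m) s (A (s \<circ> loc) + 1 + 2) (s(m := h (f (s \<circ> loc))))" by simp
    qed
  qed
qed

lemma ptime_Cons: "ptime f \<Longrightarrow> ptime (\<lambda>e. b # f e)"
  by (rule ptime_post[where d = "\<lambda>m. Push m b"]) (auto intro: exec_Push)

lemma ptime_tl: "ptime f \<Longrightarrow> ptime (\<lambda>e. tl (f e))"
  by (rule ptime_post[where d = Pop]) (auto intro: exec_Pop)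

lemma pbound_rename:
  assumes "pbound B" shows "pbound (\<lambda>e. B (\<lambda>i. e (\<pi> i)))"
proof -
  obtain k p where p: "\<And>e n. upto_bound k e n \<Longrightarrow> B e \<le> poly p n"
    using assms unfolding pbound_def by blast
  have "B (\<lambda>i. e (\<pi> i)) \<le> poly p n" if "upto_bound (Suc (\<Sum>i<k. \<pi> i)) e n" for e n
  proof (rule p, unfold upto_bound_def, intro allI impI)
    fix i assume "i < k"
    then have "\<pi> i \<le> (\<Sum>i<k. \<pi> i)" by (intro member_le_sum) auto
    then show "length (e (\<pi> i)) \<le> n" using that by (simp add: upto_bound_def)
  qed
  then show ?thesis unfolding pbound_def by blast
qed

lemma ptime_rename:
  assumes "ptime f" shows "ptime (\<lambda>e. f (\<lambda>i. e (\<pi> i)))"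
  using assms
proof (rule ptimeE)
  fix A assume A: "pbound A" and
    c: "realizes f A"
  show ?thesis
  proof (rule ptimeI)
    show "pbound (\<lambda>e. length (f (\<lambda>i. e (\<pi> i))))"
      by (rule pbound_rename[OF pbound_ptime[OF assms]])
    show "pbound (\<lambda>e. A (\<lambda>i. e (\<pi> i)))"
      by (rule pbound_rename[OF A])
    fix loc :: "nat \<Rightarrow> nat" and m assume "\<forall>i. loc i < m"
    then show "\<exists>c. \<forall>s. (\<forall>j\<ge>m. s j = []) \<longrightarrow>
        exec c s (A (\<lambda>i. (s \<circ> loc) (\<pi> i))) (s(m := f (\<lambda>i. (s \<circ> loc) (\<pi> i))))"
      using realizesE[OF c, of "\<lambda>i. loc (\<pi> i)" m] by (simp add: comp_def) blast
  qed
qed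

definition econs :: "bool list \<Rightarrow> env \<Rightarrow> env" (infixr "##" 65) where
  "a ## e = case_nat a e"

lemma econs_simps [simp]: "(a ## e) 0 = a" "(a ## e) (Suc i) = e i" "(\<lambda>i. (a ## e) (Suc i)) = e"
  by (simp_all add: econs_def)

text \<open>Substituting a value of polynomially bounded length keeps bounds polynomial. The new
  bound may depend on the environment only, so the old polynomial is evaluated at the bound for the
  new value plus the lengths of the relevant variables.\<close>

lemma pbound_econs:
  assumes "pbound B" "pbound G"
  shows "\<exists>B'. pbound B' \<and> (\<forall>e w. length w \<le> G e \<longrightarrow> B (w ## e) \<le> B' e)"
proof -
  obtain k p k' q where p: "\<And>e n. upto_bound k e n \<Longrightarrow> B e \<le> poly p n"
    and q: "\<And>e n. upto_bound k' e n \<Longrightarrow> G e \<le> poly q n"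
    using assms unfolding pbound_def by metis
  define K where "K = max k k'"
  define B' where "B' = (\<lambda>e. poly p (G e + (\<Sum>i<K. length (e i))))"
  have ub: "length (e i) \<le> (\<Sum>i<K. length (e i))" if "i < K" for e :: env and i
    using that by (auto intro!: member_le_sum)
  have "B' e \<le> poly (p \<circ>\<^sub>p (q + [:0, K:])) n" if "upto_bound K e n" for e n
  proof -
    have "(\<Sum>i<K. length (e i)) \<le> K * n"
      using that sum_bounded_above[of "{..<K}" "\<lambda>i. length (e i)" n] by (simp add: upto_bound_def)
    moreover have "G e \<le> poly q n"
      using q[OF upto_bound_mono[OF that]] by (simp add: K_def)
    ultimately show ?thesis
      unfolding B'_def by (intro poly_nat_le_pcompose) (simp add: mult.commute)
  qed
  then have "pbound B'" unfolding pbound_def by blast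
  moreover have "B (w ## e) \<le> B' e" if "length w \<le> G e" for e w
    unfolding B'_def
  proof (rule p, unfold upto_bound_def, intro allI impI)
    fix i assume "i < k"
    then show "length ((w ## e) i) \<le> G e + (\<Sum>i<K. length (e i))"
    proof (cases i)
      case (Suc j)
      then have "j < K" using \<open>i < k\<close> by (simp add: K_def)
      then show ?thesis using ub[of j e] Suc by simp
    qed (use that in simp)
  qed
  ultimately show ?thesis by blast
qed

text \<open>The value of \<open>g\<close> stays in register \<open>m\<close> as variable 0 of the
  program for \<open>f\<close>, which writes to \<open>Suc m\<close>; afterwards \<open>m\<close> is
  cleared and the result is moved down.\<close>

lemma ptime_let:
  assumes f: "ptime f" and g: "ptime g"
  shows "ptime (\<lambda>e. f (g e ## e))"
proof -
  from f obtain A where A: "pbound A" "\<And>e. length (f e) \<le> A e" and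
    c: "realizes f A"
    by (rule ptimeE) (rule that)
  from g obtain A' where A': "pbound A'" "\<And>e. length (g e) \<le> A' e" and
    c': "realizes g A'"
    by (rule ptimeE) (rule that)
  obtain B where B0: "pbound B" "\<forall>e w. length w \<le> length (g e) \<longrightarrow> A (w ## e) \<le> B e"
    using pbound_econs[OF A(1) pbound_ptime[OF g]] by (elim exE conjE)
  then have B: "pbound B" "A (g e ## e) \<le> B e" for e
    by simp_all
  show ?thesis
  proof (rule ptimeI[where A = "\<lambda>e. A' e + B e + (3 * A' e + 1) + (14 * B e + 3) + 3"])
    show "pbound (\<lambda>e. length (f (g e ## e)))"
      by (rule pbound_mono[OF B(1)]) (rule le_trans[OF A(2) B(2)])
    show "pbound (\<lambda>e. A' e + B e + (3 * A' e + 1) + (14 * B e + 3) + 3)"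
      by (intro pbound_add pbound_mult pbound_const A' B)
    fix loc :: "nat \<Rightarrow> nat" and m assume l: "\<forall>i. loc i < m"
    obtain c1 where c1: "\<And>s. (\<forall>j\<ge>m. s j = []) \<Longrightarrow> exec c1 s (A' (s \<circ> loc)) (s(m := g (s \<circ> loc)))"
      by (rule realizesE[OF c' l]) (rule that)
    define loc' where "loc' = case_nat m loc"
    have "\<forall>i. loc' i < Suc m"
      using l by (auto simp: loc'_def less_Suc_eq split: nat.splits)
    from realizesE[OF c this] obtain c2 where c2: "\<And>s. (\<forall>j\<ge>Suc m. s j = []) \<Longrightarrow> exec c2 s (A (s \<circ> loc')) (s(Suc m := f (s \<circ> loc')))"
      by blast
    show "\<exists>c. \<forall>s. (\<forall>j\<ge>m. s j = []) \<longrightarrow> exec c s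
       (A' (s \<circ> loc) + B (s \<circ> loc) + (3 * A' (s \<circ> loc) + 1) + (14 * B (s \<circ> loc) + 3) + 3)
       (s(m := f (g (s \<circ> loc) ## (s \<circ> loc))))"
    proof (intro exI[of _ "c1 ;; c2 ;; clear m ;; pour (Suc m) (Suc (Suc m)) ;; pour (Suc (Suc m)) m"] allI impI)
      fix s :: store assume s: "\<forall>j\<ge>m. s j = []"
      let ?e = "s \<circ> loc"
      define s1 where "s1 = s(m := g ?e)"
      have e1: "s1 \<circ> loc' = g ?e ## ?e"
        using l less_irrefl by (fastforce simp: s1_def loc'_def econs_def fun_eq_iff split: nat.splits)
      define s2 where "s2 = s1(Suc m := f (g ?e ## ?e))"
      define s3 where "s3 = s2(m := [])"
      have 1: "exec c1 s (A' ?e) s1" unfolding s1_def by (rule c1[OF s])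
      have 2: "exec c2 s1 (B ?e) s2"
      proof -
        have "\<forall>j\<ge>Suc m. s1 j = []" using s by (simp add: s1_def)
        from c2[OF this] have "exec c2 s1 (A (g ?e ## ?e)) s2"
          by (simp only: e1 s2_def)
        then show ?thesis by (rule exec_mono) (rule B(2))
      qed
      have 3: "exec (clear m) s2 (3 * A' ?e + 1) s3"
        by (rule exec_clear) (use A' in \<open>auto simp: s3_def s2_def s1_def\<close>)
      have le: "length (f (g ?e ## ?e)) \<le> B ?e"
        using A(2)[of "g ?e ## ?e"] B(2)[of ?e] by simp
      have 4: "exec (pour (Suc m) (Suc (Suc m)) ;; pour (Suc (Suc m)) m) s3 (14 * B ?e + 3) (s(m := f (g ?e ## ?e)))"
        by (rule exec_move) (use s le in \<open>auto simp: s3_def s2_def s1_def fun_eq_iff\<close>)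
      show "exec (c1 ;; c2 ;; clear m ;; pour (Suc m) (Suc (Suc m)) ;; pour (Suc (Suc m)) m) s
         (A' ?e + B ?e + (3 * A' ?e + 1) + (14 * B ?e + 3) + 3) (s(m := f (g ?e ## ?e)))"
        by (rule exec_Seq[OF 1 exec_Seq[OF 2 exec_Seq[OF 3 4 order_refl] order_refl]]) simp
    qed
  qed
qed

lemma ptime_case:
  assumes f: "ptime f" and g: "ptime g" "ptime h"
  shows "ptime (\<lambda>e. if f e \<noteq> [] \<and> hd (f e) then g e else h e)" (is "ptime ?r")
proof -
  from f obtain A where A: "pbound A" "\<And>e. length (f e) \<le> A e" and c: "realizes f A"
    by (rule ptimeE) (rule that)
  from g(1) obtain A1 where A1: "pbound A1" "\<And>e. length (g e) \<le> A1 e" and c1: "realizes g A1"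
    by (rule ptimeE) (rule that)
  from g(2) obtain A2 where A2: "pbound A2" "\<And>e. length (h e) \<le> A2 e" and c2: "realizes h A2"
    by (rule ptimeE) (rule that)
  define D where "D = (\<lambda>e. A1 e + A2 e)"
  define T where "T = (\<lambda>e. A e + 1 + (1 + ((3 * A e + 1) + 1 + D e)))"
  have D: "pbound D" "\<And>e. A1 e \<le> D e" "\<And>e. A2 e \<le> D e"
    unfolding D_def using A1 A2 by (auto intro!: pbound_add)
  show ?thesis
  proof (rule ptimeI)
    have "length (?r e) \<le> D e" for e
      using A1(2)[of e] A2(2)[of e] by (simp add: D_def)
    then show "pbound (\<lambda>e. length (?r e))" by (rule pbound_mono[OF D(1)])
    show "pbound T" unfolding T_def by (intro pbound_add pbound_mult pbound_const A D)
    fix loc :: "nat \<Rightarrow> nat" and m assume l: "\<forall>i. loc i < m"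
    obtain b where b: "\<And>s. (\<forall>j\<ge>m. s j = []) \<Longrightarrow> exec b s (A (s \<circ> loc)) (s(m := f (s \<circ> loc)))"
      by (rule realizesE[OF c l]) (rule that)
    obtain b1 where b1: "\<And>s. (\<forall>j\<ge>m. s j = []) \<Longrightarrow> exec b1 s (A1 (s \<circ> loc)) (s(m := g (s \<circ> loc)))"
      by (rule realizesE[OF c1 l]) (rule that)
    obtain b2 where b2: "\<And>s. (\<forall>j\<ge>m. s j = []) \<Longrightarrow> exec b2 s (A2 (s \<circ> loc)) (s(m := h (s \<circ> loc)))"
      by (rule realizesE[OF c2 l]) (rule that)
    define C where "C = Case m (clear m ;; b2) (clear m ;; b2) (clear m ;; b1)"
    show "\<exists>c. \<forall>s. (\<forall>j\<ge>m. s j = []) \<longrightarrow> exec c s (T (s \<circ> loc)) (s(m := ?r (s \<circ> loc)))"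
    proof (intro exI[of _ "b ;; C"] allI impI)
      fix s :: store assume s: "\<forall>j\<ge>m. s j = []"
      let ?e = "s \<circ> loc"
      define s1 where "s1 = s(m := f ?e)"
      have cl: "exec (clear m) s1 (3 * A ?e + 1) s"
        by (rule exec_clear) (use s A(2)[of ?e] in \<open>auto simp: s1_def fun_eq_iff\<close>)
      have br: "exec (clear m ;; b1) s1 ((3 * A ?e + 1) + 1 + D ?e) (s(m := g ?e))"
        "exec (clear m ;; b2) s1 ((3 * A ?e + 1) + 1 + D ?e) (s(m := h ?e))"
        by (rule exec_Seq[OF cl _ order_refl], rule exec_mono[OF _ D(2)], rule b1[OF s],
            rule exec_Seq[OF cl _ order_refl], rule exec_mono[OF _ D(3)], rule b2[OF s])
      have "exec C s1 (1 + ((3 * A ?e + 1) + 1 + D ?e)) (s(m := ?r ?e))"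
        unfolding C_def by (rule exec_Case[OF _ _ _ order_refl]) (use br in \<open>simp_all add: s1_def\<close>)
      then show "exec (b ;; C) s (T ?e) (s(m := ?r ?e))"
        unfolding T_def using b[OF s] s1_def by (intro exec_Seq[OF _ _ order_refl]) simp_all
    qed
  qed
qed

text \<open>The length of \<open>N e\<close> controls a loop. The bound \<open>B\<close> on all
  intermediate values is the point of bounded recursion: a polynomial-time step may double the
  length of its argument, and its iterates would then grow exponentially.\<close>

lemma ptime_rec:
  assumes N: "ptime N" and g: "ptime g" and h: "ptime (\<lambda>e. h (length (e 0)) (e (Suc 0)) (\<lambda>i. e (Suc (Suc i))))"
    and B: "pbound B" "\<And>e i. i \<le> length (N e) \<Longrightarrow> length (rec_nat (g e) (\<lambda>i r. h i r e) i) \<le> B e"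
  shows "ptime (\<lambda>e. rec_nat (g e) (\<lambda>i r. h i r e) (length (N e)))" (is "ptime ?f")
proof -
  from N obtain A where A: "pbound A" "\<And>e. length (N e) \<le> A e" and
    c: "realizes N A"
    by (rule ptimeE) (rule that)
  from g obtain A1 where A1: "pbound A1" "\<And>e. length (g e) \<le> A1 e" and
    c1: "realizes g A1"
    by (rule ptimeE) (rule that)
  define H where "H = (\<lambda>e. h (length (e 0)) (e (Suc 0)) (\<lambda>i. e (Suc (Suc i))))"
  from h have "ptime H" by (simp add: H_def)
  then obtain A2 where A2: "pbound A2" "\<And>e. length (H e) \<le> A2 e" and
    c2: "realizes H A2"
    by (rule ptimeE) (rule that)
  obtain B1 where B1: "pbound B1" "\<And>e w. length w \<le> length (N (\<lambda>i. e (Suc i))) \<Longrightarrow> A2 (w ## e) \<le> B1 e"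
    using pbound_econs[OF A2(1) pbound_rename[OF pbound_ptime[OF N], of Suc]] by blast
  obtain B2 where B2: "pbound B2" "\<And>e w. length w \<le> B e \<Longrightarrow> B1 (w ## e) \<le> B2 e"
    using pbound_econs[OF B1(1) B(1)] by blast
  define r where "r = (\<lambda>e. rec_nat (g e) (\<lambda>i r. h i r e))"
  have r: "r e 0 = g e" "r e (Suc i) = H (replicate i True ## r e i ## e)" for e i
    by (simp_all add: r_def H_def)
  have rB: "length (r e i) \<le> B e" if "i \<le> length (N e)" for e i
    using B(2)[OF that] by (simp add: r_def)
  have hB: "A2 (replicate i True ## r e i ## e) \<le> B2 e" if "i \<le> length (N e)" for e i
    using B1(2)[of "replicate i True" "r e i ## e"] B2(2)[OF rB[OF that]] that
    by (simp add: le_trans)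
  define T3 where "T3 = (\<lambda>e. 1 + 1 + (B2 e + 1 + ((3 * B e + 1) + 1 + ((14 * B e + 3) + 1 + 2))))"
  define T where "T = (\<lambda>e. A e + 1 + (A1 e + 1 + ((A e * (T3 e + 2) + 1) + 1 + ((3 * A e + 1) + 1 + (14 * B e + 3)))))"
  show ?thesis
  proof (rule ptimeI)
    show "pbound (\<lambda>e. length (?f e))" by (rule pbound_mono[OF B(1)]) (use B(2) in simp)
    show "pbound T" unfolding T_def T3_def by (intro pbound_add pbound_mult pbound_const A A1 B B2)
    fix loc :: "nat \<Rightarrow> nat" and m assume l: "\<forall>i. loc i < m"
    \<comment> \<open>\<open>m\<close> holds the remaining counter, \<open>m1\<close> the
      accumulator, \<open>m2\<close> the index in unary and \<open>m3\<close> the next value, which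
      is moved to \<open>m1\<close> by way of \<open>m4\<close>.\<close>
    define m1 m2 m3 m4 where ms: "m1 = Suc m" "m2 = Suc m1" "m3 = Suc m2" "m4 = Suc m3"
    define loc' where "loc' = case_nat m2 (case_nat m1 loc)"
    obtain b where b: "\<And>s. (\<forall>j\<ge>m. s j = []) \<Longrightarrow> exec b s (A (s \<circ> loc)) (s(m := N (s \<circ> loc)))"
      by (rule realizesE[OF c l]) (rule that)
    have "\<forall>i. loc i < m1" using l by (simp add: ms less_Suc_eq)
    from realizesE[OF c1 this] obtain b1 where
      b1: "\<And>s. (\<forall>j\<ge>m1. s j = []) \<Longrightarrow> exec b1 s (A1 (s \<circ> loc)) (s(m1 := g (s \<circ> loc)))"
      by blast
    have "\<forall>i. loc' i < m3" using l by (auto simp: ms less_Suc_eq loc'_def split: nat.splits)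
    from realizesE[OF c2 this] obtain b2 where
      b2: "\<And>s. (\<forall>j\<ge>m3. s j = []) \<Longrightarrow> exec b2 s (A2 (s \<circ> loc')) (s(m3 := H (s \<circ> loc')))"
      by blast
    define body where "body = Pop m ;; b2 ;; clear m1 ;; (pour m3 m4 ;; pour m4 m1) ;; Push m2 True"
    show "\<exists>c. \<forall>s. (\<forall>j\<ge>m. s j = []) \<longrightarrow> exec c s (T (s \<circ> loc)) (s(m := ?f (s \<circ> loc)))"
    proof (intro exI[of _ "b ;; b1 ;; While m body ;; clear m2 ;; (pour m1 m2 ;; pour m2 m)"] allI impI)
      fix s :: store assume s: "\<forall>j\<ge>m. s j = []"
      define e where "e = s \<circ> loc"
      define S where "S = (\<lambda>i. s(m := drop i (N e), m1 := r e i, m2 := replicate i True))"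
      have b': "exec b s (A e) (s(m := N e))" using b[OF s] by (simp add: e_def)
      have "(s(m := N e)) \<circ> loc = e" using l less_irrefl by (fastforce simp: e_def fun_eq_iff)
      then have b1': "exec b1 (s(m := N e)) (A1 e) (S 0)"
        using b1[of "s(m := N e)"] s r(1) by (simp add: S_def ms fun_upd_idem)
      have W: "exec (While m body) (S 0) (A e * (T3 e + 2) + 1) (S (length (N e)))"
      proof (rule exec_While[where B = "T3 e"])
        fix i assume i: "i < length (N e)"
        show "S i m \<noteq> []" using i by (simp add: S_def ms)
        define s1 where "s1 = (S i)(m := drop (Suc i) (N e))"
        define s2 where "s2 = s1(m3 := r e (Suc i))"
        define s3 where "s3 = s2(m1 := [])"
        define s4 where "s4 = s3(m3 := [], m1 := r e (Suc i))"
        have loc_ne: "loc k \<noteq> m" "loc k \<noteq> m1" "loc k \<noteq> m2" for k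
          using l[rule_format, of k] by (auto simp: ms)
        have 1: "exec (Pop m) (S i) 1 s1"
          by (rule exec_Pop) (simp_all add: s1_def S_def ms drop_Suc tl_drop)
        have "s1 \<circ> loc' = replicate i True ## r e i ## e"
        proof
          fix k show "(s1 \<circ> loc') k = (replicate i True ## r e i ## e) k"
            using loc_ne by (simp add: s1_def S_def loc'_def econs_def ms e_def split: nat.splits)
        qed
        moreover have "\<forall>j\<ge>m3. s1 j = []" using s by (simp add: s1_def S_def ms)
        ultimately have 2: "exec b2 s1 (B2 e) s2"
          using b2[of s1] hB[of i e] i r(2)[of e i] exec_mono by (simp add: s2_def)
        have 3: "exec (clear m1) s2 (3 * B e + 1) s3"
          by (rule exec_clear) (use rB[of i e] i in \<open>simp_all add: s3_def s2_def s1_def S_def ms\<close>)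
        have 4: "exec (pour m3 m4 ;; pour m4 m1) s3 (14 * B e + 3) s4"
          by (rule exec_move) (use rB[of "Suc i" e] i s in \<open>simp_all add: s4_def s3_def s2_def s1_def S_def ms\<close>)
        have "S (Suc i) = s4(m2 := True # s4 m2)"
          using s by (auto simp: s4_def s3_def s2_def s1_def S_def ms fun_eq_iff)
        then have 5: "exec (Push m2 True) s4 2 (S (Suc i))" by (rule exec_Push) simp
        show "exec body (S i) (T3 e) (S (Suc i))"
          unfolding body_def T3_def
          by (rule exec_Seq[OF 1 exec_Seq[OF 2 exec_Seq[OF 3 exec_Seq[OF 4 5 order_refl] order_refl] order_refl] order_refl])
      next
        show "S (length (N e)) m = []" by (simp add: S_def ms)
        show "length (N e) * (T3 e + 2) + 1 \<le> A e * (T3 e + 2) + 1"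
          by (intro add_mono mult_le_mono1 A(2) order_refl)
      qed
      define s5 where "s5 = (S (length (N e)))(m2 := [])"
      have 6: "exec (clear m2) (S (length (N e))) (3 * A e + 1) s5"
        by (rule exec_clear) (use A(2)[of e] in \<open>simp_all add: s5_def S_def\<close>)
      have fe: "?f e = r e (length (N e))" by (simp add: r_def)
      have fin: "s(m := ?f e) = s5(m1 := [], m := s5 m1)"
        unfolding fe using s by (auto simp: s5_def S_def ms fun_eq_iff)
      have 7: "exec (pour m1 m2 ;; pour m2 m) s5 (14 * B e + 3) (s(m := ?f e))"
        by (rule exec_move[OF _ _ _ _ _ fin]) (use rB[of "length (N e)" e] in \<open>simp_all add: s5_def S_def ms\<close>)
      have "exec (b ;; b1 ;; While m body ;; clear m2 ;; (pour m1 m2 ;; pour m2 m)) s (T e) (s(m := ?f e))"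
        unfolding T_def
        by (rule exec_Seq[OF b' exec_Seq[OF b1' exec_Seq[OF W exec_Seq[OF 6 7 order_refl] order_refl] order_refl] order_refl])
      then show "exec (b ;; b1 ;; While m body ;; clear m2 ;; (pour m1 m2 ;; pour m2 m)) s
          (T (s \<circ> loc)) (s(m := ?f (s \<circ> loc)))"
        by (simp only: e_def)
    qed
  qed
qed

section \<open>From polynomial time to NP\<close>

text \<open>Booleans are represented by the empty list or \<open>[True]\<close>, numbers in unary (\<open>ptn\<close>) or, below, in
  binary (\<open>ptv\<close>). A bound variable \<open>i\<close> becomes variable \<open>0\<close> of the environment, in unary.\<close>

definition ptb :: "(env \<Rightarrow> bool) \<Rightarrow> bool" where
  "ptb P \<longleftrightarrow> ptime (\<lambda>e. if P e then [True] else [])"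

definition ptn :: "(env \<Rightarrow> nat) \<Rightarrow> bool" where
  "ptn N \<longleftrightarrow> ptime (\<lambda>e. replicate (N e) True)"

theorem NP_intro:
  fixes p :: "nat poly"
  assumes V: "ptb (\<lambda>e. V (e 0) (e 1))"
    and L: "\<And>x. x \<in> L \<longleftrightarrow> (\<exists>u. length u \<le> poly p (length x) \<and> V x u)"
  shows "L \<in> NP"
proof -
  obtain A where A: "pbound A" and c: "realizes (\<lambda>e. if V (e 0) (e 1) then [True] else []) A"
    using V unfolding ptb_def by (rule ptimeE) (rule that)
  obtain k q where q: "\<And>e n. upto_bound k e n \<Longrightarrow> A e \<le> poly q n"
    using A unfolding pbound_def by blast
  \<comment> \<open>All variables above 1 are aliased with variable 1: \<open>V\<close> reads only
    the first two, and the bound \<open>q\<close> applies because every variable then holds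
    \<open>x\<close> or \<open>u\<close>.\<close>
  define loc where "loc = (\<lambda>i::nat. min i 1)"
  have "\<forall>i. loc i < 2" by (simp add: loc_def min_def)
  from realizesE[OF c this] obtain c where c: "\<And>s. \<forall>j\<ge>2. s j = [] \<Longrightarrow>
      exec c s (A (s \<circ> loc)) (s(2 := if V ((s \<circ> loc) 0) ((s \<circ> loc) 1) then [True] else []))"
    by blast
  define K where "K = Suc (Max (insert 2 (regs c)))"
  have K: "regs c \<subseteq> {..<K}" "2 < K"
    using finite_regs[of c] by (auto simp: K_def less_Suc_eq_le)
  define M where "M = tm_of c K 2"
  \<comment> \<open>The certificate has length at most \<open>p\<close> of the input length; the
    added 1 is the step from \<open>SKIP\<close> to the verdict.\<close>
  define t where "t = pcompose q ([:0, 1:] + p) + [:1:]"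
  have run: "\<exists>t'. t' \<le> poly q (length x + length u) \<and> halts_within M x u (t' + 1) \<and> (accepts M x u \<longleftrightarrow> V x u)" for x u
  proof -
    define s :: store where "s = (\<lambda>i. if i = 0 then x else if i = 1 then u else [])"
    have "upto_bound k (s \<circ> loc) (length x + length u)"
      by (simp add: upto_bound_def s_def)
    then have "A (s \<circ> loc) \<le> poly q (length x + length u)" by (rule q)
    moreover have "exec c s (A (s \<circ> loc)) (s(2 := if V x u then [True] else []))"
      using c[of s] by (simp add: s_def loc_def)
    ultimately have "exec c s (poly q (length x + length u)) (s(2 := if V x u then [True] else []))"
      using exec_mono by blast
    from tm_of_correct[OF this[unfolded s_def] K(1) _ K(2)] K(2) show ?thesis
      unfolding M_def by auto
  qed
  have "wf_tm M" unfolding M_def using K by (intro wf_tm_of) auto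
  moreover have "halts_within M x u (poly t (length x))" if u: "length u \<le> poly p (length x)" for x u
  proof -
    have "poly q (length x + length u) \<le> poly q (length x + poly p (length x))"
      using u by (intro poly_nat_mono) simp
    moreover obtain t' where t': "t' \<le> poly q (length x + length u)" "halts_within M x u (t' + 1)"
      using run[of x u] by blast
    moreover have "poly t (length x) = poly q (length x + poly p (length x)) + 1"
      by (simp add: t_def poly_pcompose)
    moreover define n where "n = t' + 1"
    ultimately have n: "n \<le> poly t (length x)" "halts_within M x u n"
      by (linarith, simp)
    then obtain d where d: "poly t (length x) = d + n" by (metis le_add_diff_inverse2)
    have "(step M ^^ poly t (length x)) (init M x u) = (step M ^^ n) (init M x u)"
      unfolding d funpow_add comp_apply
      by (rule step_halted) (use n(2) in \<open>simp add: halts_within_def\<close>)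
    then show ?thesis using n(2) unfolding halts_within_def by simp
  qed
  moreover have "x \<in> L \<longleftrightarrow> (\<exists>u. length u \<le> poly p (length x) \<and> accepts M x u)" for x
    using L run by blast
  ultimately show ?thesis unfolding NP_def by blast
qed

section \<open>Polynomial-time arithmetic\<close>

lemma ptime_cong: "ptime f \<Longrightarrow> (\<And>e. f e = g e) \<Longrightarrow> ptime g"
  by (metis ext)

lemma ptime_if:
  assumes "ptb P" "ptime f" "ptime g"
  shows "ptime (\<lambda>e. if P e then f e else g e)"
  by (rule ptime_cong[OF ptime_case[OF assms(1)[unfolded ptb_def] assms(2,3)]]) simp

lemma ptime_const: "ptime (\<lambda>_. w)"
  by (induction w) (auto intro: ptime_Nil ptime_Cons)

lemma ptb_const: "ptb (\<lambda>_. b)"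
  unfolding ptb_def by (rule ptime_const)

lemma ptb_if:
  assumes "ptb P" "ptb Q" "ptb R"
  shows "ptb (\<lambda>e. if P e then Q e else R e)"
  unfolding ptb_def by (rule ptime_cong[OF ptime_if[OF assms(1) assms(2,3)[unfolded ptb_def]]]) simp

lemma ptb_cong: "ptb P \<Longrightarrow> (\<And>e. P e = Q e) \<Longrightarrow> ptb Q"
proof -
  assume P: "ptb P" and eq: "\<And>e. P e = Q e"
  have "P = Q" by (rule ext) (rule eq)
  with P show ?thesis by simp
qed

lemma ptb_not: "ptb P \<Longrightarrow> ptb (\<lambda>e. \<not> P e)"
  by (rule ptb_cong[OF ptb_if[OF _ ptb_const[of False] ptb_const[of True], of P]]) simp_all

lemma ptb_conj: "ptb P \<Longrightarrow> ptb Q \<Longrightarrow> ptb (\<lambda>e. P e \<and> Q e)"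
  by (rule ptb_cong[OF ptb_if[OF _ _ ptb_const[of False], of P Q]]) simp_all

lemma ptb_disj: "ptb P \<Longrightarrow> ptb Q \<Longrightarrow> ptb (\<lambda>e. P e \<or> Q e)"
  by (rule ptb_cong[OF ptb_if[OF _ ptb_const[of True], of P Q]]) simp_all

lemma ptb_imp: "ptb P \<Longrightarrow> ptb Q \<Longrightarrow> ptb (\<lambda>e. P e \<longrightarrow> Q e)"
  by (rule ptb_cong[OF ptb_if[OF _ _ ptb_const[of True], of P Q]]) simp_all

lemma ptb_iff: "ptb P \<Longrightarrow> ptb Q \<Longrightarrow> ptb (\<lambda>e. P e = Q e)"
  by (rule ptb_cong[OF ptb_if[OF _ _ ptb_not, of P Q Q]]) auto

lemma ptn_rec:
  assumes N: "ptn N" and "ptime g" "ptime (\<lambda>e. h (length (e 0)) (e (Suc 0)) (\<lambda>i. e (Suc (Suc i))))"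
    and "pbound B" "\<And>e i. i \<le> N e \<Longrightarrow> length (rec_nat (g e) (\<lambda>i r. h i r e) i) \<le> B e"
  shows "ptime (\<lambda>e. rec_nat (g e) (\<lambda>i r. h i r e) (N e))"
  using ptime_rec[OF N[unfolded ptn_def] assms(2-4)] assms(5) by simp

lemma pbound_ptn: "ptn N \<Longrightarrow> pbound N"
  unfolding ptn_def by (drule pbound_ptime) simp

lemma ptn_length: "ptime f \<Longrightarrow> ptn (\<lambda>e. length (f e))"
proof -
  assume f: "ptime f"
  have r: "rec_nat [] (\<lambda>i r. True # r) n = replicate n True" for n by (induction n) auto
  show ?thesis
    unfolding ptn_def r[symmetric]
    by (rule ptime_rec[where h = "\<lambda>i r e. True # r", OF f ptime_Nil _ pbound_ptime[OF f]])
      (auto intro: ptime_Cons ptime_var simp: r)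
qed

text \<open>\<open>ptime_case\<close> also looks at the top bit; on the unary length this bit is
  always set, and only emptiness is left to test.\<close>

lemma ptb_ne: "ptime f \<Longrightarrow> ptb (\<lambda>e. f e \<noteq> [])"
  unfolding ptb_def
  by (rule ptime_cong[OF ptime_case[OF ptn_length[unfolded ptn_def] ptime_const[of "[True]"] ptime_const[of "[]"]]])
    (assumption, rename_tac e, case_tac "f e", simp_all)

lemma ptb_null: "ptime f \<Longrightarrow> ptb (\<lambda>e. f e = [])"
  using ptb_not[OF ptb_ne] by simp

lemma ptn_const: "ptn (\<lambda>_. c)"
  unfolding ptn_def by (rule ptime_const)

lemma ptn_Suc: "ptn N \<Longrightarrow> ptn (\<lambda>e. Suc (N e))"
  unfolding ptn_def by (simp add: ptime_Cons)

lemma ptn_add: "ptn M \<Longrightarrow> ptn N \<Longrightarrow> ptn (\<lambda>e. M e + N e)"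
proof -
  assume MN: "ptn M" "ptn N"
  have r: "rec_nat (replicate m True) (\<lambda>i r. True # r) n = replicate (m + n) True" for m n
    by (induction n) auto
  show ?thesis
    unfolding ptn_def r[symmetric]
    by (rule ptn_rec[where h = "\<lambda>i r e. True # r" and B = "\<lambda>e. M e + N e",
          OF MN(2) MN(1)[unfolded ptn_def]])
      (use pbound_add[OF MN[THEN pbound_ptn]] in \<open>auto intro!: ptime_Cons ptime_var simp: r\<close>)
qed

lemma ptime_drop: "ptn N \<Longrightarrow> ptime f \<Longrightarrow> ptime (\<lambda>e. drop (N e) (f e))"
proof -
  assume Nf: "ptn N" "ptime f"
  have r: "rec_nat w (\<lambda>i r. tl r) n = drop n w" for n and w :: "bool list"
    by (induction n) (auto simp: drop_Suc tl_drop)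
  show ?thesis
    unfolding r[symmetric]
    by (rule ptn_rec[where h = "\<lambda>i r e. tl r" and B = "\<lambda>e. length (f e)"])
      (use Nf in \<open>auto intro!: ptime_tl ptime_var pbound_ptime simp: r\<close>)
qed

lemma ptn_diff: "ptn M \<Longrightarrow> ptn N \<Longrightarrow> ptn (\<lambda>e. M e - N e)"
  using ptime_drop[of N "\<lambda>e. replicate (M e) True"] by (simp add: ptn_def)

lemma ptb_less:
  assumes "ptn M" "ptn N" shows "ptb (\<lambda>e. M e < N e)"
  by (rule ptb_cong[OF ptb_ne[OF ptn_diff[OF assms(2,1), unfolded ptn_def]]]) auto

lemma ptb_le: "ptn M \<Longrightarrow> ptn N \<Longrightarrow> ptb (\<lambda>e. M e \<le> N e)"
  using ptb_not[OF ptb_less[of N M]] by (simp add: not_less)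

lemma ptb_eq: "ptn M \<Longrightarrow> ptn N \<Longrightarrow> ptb (\<lambda>e. M e = N e)"
  using ptb_conj[OF ptb_le[of M N] ptb_le[of N M]] by (simp add: eq_iff)

text \<open>Positions beyond the end read as \<open>False\<close>, so a list acts as an infinite
  binary expansion and lengths need not be aligned.\<close>

definition nthd :: "bool list \<Rightarrow> nat \<Rightarrow> bool" where
  "nthd w i \<longleftrightarrow> i < length w \<and> w ! i"

lemma ptb_nthd: "ptime f \<Longrightarrow> ptn N \<Longrightarrow> ptb (\<lambda>e. nthd (f e) (N e))"
proof -
  assume "ptime f" "ptn N"
  then have "ptime (\<lambda>e. drop (N e) (f e))" by (intro ptime_drop)
  from ptime_case[OF this ptime_const[of "[True]"] ptime_const[of "[]"]]
  show ?thesis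
    unfolding ptb_def by (rule ptime_cong) (auto simp: nthd_def hd_drop_conv_nth)
qed

lemma ptb_rec:
  assumes N: "ptn N" and P: "ptb P"
    and H: "ptb (\<lambda>e. H (length (e 0)) (e (Suc 0) \<noteq> []) (\<lambda>i. e (Suc (Suc i))))"
  shows "ptb (\<lambda>e. rec_nat (P e) (\<lambda>i b. H i b e) (N e))"
proof -
  have r: "rec_nat (if P e then [True] else []) (\<lambda>i r. if H i (r \<noteq> []) e then [True] else []) n =
      (if rec_nat (P e) (\<lambda>i b. H i b e) n then [True] else [])" for e n
    by (induction n) auto
  show ?thesis
    unfolding ptb_def r[symmetric]
    by (rule ptn_rec[where h = "\<lambda>i r e. if H i (r \<noteq> []) e then [True] else []" and B = "\<lambda>_. 1", OF N])
      (use P H in \<open>auto simp: ptb_def pbound_const r\<close>)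
qed

lemma ptb_rename: "ptb P \<Longrightarrow> ptb (\<lambda>e. P (\<lambda>i. e (\<pi> i)))"
  unfolding ptb_def by (rule ptime_rename)

text \<open>In a recursion step variable 0 is the index and variable 1 the accumulator; a predicate
  that does not mention the accumulator is shifted past it.\<close>

lemma ptb_rename1:
  "ptb (\<lambda>e. P (length (e 0)) (\<lambda>i. e (Suc i))) \<Longrightarrow> ptb (\<lambda>e. P (length (e 0)) (\<lambda>i. e (Suc (Suc i))))"
  by (drule ptb_rename[where \<pi> = "\<lambda>i. if i = 0 then 0 else Suc i"]) simp

lemma ptb_ball:
  assumes "ptn N" "ptb (\<lambda>e. P (length (e 0)) (\<lambda>i. e (Suc i)))"
  shows "ptb (\<lambda>e. \<forall>i<N e. P i e)"
proof -
  have r: "rec_nat True (\<lambda>i b. b \<and> P i e) n \<longleftrightarrow> (\<forall>i<n. P i e)" for e n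
    by (induction n) (auto simp: less_Suc_eq)
  show ?thesis
    unfolding r[symmetric]
    by (rule ptb_rec[where H = "\<lambda>i b e. b \<and> P i e"])
      (use assms in \<open>auto intro!: ptb_conj ptb_const ptb_ne ptime_var ptb_rename1\<close>)
qed

lemma ptb_bex:
  assumes "ptn N" "ptb (\<lambda>e. P (length (e 0)) (\<lambda>i. e (Suc i)))"
  shows "ptb (\<lambda>e. \<exists>i<N e. P i e)"
  using ptb_not[OF ptb_ball[OF assms(1) ptb_not, of P]] assms(2) by simp

lemma ptn_count:
  assumes "ptn N" "ptb (\<lambda>e. P (length (e 0)) (\<lambda>i. e (Suc i)))"
  shows "ptn (\<lambda>e. \<Sum>i<N e. if P i e then 1 else 0)"
proof -
  have r: "rec_nat [] (\<lambda>i r. if P i e then True # r else r) n = replicate (\<Sum>i<n. if P i e then 1 else 0) True" for e n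
    by (induction n) auto
  have le: "(\<Sum>i<n. if P i e then 1 else 0) \<le> n" for e n
    by (induction n) auto
  show ?thesis
    unfolding ptn_def r[symmetric]
  proof (rule ptn_rec[where h = "\<lambda>i r e. if P i e then True # r else r" and B = N])
    show "ptime (\<lambda>e. if P (length (e 0)) (\<lambda>i. e (Suc (Suc i))) then True # e (Suc 0) else e (Suc 0))"
      by (intro ptime_if ptime_Cons ptime_var ptb_rename1 assms)
    show "length (rec_nat [] (\<lambda>i r. if P i e then True # r else r) i) \<le> N e" if "i \<le> N e" for i e
      using le_trans[OF le that] by (simp add: r)
  qed (intro assms ptime_Nil pbound_ptn)+
qed

lemma ptb_subst:
  assumes "ptb (\<lambda>e. P (length (e 0)) (\<lambda>i. e (Suc i)))" "ptn M"
  shows "ptb (\<lambda>e. P (M e) e)"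
  using ptime_let[OF assms[unfolded ptb_def ptn_def]] by (simp add: ptb_def)

lemma ptn_rename: "ptn N \<Longrightarrow> ptn (\<lambda>e. N (\<lambda>i. e (\<pi> i)))"
  unfolding ptn_def by (rule ptime_rename)

text \<open>Recursion adds entries at the front, so the table is built from its last entry: round
  \<open>i\<close> contributes the index \<open>N e - Suc i\<close>.\<close>

lemma ptime_tab:
  assumes "ptn N" "ptb (\<lambda>e. P (length (e 0)) (\<lambda>i. e (Suc i)))"
  shows "ptime (\<lambda>e. map (\<lambda>i. P i e) [0..<N e])"
proof -
  have r: "rec_nat [] (\<lambda>i r. P (N e - Suc i) e # r) n = map (\<lambda>i. P i e) [N e - n..<N e]" if "n \<le> N e" for e n
    using that
  proof (induction n)
    case (Suc n)
    then have "[N e - Suc n..<N e] = (N e - Suc n) # [N e - n..<N e]"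
      by (subst upt_conv_Cons) (auto simp: Suc_diff_Suc)
    then show ?case using Suc by simp
  qed auto
  have st: "ptb (\<lambda>e. P (N (\<lambda>i. e (Suc (Suc i))) - Suc (length (e 0))) (\<lambda>i. e (Suc (Suc i))))"
  proof (rule ptb_subst[where P = "\<lambda>n e. P n (\<lambda>i. e (Suc (Suc i)))"])
    show "ptb (\<lambda>e. P (length (e 0)) (\<lambda>i. e (Suc (Suc (Suc i)))))"
      using ptb_rename[OF assms(2), of "\<lambda>i. if i = 0 then 0 else Suc (Suc i)"] by simp
    show "ptn (\<lambda>e. N (\<lambda>i. e (Suc (Suc i))) - Suc (length (e 0)))"
      by (rule ptn_diff[OF ptn_rename[OF assms(1)] ptn_Suc[OF ptn_length[OF ptime_var]]])
  qed
  have "ptime (\<lambda>e. rec_nat [] (\<lambda>i r. P (N e - Suc i) e # r) (N e))"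
  proof (rule ptn_rec[where h = "\<lambda>i r e. P (N e - Suc i) e # r" and B = N])
    have "ptime (\<lambda>e. if P (N (\<lambda>i. e (Suc (Suc i))) - Suc (length (e 0))) (\<lambda>i. e (Suc (Suc i))) then True # e (Suc 0) else False # e (Suc 0))"
      by (intro ptime_if st ptime_Cons ptime_var)
    then show "ptime (\<lambda>e. P (N (\<lambda>i. e (Suc (Suc i))) - Suc (length (e 0))) (\<lambda>i. e (Suc (Suc i))) # e (Suc 0))"
      by (rule ptime_cong) simp
  qed (use assms r in \<open>auto intro!: ptime_Nil pbound_ptn\<close>)
  then show ?thesis using r by simp
qed

section \<open>Binary arithmetic\<close>

lemma ptime_comp1: "ptime (\<lambda>e. F (e 0)) \<Longrightarrow> ptime f \<Longrightarrow> ptime (\<lambda>e. F (f e))"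
  by (drule (1) ptime_let) simp

lemma ptime_comp2:
  assumes "ptime (\<lambda>e. F (e 0) (e (Suc 0)))" "ptime f" "ptime g"
  shows "ptime (\<lambda>e. F (f e) (g e))"
  using ptime_let[OF ptime_let[OF assms(1) ptime_rename[OF assms(2), of Suc]] assms(3)] by simp

primrec val :: "bool list \<Rightarrow> nat" where
  "val [] = 0"
| "val (b # w) = (if b then 1 else 0) + 2 * val w"

text \<open>The value of the \<open>n\<close> lowest bits: the quantity in the invariants of
  addition and comparison, which both read from the low end.\<close>

definition lo :: "nat \<Rightarrow> bool list \<Rightarrow> nat" where
  "lo n w = (\<Sum>i<n. if nthd w i then 2 ^ i else 0)"

lemma val_lo: "length w \<le> n \<Longrightarrow> val w = lo n w"
proof (induction w arbitrary: n)
  case (Cons b w)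
  then obtain m where n: "n = Suc m" "length w \<le> m" by (cases n) auto
  have "lo n (b # w) = (if b then 1 else 0) + 2 * lo m w"
    unfolding lo_def n(1) sum.lessThan_Suc_shift by (simp add: nthd_def sum_distrib_left if_distrib cong: if_cong)
  then show ?case using Cons.IH[OF n(2)] by simp
qed (simp add: lo_def nthd_def)

lemma lo_less: "lo n w < 2 ^ n"
  unfolding lo_def by (induction n) auto

lemma val_less: "val w < 2 ^ length w"
  using lo_less[of "length w" w] val_lo[of w "length w"] by simp

lemma val_map_upt: "val (map P [0..<n]) = (\<Sum>i<n. if P i then 2 ^ i else 0)"
  by (simp add: val_lo[of _ n] lo_def nthd_def)

definition carry :: "bool list \<Rightarrow> bool list \<Rightarrow> nat \<Rightarrow> bool" where
  "carry a b n = rec_nat False (\<lambda>i c. if c then nthd a i \<or> nthd b i else nthd a i \<and> nthd b i) n"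

lemma carry_simps [simp]:
  "carry a b 0 \<longleftrightarrow> False"
  "carry a b (Suc n) \<longleftrightarrow> (if carry a b n then nthd a n \<or> nthd b n else nthd a n \<and> nthd b n)"
  by (simp_all add: carry_def)

definition addb :: "bool list \<Rightarrow> bool list \<Rightarrow> bool list" where
  "addb a b = map (\<lambda>i. nthd a i \<noteq> (nthd b i \<noteq> carry a b i)) [0..<length a + length b]"

lemma length_addb: "length (addb a b) = length a + length b"
  by (simp add: addb_def)

lemma val_addb: "val (addb a b) = val a + val b"
proof -
  have inv: "(\<Sum>i<n. if nthd a i \<noteq> (nthd b i \<noteq> carry a b i) then 2 ^ i else 0) + (if carry a b n then 2 ^ n else 0) =
      lo n a + lo n b" for n
    by (induction n) (auto simp: lo_def)
  define n where "n = length a + length b"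
  \<comment> \<open>The generous length of \<open>addb a b\<close> suffices, because (x - 1) + (y -
    1) < x * y for positive x and y; hence the last carry is 0.\<close>
  have "(2 ^ length a - 1) + (2 ^ length b - 1) < (2 ^ n :: nat)"
  proof -
    have "(x - 1) + (y - 1) < x * y" if "x > 0" "y > 0" for x y :: nat
      using that by (cases x; cases y) auto
    from this[of "2 ^ length a" "2 ^ length b"] show ?thesis by (simp add: n_def power_add)
  qed
  then have "val a + val b < 2 ^ n"
    using val_less[of a] val_less[of b] by linarith
  then have "lo n a + lo n b < 2 ^ n"
    using val_lo[of a n] val_lo[of b n] by (simp add: n_def)
  then have "\<not> carry a b n" using inv[of n] by (cases "carry a b n") auto
  then show ?thesis
    using inv[of n] val_lo[of a n] val_lo[of b n] by (simp add: addb_def val_map_upt n_def)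
qed

lemma ptime_addb: "ptime f \<Longrightarrow> ptime g \<Longrightarrow> ptime (\<lambda>e. addb (f e) (g e))"
proof (rule ptime_comp2[where F = addb])
  have c: "ptb (\<lambda>e. carry (e i) (e j) (length (e k)))" for i j k
    unfolding carry_def
    by (rule ptb_rec[where H = "\<lambda>n c e. if c then nthd (e i) n \<or> nthd (e j) n else nthd (e i) n \<and> nthd (e j) n"])
      (intro ptb_if ptb_ne ptb_disj ptb_conj ptb_nthd ptn_length ptime_var ptb_const)+
  show "ptime (\<lambda>e. addb (e 0) (e (Suc 0)))"
    unfolding addb_def
    by (rule ptime_tab[where P = "\<lambda>i e. nthd (e 0) i \<noteq> (nthd (e (Suc 0)) i \<noteq> carry (e 0) (e (Suc 0)) i)"])
      (auto intro!: ptb_not ptb_iff ptb_nthd ptn_length ptime_var ptn_add c)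
qed

text \<open>Horner's scheme from the top bit of \<open>a\<close>, where \<open>False # r\<close>
  doubles. A round lengthens the accumulator by at most \<open>length b + 1\<close>, so it stays
  short although leading zeros are never removed.\<close>

definition mulb :: "bool list \<Rightarrow> bool list \<Rightarrow> bool list" where
  "mulb a b = rec_nat [] (\<lambda>i r. addb (False # r) (if nthd a (length a - Suc i) then b else [])) (length a)"

lemma val_mulb: "val (mulb a b) = val a * val b"
proof -
  have "val (rec_nat [] (\<lambda>i r. addb (False # r) (if nthd a (length a - Suc i) then b else [])) n) =
      val (drop (length a - n) a) * val b" if "n \<le> length a" for n
    using that
  proof (induction n)
    case (Suc n)
    define k where "k = length a - Suc n"
    have k: "k < length a" "length a - n = Suc k" using Suc by (auto simp: k_def)
    have "drop k a = a ! k # drop (Suc k) a" using k(1) by (simp add: Cons_nth_drop_Suc)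
    then show ?case
      using Suc k by (simp add: val_addb nthd_def k_def[symmetric] algebra_simps)
  qed simp
  from this[of "length a"] show ?thesis by (simp add: mulb_def)
qed

lemma ptime_mulb: "ptime f \<Longrightarrow> ptime g \<Longrightarrow> ptime (\<lambda>e. mulb (f e) (g e))"
proof (rule ptime_comp2[where F = mulb])
  have len: "length (rec_nat [] (\<lambda>i r. addb (False # r) (if nthd a (length a - Suc i) then b else [])) n) \<le>
      n * (length b + 1)" for a b n
    by (induction n) (auto simp: length_addb)
  have bd: "pbound (\<lambda>e. length (e 0) * (length (e (Suc 0)) + 1))"
    by (intro pbound_mult pbound_add pbound_const pbound_var)
  show "ptime (\<lambda>e. mulb (e 0) (e (Suc 0)))"
    unfolding mulb_def
  proof (rule ptime_rec[where h = "\<lambda>i r e. addb (False # r) (if nthd (e 0) (length (e 0) - Suc i) then e (Suc 0) else [])"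
        and B = "\<lambda>e. length (e 0) * (length (e (Suc 0)) + 1)" and N = "\<lambda>e. e 0" and g = "\<lambda>e. []"])
    show "length (rec_nat [] (\<lambda>i r. addb (False # r) (if nthd (e 0) (length (e 0) - Suc i) then e (Suc 0) else [])) i)
      \<le> length (e 0) * (length (e (Suc 0)) + 1)" if "i \<le> length (e 0)" for e :: env and i
      using len[of "e 0" "e (Suc 0)" i] mult_le_mono1[OF that, of "length (e (Suc 0)) + 1"] by linarith
  qed (auto intro!: ptime_addb ptime_Cons ptime_if ptb_nthd ptn_diff ptn_Suc ptn_length ptime_var ptime_Nil
      bd[simplified])
qed

text \<open>The scan goes upwards, so the highest position where the numbers differ decides.\<close>

definition leb :: "bool list \<Rightarrow> bool list \<Rightarrow> bool" where
  "leb a b = rec_nat True (\<lambda>i c. if nthd a i = nthd b i then c else nthd b i) (length a + length b)"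

lemma leb_iff: "leb a b \<longleftrightarrow> val a \<le> val b"
proof -
  have "rec_nat True (\<lambda>i c. if nthd a i = nthd b i then c else nthd b i) n \<longleftrightarrow> lo n a \<le> lo n b" for n
  proof (induction n)
    case (Suc n)
    then show ?case using lo_less[of n a] lo_less[of n b] by (auto simp: lo_def)
  qed (simp add: lo_def)
  then show ?thesis by (simp add: leb_def val_lo[of a "length a + length b"] val_lo[of b "length a + length b"])
qed

lemma ptb_leb: "ptime f \<Longrightarrow> ptime g \<Longrightarrow> ptb (\<lambda>e. leb (f e) (g e))"
  unfolding ptb_def
proof (rule ptime_comp2[where F = "\<lambda>a b. if leb a b then [True] else []"])
  show "ptime (\<lambda>e. if leb (e 0) (e (Suc 0)) then [True] else [])"
    unfolding leb_def ptb_def[symmetric]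
    by (rule ptb_rec[where H = "\<lambda>n c e. if nthd (e 0) n = nthd (e (Suc 0)) n then c else nthd (e (Suc 0)) n"])
      (intro ptb_if ptb_ne ptb_iff ptb_nthd ptn_length ptime_var ptb_const ptn_add)+
qed

text \<open>Some representation of the value is computed, not the canonical one: sums and products
  carry leading zeros, to which \<open>val\<close> is blind.\<close>

definition ptv :: "(env \<Rightarrow> nat) \<Rightarrow> bool" where
  "ptv v \<longleftrightarrow> (\<exists>g. ptime g \<and> (\<forall>e. val (g e) = v e))"

lemma ptv_val: "ptime f \<Longrightarrow> ptv (\<lambda>e. val (f e))"
  unfolding ptv_def by blast

lemma ptvE:
  assumes "ptv v"
  obtains f where "ptime f" "v = (\<lambda>e. val (f e))"
proof -
  obtain f where f: "ptime f" "\<And>e. val (f e) = v e"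
    using assms unfolding ptv_def by blast
  have "v = (\<lambda>e. val (f e))" by (rule ext) (simp add: f(2))
  with f(1) show thesis by (rule that)
qed

lemma ptv_add: "ptv v \<Longrightarrow> ptv w \<Longrightarrow> ptv (\<lambda>e. v e + w e)"
  by (elim ptvE) (simp add: ptv_val ptime_addb flip: val_addb)

lemma ptv_mult: "ptv v \<Longrightarrow> ptv w \<Longrightarrow> ptv (\<lambda>e. v e * w e)"
  by (elim ptvE) (simp add: ptv_val ptime_mulb flip: val_mulb)

lemma ptb_ptv_le: "ptv v \<Longrightarrow> ptv w \<Longrightarrow> ptb (\<lambda>e. v e \<le> w e)"
  by (elim ptvE) (simp add: ptb_leb flip: leb_iff)

lemma ptv_if:
  assumes "ptb P" "ptv v" "ptv w"
  shows "ptv (\<lambda>e. if P e then v e else w e)"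
proof -
  obtain f g where "ptime f" "v = (\<lambda>e. val (f e))" "ptime g" "w = (\<lambda>e. val (g e))"
    using assms(2,3) by (elim ptvE)
  then show ?thesis
    using assms(1) unfolding ptv_def
    by (intro exI[of _ "\<lambda>e. if P e then f e else g e"]) (auto intro: ptime_if)
qed

lemma val_nat_bits: "val (nat_bits n) = n"
proof (induction n rule: less_induct)
  case (less n)
  then show ?case by (cases "n = 0") (auto simp: nat_bits_0 nat_bits_pos)
qed

lemma ptv_const: "ptv (\<lambda>_. c)"
  unfolding ptv_def using ptime_const val_nat_bits by blast

lemma ptv_sum:
  assumes N: "ptn N" and v: "ptv (\<lambda>e. v (length (e 0)) (\<lambda>i. e (Suc i)))"
  shows "ptv (\<lambda>e. \<Sum>i<N e. v i e)"
proof -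
  obtain H where H: "ptime H" "\<And>e. val (H e) = v (length (e 0)) (\<lambda>i. e (Suc i))"
    using v unfolding ptv_def by blast
  obtain B where B: "pbound B" "\<And>e w. length w \<le> N e \<Longrightarrow> length (H (w ## e)) \<le> B e"
    using pbound_econs[OF pbound_ptime[OF H(1)] pbound_ptn[OF N]] by blast
  define r where "r = (\<lambda>e. rec_nat [] (\<lambda>i r. addb r (H (replicate i True ## e))))"
  have val: "val (r e n) = (\<Sum>i<n. v i e)" for e n
    by (induction n) (auto simp: r_def val_addb H(2))
  have len: "length (r e n) \<le> n * B e" if "n \<le> N e" for e n
    using that
  proof (induction n)
    case (Suc n)
    then show ?case using B(2)[of "replicate n True" e] by (simp add: r_def length_addb)
  qed (simp add: r_def)
  have "ptime (\<lambda>e. r e (N e))"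
    unfolding r_def
  proof (rule ptn_rec[where h = "\<lambda>i r e. addb r (H (replicate i True ## e))" and B = "\<lambda>e. N e * B e"])
    have "ptime (\<lambda>e. H (replicate (length (e 0)) True ## (\<lambda>i. e (Suc (Suc i)))))"
      using ptime_let[OF ptime_rename[OF H(1), of "\<lambda>i. if i = 0 then 0 else Suc (Suc i)"]
          ptn_length[OF ptime_var[of 0], unfolded ptn_def]]
      by (rule back_subst[of ptime]) (auto simp: fun_eq_iff econs_def intro!: arg_cong[of _ _ H] split: nat.splits)
    then show "ptime (\<lambda>e. addb (e (Suc 0)) (H (replicate (length (e 0)) True ## (\<lambda>i. e (Suc (Suc i))))))"
      by (intro ptime_addb ptime_var)
    show "length (rec_nat [] (\<lambda>i r. addb r (H (replicate i True ## e))) i) \<le> N e * B e" if "i \<le> N e" for e i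
      using le_trans[OF len[OF that] mult_le_mono1[OF that]] by (simp add: r_def)
  qed (intro N ptime_Nil pbound_mult pbound_ptn B)+
  then show ?thesis unfolding ptv_def using val by blast
qed

lemma ptv_ptn: "ptn N \<Longrightarrow> ptv N"
  using ptv_sum[of N "\<lambda>_ _. 1"] by (simp add: ptv_const)

section \<open>Walks and averages\<close>

text \<open>The list of a walk omits its last state, so that walks concatenate.\<close>

fun walk :: "('s \<times> 's) set \<Rightarrow> 's \<Rightarrow> 's list \<Rightarrow> 's \<Rightarrow> bool" where
  "walk E a [] b \<longleftrightarrow> a = b"
| "walk E a (v # vs) b \<longleftrightarrow> v = a \<and> (\<exists>c. (a, c) \<in> E \<and> walk E c vs b)"

lemma walk_append: "walk E a (vs @ ws) c \<longleftrightarrow> (\<exists>b. walk E a vs b \<and> walk E b ws c)"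
  by (induction vs arbitrary: a) auto

lemma walk_appendI: "walk E a vs b \<Longrightarrow> walk E b ws c \<Longrightarrow> walk E a (vs @ ws) c"
  by (auto simp: walk_append)

lemma walk_first: "walk E a vs b \<Longrightarrow> (vs @ [b]) ! 0 = a"
  by (cases vs) auto

lemma walk_nth: "walk E a vs b \<Longrightarrow> i < length vs \<Longrightarrow> (vs ! i, (vs @ [b]) ! Suc i) \<in> E"
proof (induction vs arbitrary: a i)
  case (Cons v vs)
  then obtain c where c: "v = a" "(a, c) \<in> E" "walk E c vs b" by auto
  show ?case
  proof (cases i)
    case 0
    then show ?thesis using c walk_first[OF c(3)] by simp
  next
    case (Suc j)
    then show ?thesis using Cons.IH[OF c(3), of j] Cons.prems by simp
  qed
qed simp

lemma walk_map_upt: "(\<And>j. j < m \<Longrightarrow> (f j, f (Suc j)) \<in> E) \<Longrightarrow> walk E (f 0) (map f [0..<m]) (f m)"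
  by (induction m) (auto simp: walk_append)

lemma walk_mono: "walk E a vs b \<Longrightarrow> E \<subseteq> E' \<Longrightarrow> walk E' a vs b"
  by (induction vs arbitrary: a) auto

lemma walk_set: "walk E a vs b \<Longrightarrow> E \<subseteq> V \<times> V' \<Longrightarrow> set vs \<subseteq> V"
  by (induction vs arbitrary: a) auto

lemma walk_replicate: "walk E p C p \<Longrightarrow> walk E p (concat (replicate k C)) p"
  by (induction k) (auto simp: walk_append)

text \<open>This rate fits a run whose k-th block has length of order k and a bounded deviation:
  within N steps only about sqrt N blocks are completed, and the current one has length of order
  sqrt N.\<close>

lemma avg_tendsto_0:
  fixes h :: "nat \<Rightarrow> real"
  assumes "\<And>N. \<bar>\<Sum>i<N. h i\<bar> \<le> A * (1 + sqrt (real N))"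
  shows "(\<lambda>n. 1 / real (n + 1) * (\<Sum>i\<le>n. h i)) \<longlonglongrightarrow> 0"
proof (rule Lim_null_comparison)
  have A: "A \<ge> 0" using assms[of 0] by simp
  show "\<forall>\<^sub>F n in sequentially. norm (1 / real (n + 1) * (\<Sum>i\<le>n. h i)) \<le> 2 * A * sqrt (inverse (real (Suc n)))"
  proof (rule always_eventually, rule allI)
    fix n
    define x where "x = real (Suc n)"
    have x: "x \<ge> 1" by (simp add: x_def)
    have "\<bar>\<Sum>i\<le>n. h i\<bar> \<le> A * (1 + sqrt x)"
      using assms[of "Suc n"] by (simp add: lessThan_Suc_atMost x_def)
    also have "\<dots> \<le> A * (2 * sqrt x)"
      using x A by (intro mult_left_mono) auto
    finally have "\<bar>\<Sum>i\<le>n. h i\<bar> / x \<le> A * (2 * sqrt x) / x"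
      using x by (intro divide_right_mono) auto
    also have "\<dots> = 2 * A * sqrt (inverse x)"
      using x sqrt_divide_self_eq[of x] by (simp add: real_sqrt_inverse flip: times_divide_eq_right)
    finally show "norm (1 / real (n + 1) * (\<Sum>i\<le>n. h i)) \<le> 2 * A * sqrt (inverse (real (Suc n)))"
      by (simp add: x_def abs_mult)
  qed
  have "(\<lambda>n. 2 * A * sqrt (inverse (real (Suc n)))) \<longlonglongrightarrow> 2 * A * sqrt 0"
    by (intro tendsto_intros LIMSEQ_inverse_real_of_nat)
  then show "(\<lambda>n. 2 * A * sqrt (inverse (real (Suc n)))) \<longlonglongrightarrow> 0" by simp
qed

lemma avg_tendsto:
  fixes g :: "nat \<Rightarrow> real"
  assumes "\<And>N. \<bar>\<Sum>i<N. g i - \<mu>\<bar> \<le> A * (1 + sqrt (real N))"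
  shows "(\<lambda>n. 1 / real (n + 1) * (\<Sum>i\<le>n. g i)) \<longlonglongrightarrow> \<mu>"
proof -
  have "(\<lambda>n. 1 / real (n + 1) * (\<Sum>i\<le>n. g i - \<mu>) + \<mu>) \<longlonglongrightarrow> 0 + \<mu>"
    by (intro tendsto_add avg_tendsto_0[OF assms] tendsto_const)
  moreover have "1 / real (n + 1) * (\<Sum>i\<le>n. g i - \<mu>) + \<mu> = 1 / real (n + 1) * (\<Sum>i\<le>n. g i)" for n
    by (simp add: sum_subtractf field_simps)
  ultimately show ?thesis by simp
qed

lemma mp_eqI:
  assumes "(\<lambda>n. 1 / real (n + 1) * (\<Sum>i\<le>n. real (\<rho> (r i)))) \<longlonglongrightarrow> \<mu>"
  shows "mp \<rho> r = \<mu>"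
  using lim_imp_Liminf[OF _ tendsto_ereal[OF assms]] by (simp add: mp_def)

lemma va_eqI:
  assumes "(\<lambda>n. 1 / real (n + 1) * (\<Sum>i\<le>n. (real (\<rho> (r i)) - mp \<rho> r)\<^sup>2)) \<longlonglongrightarrow> v"
  shows "va \<rho> r = v"
  using lim_imp_Limsup[OF _ tendsto_ereal[OF assms]] by (simp add: va_def)

section \<open>Strategies and runs\<close>

lemma history_induced: "history \<sigma> s n = map (induced_run \<sigma> s) [0..<Suc n]"
proof (induction n)
  case (Suc n)
  have "history \<sigma> s (Suc n) = history \<sigma> s n @ [induced_run \<sigma> s (Suc n)]"
    by (simp add: induced_run_def)
  with Suc show ?case by simp
qed (simp add: induced_run_def)

lemma induced_run_0 [simp]: "induced_run \<sigma> s 0 = s"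
  by (simp add: induced_run_def)

lemma induced_run_Suc: "induced_run \<sigma> s (Suc n) = \<sigma> (map (induced_run \<sigma> s) [0..<n] @ [induced_run \<sigma> s n])"
  using history_induced[of \<sigma> s n] by (simp add: induced_run_def)

lemma induced_run_runs:
  assumes "is_graph G" "strategy G \<sigma>" "s \<in> states G"
  shows "induced_run \<sigma> s \<in> runs G"
proof -
  let ?r = "induced_run \<sigma> s"
  have E: "edges G \<subseteq> states G \<times> states G" using assms(1) by (simp add: is_graph_def)
  have "\<forall>i\<le>n. ?r i \<in> states G \<and> (?r i, ?r (Suc i)) \<in> edges G" for n
  proof (induction n)
    case 0
    show ?case using assms(2,3) induced_run_Suc[of \<sigma> s 0] 
      by (auto simp: strategy_def dest: spec[of _ "[]"])
  next
    case (Suc n)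
    have "set (map ?r [0..<Suc n]) \<subseteq> states G" using Suc by auto
    moreover have "?r (Suc n) \<in> states G" using Suc E by blast
    ultimately have "(?r (Suc n), ?r (Suc (Suc n))) \<in> edges G"
      unfolding induced_run_Suc[of \<sigma> s "Suc n"] using assms(2) unfolding strategy_def by blast
    then show ?case using Suc \<open>?r (Suc n) \<in> states G\<close> by (auto simp: le_Suc_eq)
  qed
  then show ?thesis using assms(3) by (auto simp: runs_def)
qed

lemma run_strategy:
  assumes G: "is_graph G" and r: "r \<in> runs G"
  shows "\<exists>\<sigma>. strategy G \<sigma> \<and> induced_run \<sigma> (r 0) = r"
proof -
  \<comment> \<open>Follow \<open>r\<close> while the history is a prefix of it; off this path any
    successor will do.\<close>
  define \<sigma> where "\<sigma> = (\<lambda>h. if h = map r [0..<length h] then r (length h)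
     else SOME t. (last h, t) \<in> edges G)"
  have "strategy G \<sigma>"
    unfolding strategy_def
  proof (intro allI impI)
    fix h s assume "s \<in> states G"
    then have ex: "\<exists>t. (s, t) \<in> edges G" using G by (simp add: is_graph_def)
    show "(s, \<sigma> (h @ [s])) \<in> edges G"
    proof (cases "h @ [s] = map r [0..<length (h @ [s])]")
      case True
      then have "s = r (length h)" by simp
      moreover have "\<sigma> (h @ [s]) = r (Suc (length h))" using True by (simp add: \<sigma>_def)
      ultimately show ?thesis using r by (simp add: runs_def)
    next
      case False
      then show ?thesis using someI_ex[OF ex] by (auto simp: \<sigma>_def)
    qed
  qed
  moreover have "history \<sigma> (r 0) n = map r [0..<Suc n]" for n
  proof (induction n)
    case (Suc n)
    have "\<sigma> (map r [0..<Suc n]) = r (Suc n)" by (simp add: \<sigma>_def del: upt_Suc)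
    then show ?case using Suc by simp
  qed simp
  then have "induced_run \<sigma> (r 0) = r" by (simp add: induced_run_def fun_eq_iff)
  ultimately show ?thesis by blast
qed

section \<open>Runs from certificates\<close>

lemma abs_sum_list_le:
  fixes h :: "'a \<Rightarrow> real"
  assumes "\<And>v. v \<in> set vs \<Longrightarrow> \<bar>h v\<bar> \<le> M"
  shows "\<bar>sum_list (map h vs)\<bar> \<le> M * real (length vs)"
  using assms
proof (induction vs)
  case (Cons v vs)
  then have "\<bar>h v\<bar> \<le> M" "\<bar>sum_list (map h vs)\<bar> \<le> M * real (length vs)" by simp_all
  then show ?case by (simp add: algebra_simps abs_le_iff)
qed simp

lemma sum_list_concat_replicate:
  "sum_list (map h (concat (replicate k C))) = real k * sum_list (map h C)" for h :: "'a \<Rightarrow> real"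
  by (induction k) (auto simp: algebra_simps)

lemma length_concat_replicate: "length (concat (replicate k C)) = k * length C"
  by (induction k) auto

text \<open>The cycles are traversed for \<open>k x1\<close> and \<open>k x2\<close> rounds in the \<open>k\<close>-th block, so the two
  connecting walks have frequency zero.\<close>

lemma mixed_run:
  assumes w: "walk E s P0 p" "walk E p C1 p" "walk E p P1 q" "walk E q C2 q" "walk E q P2 p"
    and ne: "C1 \<noteq> []" "C2 \<noteq> []" and x: "x1 + x2 > (0::nat)"
  obtains r where "r 0 = s" "\<And>i. (r i, r (Suc i)) \<in> E"
    "\<And>g :: 's \<Rightarrow> real. (\<lambda>n. 1 / real (n + 1) * (\<Sum>i\<le>n. g (r i))) \<longlonglongrightarrow>
      (real x1 * sum_list (map g C1) + real x2 * sum_list (map g C2)) /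
      (real x1 * real (length C1) + real x2 * real (length C2))"
proof -
  define b where "b = (\<lambda>k. concat (replicate (k * x1) C1) @ P1 @ concat (replicate (k * x2) C2) @ P2)"
  define pre where "pre = (\<lambda>k. P0 @ concat (map b [0..<k]))"
  define a where "a = x1 * length C1 + x2 * length C2"
  define d where "d = length P1 + length P2"
  have a: "a \<ge> 1"
  proof -
    have "length C1 \<ge> 1" "length C2 \<ge> 1" using ne by (simp_all add: Suc_leI)
    then have "x1 * length C1 \<ge> x1" "x2 * length C2 \<ge> x2" by simp_all
    then show ?thesis using x unfolding a_def by linarith
  qed
  have pre_Suc: "pre (Suc k) = pre k @ b k" for k by (simp add: pre_def)
  have len_b: "length (b k) = k * a + d" for k
    by (simp add: b_def a_def d_def length_concat_replicate algebra_simps)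
  \<comment> \<open>Block \<open>k\<close> has at least \<open>k\<close> states, so the first
    \<open>k\<close> blocks have at least k (k - 1) / 2.\<close>
  have len_pre: "k * k \<le> 2 * length (pre k) + k" for k
  proof (induction k)
    case (Suc k)
    have "k \<le> length (b k)" using a by (cases a) (simp_all add: len_b)
    then show ?case using Suc by (simp add: pre_Suc)
  qed simp
  have walk_b: "walk E p (b k) p" for k
    unfolding b_def
    by (rule walk_appendI[OF walk_replicate[OF w(2)] walk_appendI[OF w(3) walk_appendI[OF walk_replicate[OF w(4)] w(5)]]])
  have walk_pre: "walk E s (pre k) p" for k
  proof (induction k)
    case 0
    then show ?case using w(1) by (simp add: pre_def)
  next
    case (Suc k)
    then show ?case unfolding pre_Suc using walk_b by (rule walk_appendI)
  qed
  have pre_mono: "\<exists>zs. pre k' = pre k @ zs" if "k \<le> k'" for k k'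
    using that by (induction k' rule: dec_induct) (auto simp: pre_Suc)
  have long: "N < length (pre (N + 3))" for N
    using len_pre[of "N + 3"] by (simp add: algebra_simps)
  \<comment> \<open>The prefixes extend each other, so any long enough one determines position
    \<open>i\<close>; by the quadratic growth, \<open>i + 3\<close> blocks are enough.\<close>
  define r where "r = (\<lambda>i. pre (i + 3) ! i)"
  have r: "r i = pre K ! i" if "i < length (pre K)" for i K
  proof (cases "K \<le> i + 3")
    case True
    then show ?thesis using pre_mono[OF True] that by (auto simp: r_def nth_append)
  next
    case False
    then show ?thesis using pre_mono[of "i + 3" K] long[of i] by (auto simp: r_def nth_append)
  qed
  have map_r: "map r [0..<N] = take N (pre K)" if "N \<le> length (pre K)" for N K
    using that r by (intro nth_equalityI) auto
  have "r 0 = s"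
    using walk_first[OF walk_pre[of 3]] long[of 0] by (simp add: r_def nth_append)
  moreover have "(r i, r (Suc i)) \<in> E" for i
    using walk_nth[OF walk_pre[of "Suc i + 3"], of i] long[of "Suc i"] r[of i "Suc i + 3"] r[of "Suc i" "Suc i + 3"]
    by (simp add: nth_append)
  moreover have "(\<lambda>n. 1 / real (n + 1) * (\<Sum>i\<le>n. g (r i))) \<longlonglongrightarrow>
      (real x1 * sum_list (map g C1) + real x2 * sum_list (map g C2)) /
      (real x1 * real (length C1) + real x2 * real (length C2))" (is "_ \<longlonglongrightarrow> ?\<mu>") for g :: "'s \<Rightarrow> real"
  proof -
    define \<mu> where "\<mu> = ?\<mu>"
    define h where "h = (\<lambda>v. g v - \<mu>)"
    define W where "W = set (P0 @ C1 @ P1 @ C2 @ P2)"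
    define M where "M = (\<Sum>v\<in>W. \<bar>h v\<bar>)"
    have M: "\<bar>h v\<bar> \<le> M" if "v \<in> W" for v
      unfolding M_def using that by (intro member_le_sum) (auto simp: W_def)
    have M0: "M \<ge> 0" unfolding M_def by (intro sum_nonneg) auto
    have aR: "real x1 * real (length C1) + real x2 * real (length C2) = real a"
      by (simp add: a_def)
    have sub: "sum_list (map h C) = sum_list (map g C) - \<mu> * real (length C)" for C
      by (induction C) (auto simp: h_def algebra_simps)
    \<comment> \<open>By the choice of \<open>\<mu>\<close> a weighted round of both cycles has
      deviation 0. A block thus deviates by the constant \<open>K0\<close> of the connecting walks,
      whatever its length.\<close>
    have "real x1 * sum_list (map h C1) + real x2 * sum_list (map h C2) =
        (real x1 * sum_list (map g C1) + real x2 * sum_list (map g C2)) - \<mu> * real a"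
      unfolding sub aR[symmetric] by (simp only: ring_distribs) (simp add: mult_ac)
    also have "\<dots> = 0" unfolding \<mu>_def aR using a by simp
    finally have bal: "real x1 * sum_list (map h C1) + real x2 * sum_list (map h C2) = 0" .
    define K0 where "K0 = sum_list (map h P1) + sum_list (map h P2)"
    have "sum_list (map h (b k)) =
        real k * (real x1 * sum_list (map h C1) + real x2 * sum_list (map h C2)) + K0" for k
      by (simp add: b_def K0_def sum_list_concat_replicate algebra_simps)
    then have sum_b: "sum_list (map h (b k)) = K0" for k using bal by simp
    have sum_pre: "sum_list (map h (pre k)) = sum_list (map h P0) + real k * K0" for k
      by (induction k) (auto simp: pre_Suc sum_b algebra_simps, simp add: pre_def)
    have set_b: "set (b k) \<subseteq> W" for k by (auto simp: b_def W_def)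
    have set_P0: "set P0 \<subseteq> W" by (auto simp: W_def)
    define A where "A = M * real (length P0) + \<bar>K0\<bar> + M * real a + M * real d"
    have A0: "A \<ge> 0" unfolding A_def using M0 by auto
    have "\<bar>\<Sum>i<N. g (r i) - \<mu>\<bar> \<le> (2 * A) * (1 + sqrt (real N))" for N
    proof -
      \<comment> \<open>\<open>k\<close> is the block that contains position \<open>N\<close>, and 0
        if \<open>N\<close> still lies in the initial walk.\<close>
      define k where "k = (LEAST k. N < length (pre (Suc k)))"
      have "N < length (pre (Suc (N + 2)))" using long[of N] by (simp add: numeral_3_eq_3)
      then have kN: "N < length (pre (Suc k))" unfolding k_def by (rule LeastI)
      have "(\<Sum>i<N. g (r i) - \<mu>) = sum_list (map h (map r [0..<N]))"
        by (simp add: h_def interv_sum_list_conv_sum_set_nat atLeast0LessThan comp_def)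
      then have D: "(\<Sum>i<N. g (r i) - \<mu>) = sum_list (map h (take N (pre (Suc k))))"
        using map_r[of N "Suc k"] kN by simp
      show ?thesis
      proof (cases "length (pre k) \<le> N")
        case True
        define N' where "N' = N - length (pre k)"
        have tk: "take N (pre (Suc k)) = pre k @ take N' (b k)"
          using True by (simp add: pre_Suc N'_def)
        have 1: "\<bar>sum_list (map h (take N' (b k)))\<bar> \<le> M * real (length (take N' (b k)))"
          using set_b[of k] M by (intro abs_sum_list_le) (meson in_set_takeD subsetD)
        also have "\<dots> \<le> M * (real k * real a + real d)"
          using M0 by (intro mult_left_mono) (auto simp: len_b min_def simp flip: of_nat_mult of_nat_add)
        finally have 1: "\<bar>sum_list (map h (take N' (b k)))\<bar> \<le> M * (real k * real a + real d)" .
        have 2: "\<bar>sum_list (map h P0)\<bar> \<le> M * real (length P0)"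
          using set_P0 M by (intro abs_sum_list_le) blast
        have "\<bar>\<Sum>i<N. g (r i) - \<mu>\<bar> \<le> M * real (length P0) + real k * \<bar>K0\<bar> + M * (real k * real a + real d)"
        proof -
          have "\<bar>real k * K0\<bar> = real k * \<bar>K0\<bar>" by (simp add: abs_mult)
          then show ?thesis using 1 2 unfolding D tk by (simp add: sum_pre)
        qed
        also have "\<dots> \<le> A * (1 + real k)"
          using M0 by (simp add: A_def algebra_simps)
        finally have 3: "\<bar>\<Sum>i<N. g (r i) - \<mu>\<bar> \<le> A * (1 + real k)" .
        \<comment> \<open>Position \<open>N\<close> lies behind the first \<open>k\<close> blocks,
          so \<open>N\<close> is at least k (k - 1) / 2.\<close>
        have "real k \<le> 1 + 2 * sqrt (real N)"
        proof (rule ccontr)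
          assume "\<not> ?thesis"
          then have k: "real k - 1 > 2 * sqrt (real N)" by simp
          have "(2 * sqrt (real N))\<^sup>2 \<le> (real k - 1)\<^sup>2"
            using k by (intro power_mono) auto
          moreover have "(2 * sqrt (real N))\<^sup>2 = 4 * real N" by (simp add: power_mult_distrib)
          moreover have "(real k - 1)\<^sup>2 = real k * real k - 2 * real k + 1"
            by (simp add: power2_eq_square algebra_simps)
          ultimately have "4 * real N \<le> real k * real k - 2 * real k + 1" by simp
          moreover have "real k * real k \<le> 2 * real N + real k"
            using len_pre[of k] True by (simp flip: of_nat_mult of_nat_add)
          moreover have "real k > 1" using k by (smt (verit) real_sqrt_ge_zero of_nat_0_le_iff)
          moreover have "N = 0 \<Longrightarrow> k \<le> 1"
            using len_pre[of k] True by (cases k) auto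
          ultimately show False by (cases "N = 0") auto
        qed
        then have "1 + real k \<le> 2 * (1 + sqrt (real N))" by simp
        then have "A * (1 + real k) \<le> A * (2 * (1 + sqrt (real N)))"
          using A0 by (rule mult_left_mono)
        then show ?thesis using 3 by (simp add: algebra_simps)
      next
        case False
        then have "k = 0"
          using not_less_Least[of "k - 1" "\<lambda>k. N < length (pre (Suc k))"]
          unfolding k_def[symmetric] by (cases k) auto
        then have "take N (pre (Suc k)) = take N P0"
          using False by (simp add: pre_Suc) (simp add: pre_def)
        moreover have "\<bar>sum_list (map h (take N P0))\<bar> \<le> M * real (length (take N P0))"
          using set_P0 M by (intro abs_sum_list_le) (meson in_set_takeD subsetD)
        moreover have "M * real (length (take N P0)) \<le> M * real (length P0)"
          using M0 by (intro mult_left_mono) auto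
        moreover have "M * real (length P0) \<le> A" unfolding A_def using M0 by simp
        moreover have "A \<le> 2 * A * (1 + sqrt (real N))"
          using A0 mult_left_mono[of 1 "2 * (1 + sqrt (real N))" A] by (simp add: algebra_simps)
        ultimately show ?thesis unfolding D by simp
      qed
    qed
    then show ?thesis unfolding \<mu>_def[symmetric] by (rule avg_tendsto)
  qed
  ultimately show thesis by (rule that)
qed

section \<open>Certificates from runs\<close>

text \<open>A walk of more than \<open>n\<close> states repeats one among the first
  \<open>Suc n\<close>. The closed walk in between has length at most \<open>n\<close> and
  non-negative weight, so the shorter walk left after cutting it out weighs no more; at most
  \<open>n\<close> states remain in the end.\<close>

lemma walk_weight_bound:
  fixes w :: "'s \<Rightarrow> real"
  assumes cyc: "\<And>p C. walk E p C p \<Longrightarrow> C \<noteq> [] \<Longrightarrow> length C \<le> n \<Longrightarrow> sum_list (map w C) \<ge> 0"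
    and V: "finite V" "card V \<le> n" "E \<subseteq> V \<times> V" and M: "\<And>v. v \<in> V \<Longrightarrow> \<bar>w v\<bar> \<le> M" "0 \<le> M"
    and vs: "walk E a vs b"
  shows "sum_list (map w vs) \<ge> - (M * real n)"
  using vs
proof (induction vs rule: length_induct)
  case (1 vs)
  have set: "set vs \<subseteq> V" using walk_set 1(2) V(3) by metis
  show ?case
  proof (cases "length vs \<le> n")
    case True
    have "\<bar>sum_list (map w vs)\<bar> \<le> M * real (length vs)"
      using set M by (intro abs_sum_list_le) blast
    also have "\<dots> \<le> M * real n" using True M by (intro mult_left_mono) auto
    finally show ?thesis by linarith
  next
    case False
    have "card (set (take (Suc n) vs)) \<le> n"
      using card_mono[OF V(1), of "set (take (Suc n) vs)"] set set_take_subset[of "Suc n" vs] V(2) by force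
    then have "\<not> distinct (take (Suc n) vs)"
      using False distinct_card[of "take (Suc n) vs"] by auto
    then obtain xs ys zs y where d: "take (Suc n) vs = xs @ [y] @ ys @ [y] @ zs"
      using not_distinct_decomp by blast
    define us where "us = zs @ drop (Suc n) vs"
    have eq: "vs = xs @ (y # ys) @ (y # us)"
      using append_take_drop_id[of "Suc n" vs] unfolding d us_def by simp
    have "length (take (Suc n) vs) = Suc n" using False by simp
    then have len: "length (y # ys) \<le> n" unfolding d by simp
    from 1(2) obtain p q where w: "walk E a xs p" "walk E p (y # ys) q" "walk E q (y # us) b"
      unfolding eq walk_append by blast
    have [simp]: "p = y" "q = y" using w by auto
    have "walk E a (xs @ y # us) b" using w by (auto simp: walk_append)
    moreover have "length (xs @ y # us) < length vs" using eq by simp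
    ultimately have "sum_list (map w (xs @ y # us)) \<ge> - (M * real n)" using 1(1) by blast
    moreover have "sum_list (map w (y # ys)) \<ge> 0" using w(2) len by (intro cyc[of y]) simp_all
    ultimately show ?thesis unfolding eq by simp
  qed
qed

lemma separate_finite:
  fixes X Y :: "real set"
  assumes "finite X" "finite Y" "X \<noteq> {}" "\<And>x y. x \<in> X \<Longrightarrow> y \<in> Y \<Longrightarrow> x < y"
  shows "\<exists>k. (\<forall>x\<in>X. x < k) \<and> (\<forall>y\<in>Y. k < y)"
proof (cases "Y = {}")
  case True
  have "x < Max X + 1" if "x \<in> X" for x
    using Max_ge[OF assms(1) that] by simp
  then show ?thesis using True by (intro exI[of _ "Max X + 1"]) auto
next
  case False
  have "Max X < Min Y" using assms False by simp
  then obtain k where "Max X < k" "k < Min Y" using dense by blast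
  then show ?thesis using assms False by (intro exI[of _ k]) auto
qed

lemma positive_lower_bound:
  fixes f :: "'a \<Rightarrow> real"
  assumes "finite A" "\<And>x. x \<in> A \<Longrightarrow> f x > 0"
  obtains e where "e > 0" "\<And>x. x \<in> A \<Longrightarrow> e \<le> f x"
  using assms by (intro that[of "Min (insert 1 (f ` A))"]) auto

section \<open>Moments of cycles and separation by a line\<close>

definition tot :: "('s \<Rightarrow> nat) \<Rightarrow> 's list \<Rightarrow> real" where
  "tot \<rho> C = (\<Sum>v\<leftarrow>C. real (\<rho> v))"

definition tot2 :: "('s \<Rightarrow> nat) \<Rightarrow> 's list \<Rightarrow> real" where
  "tot2 \<rho> C = (\<Sum>v\<leftarrow>C. (real (\<rho> v))\<^sup>2)"

lemma sum_list_quadratic: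
  "(\<Sum>v\<leftarrow>C. (real (\<rho> v) - m)\<^sup>2 - c - \<kappa> * (real (\<rho> v) - b) - e) =
    tot2 \<rho> C - 2 * m * tot \<rho> C + (m\<^sup>2 - c - e) * real (length C) - \<kappa> * (tot \<rho> C - b * real (length C))"
  by (induction C) (auto simp: tot_def tot2_def power2_eq_square algebra_simps)

text \<open>Mean at least \<open>b\<close> and variance at most \<open>c\<close> for endless
  repetition of the cycle; denominators are cleared by the length and its square.\<close>

definition single_ok :: "('s \<Rightarrow> nat) \<Rightarrow> real \<Rightarrow> real \<Rightarrow> 's list \<Rightarrow> bool" where
  "single_ok \<rho> b c C \<longleftrightarrow> tot \<rho> C \<ge> b * length C \<and>
     tot2 \<rho> C * length C - (tot \<rho> C)\<^sup>2 \<le> c * (length C)\<^sup>2"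

text \<open>The weights \<open>b * length C2 - tot \<rho> C2\<close> and \<open>tot \<rho> C1 - b * length C1\<close> of the two cycles make the
  mean equal to \<open>b\<close>.\<close>

definition mixed_ok :: "('s \<Rightarrow> nat) \<Rightarrow> real \<Rightarrow> real \<Rightarrow> 's list \<Rightarrow> 's list \<Rightarrow> bool" where
  "mixed_ok \<rho> b c C1 C2 \<longleftrightarrow> tot \<rho> C1 > b * length C1 \<and> tot \<rho> C2 < b * length C2 \<and>
     (b * length C2 - tot \<rho> C2) * tot2 \<rho> C1 + (tot \<rho> C1 - b * length C1) * tot2 \<rho> C2 \<le>
       (c + b\<^sup>2) * ((b * length C2 - tot \<rho> C2) * length C1 + (tot \<rho> C1 - b * length C1) * length C2)"

text \<open>The variance is bounded below through its linearization at \<open>m\<close>, which equals the mean payoff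
  of the run. If no certificate exists, a line separates the cycles from the admissible region in
  the plane of first and second moments, with slope \<open>\<kappa> \<ge> 0\<close> and slack \<open>e > 0\<close>.\<close>

lemma separating_weight:
  fixes b c m :: real
  assumes fin: "finite \<C>"
    and ne: "\<And>C. C \<in> \<C> \<Longrightarrow> C \<noteq> []"
    and no1: "\<And>C. C \<in> \<C> \<Longrightarrow> \<not> single_ok \<rho> b c C"
    and no2: "\<And>C1 C2. C1 \<in> \<C> \<Longrightarrow> C2 \<in> \<C> \<Longrightarrow> \<not> mixed_ok \<rho> b c C1 C2"
  obtains \<kappa> e where "\<kappa> \<ge> 0" "e > 0"
    "\<And>C. C \<in> \<C> \<Longrightarrow> (\<Sum>v\<leftarrow>C. (real (\<rho> v) - m)\<^sup>2 - c - \<kappa> * (real (\<rho> v) - b) - e) \<ge> 0"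
proof -
  \<comment> \<open>\<open>A C\<close> and \<open>\<Lambda> C\<close> are the sums over the cycle of
    \<open>\<rho> v - b\<close> and of the squared deviation from \<open>m\<close> minus
    \<open>c\<close>.\<close>
  define A where "A = (\<lambda>C. tot \<rho> C - b * real (length C))"
  define \<Lambda> where "\<Lambda> = (\<lambda>C. tot2 \<rho> C - 2 * m * tot \<rho> C + (m\<^sup>2 - c) * real (length C))"
  \<comment> \<open>Squared deviations are smallest around the cycle's own mean; if those around
    \<open>m\<close> were small enough, \<open>C\<close> alone would be a certificate.\<close>
  have pos: "\<Lambda> C > 0" if C: "C \<in> \<C>" "A C \<ge> 0" for C
  proof (rule ccontr)
    assume "\<not> \<Lambda> C > 0"
    define L where "L = real (length C)"
    define S where "S = tot \<rho> C"
    have "\<Lambda> C * L \<le> 0"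
      using \<open>\<not> \<Lambda> C > 0\<close> by (intro mult_nonpos_nonneg) (auto simp: L_def)
    moreover have "0 \<le> (S - m * L)\<^sup>2" by simp
    ultimately have "tot2 \<rho> C * L - S\<^sup>2 \<le> c * L\<^sup>2"
      by (simp add: \<Lambda>_def L_def[symmetric] S_def[symmetric] power2_eq_square algebra_simps)
    then show False using no1[OF C(1)] C(2) by (simp add: single_ok_def A_def L_def S_def)
  qed
  \<comment> \<open>Failure of this inequality would make the mixture with weights
    \<open>- A C2\<close> and \<open>A C1\<close>, whose mean is \<open>b\<close>, satisfy
    \<open>mixed_ok\<close>. So the slopes of cycles below \<open>b\<close> are less than those of
    cycles above \<open>b\<close>, and \<open>\<kappa>\<close> fits in between.\<close>
  have cross: "\<Lambda> C2 / A C2 < \<Lambda> C1 / A C1" if C: "C1 \<in> \<C>" "C2 \<in> \<C>" "A C1 > 0" "A C2 < 0" for C1 C2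
  proof (rule ccontr)
    assume "\<not> ?thesis"
    then have le: "\<Lambda> C1 / A C1 \<le> \<Lambda> C2 / A C2" by simp
    have "(- A C2 * A C1) * (\<Lambda> C1 / A C1) \<le> (- A C2 * A C1) * (\<Lambda> C2 / A C2)"
      by (rule mult_left_mono[OF le]) (use C in \<open>simp add: mult_nonneg_nonpos2 mult_nonpos_nonneg\<close>)
    then have *: "- A C2 * \<Lambda> C1 + A C1 * \<Lambda> C2 \<le> 0"
      using C by (simp add: field_simps)
    define x1 x2 where "x1 = - A C2" and "x2 = A C1"
    define L1 L2 S1 S2 where "L1 = real (length C1)" "L2 = real (length C2)" "S1 = tot \<rho> C1" "S2 = tot \<rho> C2"
    note defs = x1_def x2_def L1_L2_S1_S2_def
    have mean: "x1 * S1 + x2 * S2 = b * (x1 * L1 + x2 * L2)"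
      by (simp add: defs A_def algebra_simps)
    have L: "x1 * L1 + x2 * L2 \<ge> 0"
    proof -
      have "x1 \<ge> 0" "x2 \<ge> 0" "L1 \<ge> 0" "L2 \<ge> 0" using C by (simp_all add: defs)
      then show ?thesis by simp
    qed
    have "x1 * tot2 \<rho> C1 + x2 * tot2 \<rho> C2 - 2 * m * (x1 * S1 + x2 * S2) + (m\<^sup>2 - c) * (x1 * L1 + x2 * L2) \<le> 0"
      using * by (simp add: defs \<Lambda>_def algebra_simps)
    then have "x1 * tot2 \<rho> C1 + x2 * tot2 \<rho> C2 \<le> (c + 2 * m * b - m\<^sup>2) * (x1 * L1 + x2 * L2)"
      unfolding mean by (simp add: algebra_simps)
    \<comment> \<open>The tangent of the parabola at \<open>m\<close> lies below it: 2 m b - m m is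
      at most b b.\<close>
    also have "\<dots> \<le> (c + b\<^sup>2) * (x1 * L1 + x2 * L2)"
    proof (rule mult_right_mono[OF _ L])
      have "0 \<le> (m - b)\<^sup>2" by simp
      then show "c + 2 * m * b - m\<^sup>2 \<le> c + b\<^sup>2" by (simp add: power2_eq_square algebra_simps)
    qed
    finally show False using no2[OF C(1,2)] C(3,4) by (simp add: mixed_ok_def defs A_def)
  qed
  \<comment> \<open>The 0 in \<open>X\<close> forces \<open>\<kappa>\<close> to be non-negative; it
    may be added because \<open>pos\<close> makes the slopes in \<open>Y\<close> positive.\<close>
  define X where "X = insert 0 ((\<lambda>C. \<Lambda> C / A C) ` {C \<in> \<C>. A C < 0})"
  define Y where "Y = (\<lambda>C. \<Lambda> C / A C) ` {C \<in> \<C>. A C > 0}"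
  have XY: "finite X" "finite Y" "X \<noteq> {}" unfolding X_def Y_def using fin by auto
  have "x < y" if "x \<in> X" "y \<in> Y" for x y
    using that cross pos by (auto simp: X_def Y_def)
  from separate_finite[OF XY this] obtain \<kappa> where \<kappa>: "\<And>x. x \<in> X \<Longrightarrow> x < \<kappa>" "\<And>y. y \<in> Y \<Longrightarrow> \<kappa> < y"
    by blast
  have W: "\<Lambda> C - \<kappa> * A C > 0" if C: "C \<in> \<C>" for C
  proof (cases "A C" "0 :: real" rule: linorder_cases)
    case less
    then have "\<Lambda> C / A C < \<kappa>" using \<kappa>(1) C by (auto simp: X_def)
    then show ?thesis using less by (simp add: neg_divide_less_eq)
  next
    case equal
    then show ?thesis using pos[OF C] by simp
  next
    case greater
    then have "\<kappa> < \<Lambda> C / A C" using \<kappa>(2) C by (auto simp: Y_def)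
    then show ?thesis using greater by (simp add: pos_less_divide_eq)
  qed
  have lenpos: "real (length C) > 0" if "C \<in> \<C>" for C using ne[OF that] by simp
  obtain e where e: "e > 0" "\<And>C. C \<in> \<C> \<Longrightarrow> e \<le> (\<Lambda> C - \<kappa> * A C) / real (length C)"
    using positive_lower_bound[OF fin, of "\<lambda>C. (\<Lambda> C - \<kappa> * A C) / real (length C)"] W lenpos
    by (metis divide_pos_pos)
  show thesis
  proof (rule that)
    show "\<kappa> \<ge> 0" using \<kappa>(1)[of 0] by (simp add: X_def)
    fix C assume C: "C \<in> \<C>"
    have "e * real (length C) \<le> \<Lambda> C - \<kappa> * A C"
      using e(2)[OF C] lenpos[OF C] by (simp add: pos_le_divide_eq)
    then show "(\<Sum>v\<leftarrow>C. (real (\<rho> v) - m)\<^sup>2 - c - \<kappa> * (real (\<rho> v) - b) - e) \<ge> 0"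
      unfolding sum_list_quadratic by (simp add: \<Lambda>_def A_def algebra_simps)
  qed (rule e(1))
qed

section \<open>From bounds on averages to \<open>mp\<close> and \<open>va\<close>\<close>

lemma bounded_avg:
  fixes g :: "'s \<Rightarrow> real"
  assumes "finite (range r)"
  obtains R where "\<And>n. 1 / real (n + 1) * (\<Sum>i\<le>n. g (r i)) \<le> R"
proof (rule that)
  fix n
  have "g (r i) \<le> Max (g ` range r)" for i using assms by (intro Max_ge) auto
  then have "(\<Sum>i\<le>n. g (r i)) \<le> real (n + 1) * Max (g ` range r)"
    using sum_bounded_above[of "{..n}" "\<lambda>i. g (r i)"] by simp
  then show "1 / real (n + 1) * (\<Sum>i\<le>n. g (r i)) \<le> Max (g ` range r)" by (simp add: field_simps)
qed

text \<open>The averages lie between 0 and the largest reward that occurs, so the lower limit is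
  finite and \<open>real_of_ereal\<close> keeps it; the averages eventually exceed any number below
  it.\<close>

lemma mp_lower:
  assumes fin: "finite (range r)" and d: "d < mp \<rho> r"
  shows "\<forall>\<^sub>F n in sequentially. d < 1 / real (n + 1) * (\<Sum>i\<le>n. real (\<rho> (r i)))"
proof -
  let ?a = "\<lambda>n. 1 / real (n + 1) * (\<Sum>i\<le>n. real (\<rho> (r i)))"
  let ?l = "liminf (\<lambda>n. ereal (?a n))"
  obtain R where R: "\<And>n. ?a n \<le> R"
    by (rule bounded_avg[OF fin, of "\<lambda>v. real (\<rho> v)"]) (rule that)
  have "0 \<le> ?a n" for n by (simp add: sum_nonneg)
  then have l0: "0 \<le> ?l" by (intro Liminf_bounded always_eventually) (auto simp: zero_ereal_def)
  have "?l \<le> limsup (\<lambda>n. ereal (?a n))" by (intro Liminf_le_Limsup) simp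
  also have "limsup (\<lambda>n. ereal (?a n)) \<le> ereal R"
    by (intro Limsup_bounded always_eventually) (use R in auto)
  finally have lR: "?l \<le> ereal R" .
  have "ereal (mp \<rho> r) = ?l" unfolding mp_def using l0 lR by (cases ?l) auto
  moreover have "ereal d < ereal (mp \<rho> r)" using d by simp
  ultimately have "ereal d < ?l" by simp
  from less_LiminfD[OF this] show ?thesis by simp
qed

lemma va_ge:
  assumes fin: "finite (range r)"
    and ev: "\<forall>\<^sub>F n in sequentially. v \<le> 1 / real (n + 1) * (\<Sum>i\<le>n. (real (\<rho> (r i)) - mp \<rho> r)\<^sup>2)"
  shows "v \<le> va \<rho> r"
proof -
  let ?a = "\<lambda>n. 1 / real (n + 1) * (\<Sum>i\<le>n. (real (\<rho> (r i)) - mp \<rho> r)\<^sup>2)"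
  let ?l = "limsup (\<lambda>n. ereal (?a n))"
  obtain R where R: "\<And>n. ?a n \<le> R"
    by (rule bounded_avg[OF fin, of "\<lambda>v. (real (\<rho> v) - mp \<rho> r)\<^sup>2"]) (rule that)
  have "ereal v \<le> liminf (\<lambda>n. ereal (?a n))"
    using ev by (intro Liminf_bounded) (auto elim: eventually_mono)
  moreover have "liminf (\<lambda>n. ereal (?a n)) \<le> ?l" by (intro Liminf_le_Limsup) simp
  moreover have "?l \<le> ereal R" by (intro Limsup_bounded always_eventually) (use R in auto)
  ultimately have "ereal v \<le> ?l" "?l \<le> ereal R" by (blast intro: order_trans)+
  then show ?thesis unfolding va_def by (cases ?l) auto
qed

lemma sum_lessThan_add: "(\<Sum>i<m + n. f i) = (\<Sum>i<m. f i) + (\<Sum>i<n. f (m + i))"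
  for f :: "nat \<Rightarrow> 'a :: comm_monoid_add" and m n :: nat
  by (induction n) (auto simp: add_ac)

text \<open>Otherwise \<open>separating_weight\<close> yields a weight that is non-negative on the
  short closed walks among the states visited infinitely often. Its sums along the run are bounded
  below, and division by time puts the average squared deviation above \<open>c + e / 2\<close> from
  some time on.\<close>

lemma certificate_of_run:
  fixes b c :: real
  assumes G: "is_graph G" and r: "r \<in> runs G" and mp: "mp \<rho> r \<ge> b" and va: "va \<rho> r \<le> c"
  obtains p q C1 C2 where "(r 0, p) \<in> (edges G)\<^sup>*" "(p, q) \<in> (edges G)\<^sup>*" "(q, p) \<in> (edges G)\<^sup>*"
    "walk (edges G) p C1 p" "walk (edges G) q C2 q" "C1 \<noteq> []" "C2 \<noteq> []"
    "length C1 \<le> card (states G)" "length C2 \<le> card (states G)"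
    "single_ok \<rho> b c C1 \<or> mixed_ok \<rho> b c C1 C2"
proof (rule ccontr)
  assume "\<not> thesis"
  note no = this[unfolded not_def, rule_format, OF that]
  define S where "S = states G"
  define n where "n = card S"
  have S: "finite S" and ES: "edges G \<subseteq> S \<times> S" using G by (simp_all add: S_def is_graph_def)
  have rS: "r i \<in> S" for i
    using r ES by (cases i) (auto simp: runs_def S_def)
  have rE: "(r i, r (Suc i)) \<in> edges G" for i using r by (simp add: runs_def)
  have reach: "(r i, r j) \<in> (edges G)\<^sup>*" if "i \<le> j" for i j
    using that by (induction j rule: dec_induct) (auto intro: rtrancl_into_rtrancl rE)
  \<comment> \<open>States visited infinitely often reach each other, and the run eventually stays
    among them; so any two cycles in \<open>V\<close> can be connected as a certificate
    requires.\<close>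
  define V where "V = {v \<in> S. infinite {i. r i = v}}"
  have V: "finite V" "card V \<le> n" using S by (auto simp: V_def n_def intro: card_mono)
  have "finite (\<Union>v\<in>S - V. {i. r i = v})" using S by (auto simp: V_def)
  moreover have "(\<Union>v\<in>S - V. {i. r i = v}) = {i. r i \<notin> V}" using rS by auto
  ultimately obtain N0 where N0: "\<forall>i\<in>{i. r i \<notin> V}. i < N0"
    unfolding finite_nat_set_iff_bounded by auto
  have rV: "r i \<in> V" if "i \<ge> N0" for i
  proof (rule ccontr)
    assume "r i \<notin> V"
    then have "i < N0" using N0 by simp
    with that show False by simp
  qed
  have hit: "\<exists>i. r i = v" if "v \<in> V" for v
    using that not_finite_existsD[of "\<lambda>i. r i = v"] by (simp add: V_def)
  have conn: "(u, v) \<in> (edges G)\<^sup>*" if "u \<in> V" "v \<in> V" for u v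
  proof -
    obtain i where i: "r i = u" using hit[OF \<open>u \<in> V\<close>] by blast
    obtain j where "j \<ge> i" "r j = v"
      using \<open>v \<in> V\<close> unfolding V_def infinite_nat_iff_unbounded_le by blast
    then show ?thesis using reach[of i j] i by simp
  qed
  define E' where "E' = edges G \<inter> V \<times> V"
  define \<C> where "\<C> = {C. set C \<subseteq> V \<and> length C \<le> n \<and> C \<noteq> [] \<and> (\<exists>p. walk E' p C p)}"
  have fin: "finite \<C>"
    by (rule finite_subset[OF _ finite_lists_length_le[OF V(1), of n]]) (auto simp: \<C>_def)
  have cyc: "\<exists>p\<in>V. walk (edges G) p C p \<and> C \<noteq> [] \<and> length C \<le> card (states G)" if C: "C \<in> \<C>" for C
  proof -
    obtain p where p: "walk E' p C p" "C \<noteq> []" using C by (auto simp: \<C>_def)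
    then have "p \<in> V" by (cases C) (auto simp: E'_def)
    moreover have "walk (edges G) p C p" by (rule walk_mono[OF p(1)]) (simp add: E'_def)
    ultimately show ?thesis using C by (auto simp: \<C>_def n_def S_def)
  qed
  have r0: "(r 0, p) \<in> (edges G)\<^sup>*" if "p \<in> V" for p
  proof -
    obtain i where "r i = p" using hit[OF \<open>p \<in> V\<close>] by blast
    then show ?thesis using reach[of 0 i] by simp
  qed
  obtain \<kappa> e where \<kappa>: "\<kappa> \<ge> 0" "e > 0" and
    w: "\<And>C. C \<in> \<C> \<Longrightarrow> (\<Sum>v\<leftarrow>C. (real (\<rho> v) - mp \<rho> r)\<^sup>2 - c - \<kappa> * (real (\<rho> v) - b) - e) \<ge> 0"
  proof (rule separating_weight[where \<rho> = \<rho> and b = b and c = c and m = "mp \<rho> r", OF fin])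
    show "C \<noteq> []" if "C \<in> \<C>" for C using cyc[OF that] by blast
    show "\<not> single_ok \<rho> b c C" if C: "C \<in> \<C>" for C
    proof
      assume *: "single_ok \<rho> b c C"
      from cyc[OF C] obtain p where p: "p \<in> V" "walk (edges G) p C p" "C \<noteq> []" "length C \<le> card (states G)"
        by blast
      \<comment> \<open>One cycle serves in both roles, with \<open>q = p\<close>.\<close>
      show False
        by (rule no[of p p C C]) (use p * r0[OF p(1)] in auto)
    qed
    show "\<not> mixed_ok \<rho> b c C1 C2" if C: "C1 \<in> \<C>" "C2 \<in> \<C>" for C1 C2
    proof
      assume *: "mixed_ok \<rho> b c C1 C2"
      from cyc[OF C(1)] obtain p where p: "p \<in> V" "walk (edges G) p C1 p" "C1 \<noteq> []" "length C1 \<le> card (states G)"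
        by blast
      from cyc[OF C(2)] obtain q where q: "q \<in> V" "walk (edges G) q C2 q" "C2 \<noteq> []" "length C2 \<le> card (states G)"
        by blast
      show False
        by (rule no[OF r0[OF p(1)] conn[OF p(1) q(1)] conn[OF q(1) p(1)] p(2) q(2) p(3) q(3) p(4) q(4)])
          (use * in blast)
    qed
  qed blast
  define w' where "w' = (\<lambda>v. (real (\<rho> v) - mp \<rho> r)\<^sup>2 - c - \<kappa> * (real (\<rho> v) - b) - e)"
  define M where "M = (\<Sum>v\<in>S. \<bar>w' v\<bar>)"
  have M: "\<bar>w' v\<bar> \<le> M" if "v \<in> S" for v unfolding M_def using that S by (intro member_le_sum) auto
  have M0: "M \<ge> 0" unfolding M_def by (intro sum_nonneg) auto
  define B where "B = M * real N0 + M * real n"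
  \<comment> \<open>The first \<open>N0\<close> steps weigh at most \<open>M\<close> each in
    absolute value; from then on the run is a walk in \<open>E'\<close>, to which
    \<open>walk_weight_bound\<close> applies.\<close>
  have low: "(\<Sum>i\<le>N. w' (r i)) \<ge> - B" for N
  proof (cases "N0 \<le> Suc N")
    case True
    have "walk E' (r N0) (map (\<lambda>i. r (N0 + i)) [0..<Suc N - N0]) (r (N0 + (Suc N - N0)))"
      using walk_map_upt[of "Suc N - N0" "\<lambda>i. r (N0 + i)" E'] rV rE by (simp add: E'_def)
    then have "sum_list (map w' (map (\<lambda>i. r (N0 + i)) [0..<Suc N - N0])) \<ge> - (M * real n)"
    proof (rule walk_weight_bound[rotated -1])
      show "sum_list (map w' C) \<ge> 0" if "walk E' p C p" "C \<noteq> []" "length C \<le> n" for p C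
        unfolding w'_def by (rule w) (use that walk_set[of E' p C p V V] in \<open>auto simp: \<C>_def E'_def\<close>)
      show "\<bar>w' v\<bar> \<le> M" if "v \<in> V" for v using that M by (simp add: V_def)
    qed (use V M0 in \<open>auto simp: E'_def\<close>)
    then have 1: "(\<Sum>i<Suc N - N0. w' (r (N0 + i))) \<ge> - (M * real n)"
      by (simp add: interv_sum_list_conv_sum_set_nat atLeast0LessThan comp_def)
    have "\<bar>\<Sum>i<N0. w' (r i)\<bar> \<le> (\<Sum>i<N0. M)"
      by (rule order_trans[OF sum_abs]) (intro sum_mono M rS)
    then have 2: "(\<Sum>i<N0. w' (r i)) \<ge> - (M * real N0)" by (simp add: mult.commute abs_le_iff)
    have "(\<Sum>i\<le>N. w' (r i)) = (\<Sum>i<N0 + (Suc N - N0). w' (r i))"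
      using True by (simp add: lessThan_Suc_atMost)
    also have "\<dots> = (\<Sum>i<N0. w' (r i)) + (\<Sum>i<Suc N - N0. w' (r (N0 + i)))"
      by (rule sum_lessThan_add)
    finally show ?thesis using 1 2 by (simp add: B_def)
  next
    case False
    have "\<bar>\<Sum>i\<le>N. w' (r i)\<bar> \<le> (\<Sum>i\<le>N. M)"
      by (rule order_trans[OF sum_abs]) (intro sum_mono M rS)
    also have "\<dots> = M * real (Suc N)" by simp
    also have "\<dots> \<le> M * real N0" using False M0 by (intro mult_left_mono) auto
    finally have "- (M * real N0) \<le> (\<Sum>i\<le>N. w' (r i))" by (simp add: abs_le_iff)
    moreover have "0 \<le> M * real n" using M0 by simp
    ultimately show ?thesis unfolding B_def by linarith
  qed
  have fr: "finite (range r)" by (rule finite_subset[OF _ S]) (use rS in auto)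
  \<comment> \<open>The slack \<open>e\<close> is shared out: a quarter for averages that may lie
    below the mean payoff by \<open>\<delta>\<close>, a quarter for the constant \<open>B\<close>,
    and half remains. The summand 1 covers \<open>\<kappa> = 0\<close>.\<close>
  define \<delta> where "\<delta> = e / (4 * (\<kappa> + 1))"
  have \<delta>: "\<delta> > 0" "\<kappa> * \<delta> \<le> e / 4"
  proof -
    show "\<delta> > 0" using \<kappa> by (simp add: \<delta>_def)
    have "\<kappa> * e \<le> (\<kappa> + 1) * e" using \<kappa> by simp
    then show "\<kappa> * \<delta> \<le> e / 4" using \<kappa> by (simp add: \<delta>_def field_simps)
  qed
  have "\<forall>\<^sub>F n in sequentially. mp \<rho> r - \<delta> < 1 / real (n + 1) * (\<Sum>i\<le>n. real (\<rho> (r i)))"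
    by (rule mp_lower[OF fr]) (use \<delta> in simp)
  moreover have "\<forall>\<^sub>F n in sequentially. B / real (n + 1) < e / 4"
  proof -
    have "(\<lambda>n. B * inverse (real (Suc n))) \<longlonglongrightarrow> B * 0"
      by (intro tendsto_intros LIMSEQ_inverse_real_of_nat)
    then have "(\<lambda>n. B / real (n + 1)) \<longlonglongrightarrow> 0" by (simp add: divide_inverse)
    then show ?thesis by (rule order_tendstoD(2)) (use \<kappa> in simp)
  qed
  ultimately have "\<forall>\<^sub>F n in sequentially. c + e / 2 \<le> 1 / real (n + 1) * (\<Sum>i\<le>n. (real (\<rho> (r i)) - mp \<rho> r)\<^sup>2)"
  proof eventually_elim
    case (elim N)
    define x where "x = real (N + 1)"
    have x: "x > 0" by (simp add: x_def)
    define s1 where "s1 = (\<Sum>i\<le>N. real (\<rho> (r i)))"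
    define s2 where "s2 = (\<Sum>i\<le>N. (real (\<rho> (r i)) - mp \<rho> r)\<^sup>2)"
    have "(\<Sum>i\<le>K. w' (r i)) = (\<Sum>i\<le>K. (real (\<rho> (r i)) - mp \<rho> r)\<^sup>2) - c * real (K + 1)
        - \<kappa> * ((\<Sum>i\<le>K. real (\<rho> (r i))) - b * real (K + 1)) - e * real (K + 1)" for K
      by (induction K) (auto simp: w'_def algebra_simps)
    from this[of N] have "(\<Sum>i\<le>N. w' (r i)) = s2 - c * x - \<kappa> * (s1 - b * x) - e * x"
      by (simp only: s1_def s2_def x_def)
    then have "s2 - c * x - \<kappa> * (s1 - b * x) - e * x \<ge> - B" using low[of N] by simp
    then have "(s2 - c * x - \<kappa> * (s1 - b * x) - e * x) / x \<ge> - B / x"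
      using x by (intro divide_right_mono) auto
    moreover have "(s2 - c * x - \<kappa> * (s1 - b * x) - e * x) / x = s2 / x - c - \<kappa> * (s1 / x - b) - e"
      using x by (simp add: field_simps)
    ultimately have 1: "s2 / x \<ge> c + \<kappa> * (s1 / x - b) + e - B / x" by simp
    have "s1 / x \<ge> mp \<rho> r - \<delta>" using elim(1) by (simp add: s1_def x_def)
    \<comment> \<open>Rewards are controlled from below only; this is what the sign of
      \<open>\<kappa>\<close> is for.\<close>
    then have "\<kappa> * (s1 / x - b) \<ge> \<kappa> * (- \<delta>)" using mp \<kappa> by (intro mult_left_mono) auto
    then have "c + e / 2 \<le> s2 / x" using 1 \<delta>(2) elim(2) by (simp add: x_def)
    then show ?case by (simp add: s2_def x_def)
  qed
  then have "c + e / 2 \<le> va \<rho> r" by (rule va_ge[OF fr])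
  with va \<kappa>(2) show False by simp
qed

section \<open>Infinite memory\<close>

text \<open>Every window of length \<open>p\<close> from \<open>i\<close> on has total deviation 0
  from the period mean, so the partial sums of deviations are bounded.\<close>

lemma periodic_avg:
  fixes g :: "nat \<Rightarrow> real"
  assumes p: "p > 0" and per: "\<And>k. k \<ge> i \<Longrightarrow> g (k + p) = g k"
  shows "(\<lambda>n. 1 / real (n + 1) * (\<Sum>j\<le>n. g j)) \<longlonglongrightarrow> (\<Sum>k<p. g (i + k)) / real p"
proof -
  define \<mu> where "\<mu> = (\<Sum>k<p. g (i + k)) / real p"
  define h where "h = (\<lambda>k. g k - \<mu>)"
  have win: "(\<Sum>k<p. h (n + k)) = 0" if "n \<ge> i" for n
    using that
  proof (induction n rule: dec_induct)
    case base
    then show ?case using p by (simp add: h_def \<mu>_def sum_subtractf)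
  next
    case (step n)
    have "(\<Sum>k<Suc p. h (n + k)) = h n + (\<Sum>k<p. h (Suc n + k))"
      by (subst sum.lessThan_Suc_shift) simp
    moreover have "(\<Sum>k<Suc p. h (n + k)) = (\<Sum>k<p. h (n + k)) + h (n + p)" by simp
    moreover have "h (n + p) = h n" using per step by (simp add: h_def)
    ultimately show ?case using step by simp
  qed
  define A where "A = (\<Sum>k<i + p. \<bar>h k\<bar>)"
  have A0: "A \<ge> 0" unfolding A_def by (intro sum_nonneg) auto
  have bd: "\<bar>\<Sum>k<N. h k\<bar> \<le> A" for N
  proof (induction N rule: less_induct)
    case (less N)
    show ?case
    proof (cases "N \<le> i + p")
      case True
      have "\<bar>\<Sum>k<N. h k\<bar> \<le> (\<Sum>k<N. \<bar>h k\<bar>)" by (rule sum_abs)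
      also have "\<dots> \<le> A" unfolding A_def using True by (intro sum_mono2) auto
      finally show ?thesis .
    next
      case False
      then have "(\<Sum>k<N. h k) = (\<Sum>k<N - p. h k) + (\<Sum>k<p. h (N - p + k))"
        using sum_lessThan_add[of h "N - p" p] by simp
      also have "(\<Sum>k<p. h (N - p + k)) = 0" using False by (intro win) simp
      finally show ?thesis using less[of "N - p"] p False by simp
    qed
  qed
  have "\<bar>\<Sum>k<N. g k - \<mu>\<bar> \<le> A * (1 + sqrt (real N))" for N
  proof -
    have "A * 1 \<le> A * (1 + sqrt (real N))" using A0 by (intro mult_left_mono) auto
    then show ?thesis using bd[of N] by (simp add: h_def)
  qed
  then show ?thesis unfolding \<mu>_def by (rule avg_tendsto)
qed

text \<open>Memory and current state together determine the rest of the run, and there are only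
  finitely many such pairs.\<close>

lemma finite_memory_periodic:
  assumes G: "is_graph G" and \<sigma>: "strategy G \<sigma>" "finite_memory G \<sigma>" and s: "s \<in> states G"
  obtains i p where "p > 0" "\<And>k. k \<ge> i \<Longrightarrow> induced_run \<sigma> s (k + p) = induced_run \<sigma> s k"
proof -
  define r where "r = induced_run \<sigma> s"
  obtain M :: "nat set" and m0 upd nxt where fm: "finite M" "m0 \<in> M"
    "\<forall>m\<in>M. \<forall>s\<in>states G. upd m s \<in> M"
    "\<forall>h s. set h \<subseteq> states G \<longrightarrow> s \<in> states G \<longrightarrow> \<sigma> (h @ [s]) = nxt (foldl upd m0 h) s"
    using \<sigma>(2) unfolding finite_memory_def by blast
  have "r \<in> runs G" unfolding r_def by (rule induced_run_runs[OF G \<sigma>(1) s])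
  then have rS: "r i \<in> states G" for i
    using G by (cases i) (auto simp: runs_def is_graph_def)
  define mem where "mem = (\<lambda>n. foldl upd m0 (map r [0..<n]))"
  have mem_Suc: "mem (Suc n) = upd (mem n) (r n)" for n by (simp add: mem_def)
  have memM: "mem n \<in> M" for n
  proof (induction n)
    case 0
    show ?case using fm(2) by (simp add: mem_def)
  next
    case (Suc n)
    then show ?case using fm(3) rS by (simp add: mem_Suc)
  qed
  have r_Suc: "r (Suc n) = nxt (mem n) (r n)" for n
  proof -
    have "r (Suc n) = \<sigma> (map r [0..<n] @ [r n])"
      unfolding r_def by (rule induced_run_Suc)
    moreover have "set (map r [0..<n]) \<subseteq> states G" using rS by auto
    then have "\<sigma> (map r [0..<n] @ [r n]) = nxt (mem n) (r n)"
      unfolding mem_def using fm(4) rS[of n] by blast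
    ultimately show ?thesis by simp
  qed
  define conf where "conf = (\<lambda>n. (mem n, r n))"
  have "range conf \<subseteq> M \<times> states G" using memM rS by (auto simp: conf_def)
  then have "finite (range conf)"
    using fm(1) G by (meson finite_SigmaI finite_subset is_graph_def)
  then have "\<not> inj conf" using finite_imageD by blast
  then obtain i j where ij: "i < j" "conf i = conf j"
    unfolding inj_def by (metis linorder_neqE_nat)
  have "conf (i + k) = conf (j + k)" for k
    by (induction k) (use ij in \<open>auto simp: conf_def mem_Suc r_Suc\<close>)
  then have "r (k + (j - i)) = r k" if "k \<ge> i" for k
    using that ij(1) spec[of "\<lambda>k. conf (i + k) = conf (j + k)" "k - i"]
    by (simp add: conf_def add.commute)
  then show thesis using ij(1) unfolding r_def by (intro that[of "j - i" i]) auto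
qed

section \<open>An objective that requires infinite memory\<close>

definition mem_graph :: "nat graph" where
  "mem_graph = \<lparr>states = {0, 1, 2}, edges = {(0, 0), (0, 1), (1, 0), (1, 2), (2, 1)}\<rparr>"

text \<open>Mean and second moment are (0, 0) for the loop at 0, (8, 80) for the cycle through 1 and
  2, and (6, 72) for the cycle through 0 and 1, whose edges are used for switching. The first two
  lie on the line with second moment 10 times the mean, the third above it. On this line the
  variance is least among means from 1 to 8 at mean 1, where it is 9; so switching with positive
  frequency violates the bound.\<close>

definition mem_reward :: "nat \<Rightarrow> nat" where
  "mem_reward v = (if v = 1 then 12 else if v = 2 then 4 else 0)"

lemma mem_graph: "is_graph mem_graph"
  by (auto simp: is_graph_def mem_graph_def)

text \<open>The loop at \<open>0\<close> and the cycle through \<open>1\<close> and \<open>2\<close> have to be mixed with time fractions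
  \<open>7/8\<close> and \<open>1/8\<close>.\<close>

lemma mem_graph_achievable:
  "\<exists>\<sigma>. strategy mem_graph \<sigma> \<and> achieves \<sigma> (variance_stability mem_graph mem_reward 1 9) 0"
proof -
  let ?E = "edges mem_graph"
  \<comment> \<open>The cycles have lengths 1 and 2, so 14 rounds against 1 give time in proportion
    14 to 2.\<close>
  obtain r where r: "r 0 = 0" "\<And>i. (r i, r (Suc i)) \<in> ?E"
    and avg: "\<And>g :: nat \<Rightarrow> real. (\<lambda>n. 1 / real (n + 1) * (\<Sum>i\<le>n. g (r i))) \<longlonglongrightarrow>
      (real 14 * sum_list (map g [0]) + real 1 * sum_list (map g [1, 2])) /
      (real 14 * real (length [0 :: nat]) + real 1 * real (length [1 :: nat, 2]))"
    by (rule mixed_run[of ?E 0 "[]" 0 "[0]" "[0]" 1 "[1, 2]" "[1]" 14 1]) (auto simp: mem_graph_def)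
  have run: "r \<in> runs mem_graph" using r by (simp add: runs_def mem_graph_def)
  have mp: "mp mem_reward r = 1"
    by (rule mp_eqI) (use avg[of "\<lambda>v. real (mem_reward v)"] in \<open>simp add: mem_reward_def\<close>)
  have "va mem_reward r = 9"
    by (rule va_eqI) (use avg[of "\<lambda>v. (real (mem_reward v) - 1)\<^sup>2"] in \<open>simp add: mp mem_reward_def\<close>)
  then have "r \<in> variance_stability mem_graph mem_reward 1 9"
    using run mp by (simp add: variance_stability_def)
  then show ?thesis
    using run_strategy[OF mem_graph run] r(1) by (auto simp: achieves_def)
qed

text \<open>Over a period, squared rewards minus 10 times the rewards sum to 24 \<open>t\<close>,
  where \<open>t\<close> counts the moves from 1 to 0. The total squared deviation is then 24 t + 9
  P + (m - 1) (9 - m) P, and 1 \<le> m \<le> 8 leaves only \<open>t = 0\<close> and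
  \<open>m = 1\<close>. But a periodic part without a move from 1 to 0 either stays at 0, with mean
  0, or avoids 0, with mean at least 4.\<close>

lemma mem_graph_not_finite_memory:
  assumes "strategy mem_graph \<sigma>" "finite_memory mem_graph \<sigma>"
  shows "\<not> achieves \<sigma> (variance_stability mem_graph mem_reward 1 9) 0"
proof
  assume ach: "achieves \<sigma> (variance_stability mem_graph mem_reward 1 9) 0"
  define r where "r = induced_run \<sigma> 0"
  have r: "r \<in> runs mem_graph" "mp mem_reward r \<ge> 1" "va mem_reward r \<le> 9"
    using ach by (simp_all add: achieves_def variance_stability_def r_def)
  have E: "(r k, r (Suc k)) \<in> {(0, 0), (0, 1), (1, 0), (1, 2), (2, 1)}" for k
    using r(1) by (simp add: runs_def mem_graph_def)
  have "0 \<in> states mem_graph" by (simp add: mem_graph_def)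
  then obtain i p where p: "p > 0" and per: "\<And>k. k \<ge> i \<Longrightarrow> r (k + p) = r k"
    unfolding r_def using finite_memory_periodic[OF mem_graph assms] by metis
  define f where "f = (\<lambda>k. real (mem_reward (r k)))"
  define P where "P = real p"
  have P: "P > 0" using p by (simp add: P_def)
  define s1 where "s1 = (\<Sum>k<p. f (i + k))"
  define m where "m = s1 / P"
  have mp: "mp mem_reward r = m"
    unfolding m_def s1_def f_def P_def by (intro mp_eqI periodic_avg) (auto simp: p per)
  have va: "va mem_reward r = (\<Sum>k<p. (f (i + k) - m)\<^sup>2) / P"
    unfolding f_def P_def by (intro va_eqI, unfold mp, intro periodic_avg) (auto simp: p per)
  have tele: "(\<Sum>k<p. \<phi> (r (Suc (i + k))) - \<phi> (r (i + k))) = 0" for \<phi> :: "nat \<Rightarrow> real"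
    using sum_lessThan_telescope[of "\<lambda>k. \<phi> (r (i + k))" p] per[of i] by simp
  define t where "t = (\<Sum>k<p. if r (i + k) = 1 \<and> r (Suc (i + k)) = 0 then 1 else 0 :: real)"
  have t0: "t \<ge> 0" unfolding t_def by (intro sum_nonneg) auto
  \<comment> \<open>Potentials on states, whose differences cancel over a period: with
    \<open>\<phi>\<close> only the moves from 1 to 0 count, and \<open>\<psi>\<close> shows that no
    cycle has mean above 8.\<close>
  define \<phi> \<psi> :: "nat \<Rightarrow> real" where "\<phi> = (\<lambda>v. if v = 2 then 24 else 0)"
    and "\<psi> = (\<lambda>v. if v = 1 then 0 else 4)"
  have step: "(f k)\<^sup>2 - 10 * f k = 24 * (if r k = 1 \<and> r (Suc k) = 0 then 1 else 0) + (\<phi> (r (Suc k)) - \<phi> (r k))"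
    "f k \<le> 8 + (\<psi> (r (Suc k)) - \<psi> (r k))" for k
    using E[of k] by (auto simp: f_def mem_reward_def \<phi>_def \<psi>_def)
  have "(\<Sum>k<p. (f (i + k))\<^sup>2 - 10 * f (i + k)) = 24 * t"
    unfolding step(1) sum.distrib tele t_def sum_distrib_left by simp
  then have sq: "(\<Sum>k<p. (f (i + k))\<^sup>2) = 24 * t + 10 * s1"
    by (simp add: sum_subtractf s1_def sum_distrib_left)
  have "s1 \<le> (\<Sum>k<p. 8 + (\<psi> (r (Suc (i + k))) - \<psi> (r (i + k))))"
    unfolding s1_def by (intro sum_mono step(2))
  also have "\<dots> = 8 * P" unfolding sum.distrib tele by (simp add: P_def)
  finally have m8: "m \<le> 8" using P by (simp add: m_def field_simps)
  have m1: "m \<ge> 1" using r(2) mp by simp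
  have s1: "s1 = m * P" using P by (simp add: m_def)
  have "(\<Sum>k<p. (f (i + k) - m)\<^sup>2) = (\<Sum>k<p. (f (i + k))\<^sup>2) - 2 * m * s1 + m\<^sup>2 * P"
    by (simp add: power2_diff sum.distrib sum_subtractf sum_distrib_left s1_def P_def mult_ac)
  also have "\<dots> = 24 * t + 9 * P + (m - 1) * (9 - m) * P"
    unfolding sq s1 by (simp add: power2_eq_square algebra_simps)
  finally have "24 * t + 9 * P + (m - 1) * (9 - m) * P \<le> 9 * P"
    using r(3) va P by (simp add: field_simps)
  moreover have nn: "(m - 1) * (9 - m) * P \<ge> 0" using m1 m8 P by simp
  ultimately have t: "t = 0" and "(m - 1) * (9 - m) * P = 0" using t0 by linarith+
  then have m: "m = 1" using m8 P by auto
  have no: "\<not> (r k = 1 \<and> r (Suc k) = 0)" if "k \<ge> i" for k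
    using that
  proof (induction k rule: less_induct)
    case (less k)
    show ?case
    proof (cases "k < i + p")
      case True
      define j where "j = k - i"
      have j: "j < p" "k = i + j" using True less.prems by (auto simp: j_def)
      have "\<forall>j\<in>{..<p}. (if r (i + j) = 1 \<and> r (Suc (i + j)) = 0 then 1 else 0 :: real) = 0"
        using t unfolding t_def by (subst (asm) sum_nonneg_eq_0_iff) auto
      then show ?thesis using j by (auto split: if_splits)
    next
      case False
      have "r k = r (k - p)" "r (Suc k) = r (Suc (k - p))"
        using per[of "k - p"] per[of "Suc (k - p)"] False by simp_all
      then show ?thesis using less.IH[of "k - p"] p False by simp
    qed
  qed
  show False
  proof (cases "\<exists>k\<ge>i. r k \<noteq> 0")
    case True
    then obtain k where k: "k \<ge> i" "r k \<noteq> 0" by blast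
    have up: "r l \<noteq> 0" if "l \<ge> k" for l
      using that
    proof (induction l rule: dec_induct)
      case (step l)
      then show ?case using no[of l] E[of l] k(1) by auto
    qed (use k in simp)
    \<comment> \<open>Adding \<open>k\<close> periods carries any \<open>l\<close> beyond
      \<open>k\<close>, where \<open>up\<close> applies.\<close>
    have nz: "r l \<noteq> 0" if "l \<ge> i" for l
    proof -
      have "r (l + n * p) = r l" for n
        by (induction n) (use that per[of "l + _ * p"] in \<open>auto simp: algebra_simps\<close>)
      from this[of k] show ?thesis using up[of "l + k * p"] p by (cases p) auto
    qed
    have "f l \<ge> 4" if "l \<ge> i" for l
      using nz[OF that] E[of l] by (auto simp: f_def mem_reward_def)
    then have "(\<Sum>k<p. 4) \<le> s1" unfolding s1_def by (intro sum_mono) simp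
    then show False using s1 m P by (simp add: P_def)
  next
    case False
    then have "s1 = 0" by (simp add: s1_def f_def mem_reward_def)
    then show False using s1 m P by simp
  qed
qed

section \<open>Decoding fields\<close>

text \<open>The number of leading pairs whose continuation bit is set, that is, the length of the
  first field. Doubling as \<open>j + j\<close> and the bound \<open>Suc i\<close> match the rules
  \<open>ptn_add\<close> and \<open>ptb_ball\<close>.\<close>

definition flen :: "bool list \<Rightarrow> nat" where
  "flen w = (\<Sum>i<length w. if \<forall>j<Suc i. nthd w (j + j) then 1 else 0)"

definition takef :: "bool list \<Rightarrow> bool list" where
  "takef w = map (\<lambda>j. nthd w (Suc (j + j))) [0..<flen w]"

definition skipf :: "bool list \<Rightarrow> bool list" where
  "skipf w = drop (Suc (Suc (flen w + flen w))) w"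

definition restf :: "bool list \<Rightarrow> nat \<Rightarrow> bool list" where
  "restf w k = rec_nat w (\<lambda>i r. skipf r) k"

definition fld :: "bool list \<Rightarrow> nat \<Rightarrow> bool list" where
  "fld w k = takef (restf w k)"

text \<open>By definition of \<open>flen\<close> the next continuation bit reads as
  \<open>False\<close>, but this may be the default value beyond the end; length and second bit are
  tested to ensure a genuine terminator.\<close>

definition okf :: "bool list \<Rightarrow> bool" where
  "okf w \<longleftrightarrow> Suc (flen w + flen w) < length w \<and> \<not> nthd w (Suc (flen w + flen w))"

lemma flen_eq:
  assumes "\<And>j. j < n \<Longrightarrow> nthd w (j + j)" "\<not> nthd w (n + n)"
  shows "flen w = n"
proof -
  have n: "n \<le> length w"
    using assms(1)[of "n - 1"] by (cases n) (auto simp: nthd_def)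
  have "(\<forall>j<Suc i. nthd w (j + j)) \<longleftrightarrow> i < n" for i
  proof
    assume a: "\<forall>j<Suc i. nthd w (j + j)"
    show "i < n"
    proof (rule ccontr)
      assume "\<not> i < n"
      then have "n < Suc i" by simp
      with a assms(2) show False by blast
    qed
  qed (use assms(1) in simp)
  then have "flen w = (\<Sum>i<length w. if i < n then 1 else 0)" by (simp add: flen_def)
  also have "\<dots> = (\<Sum>i\<in>{..<n}. 1)"
    using n by (intro sum.mono_neutral_cong_right) auto
  finally show ?thesis by simp
qed

lemma flen_spec: "j < flen w \<Longrightarrow> nthd w (j + j)" "\<not> nthd w (flen w + flen w)"
proof -
  have ex: "\<exists>n. \<not> nthd w (n + n)" by (rule exI[of _ "length w"]) (simp add: nthd_def)
  define n where "n = (LEAST n. \<not> nthd w (n + n))"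
  have n: "\<not> nthd w (n + n)" unfolding n_def by (rule LeastI_ex[OF ex])
  have n': "nthd w (j + j)" if "j < n" for j
    using not_less_Least[OF that[unfolded n_def]] by simp
  have "flen w = n" by (rule flen_eq[OF n' n])
  then show "j < flen w \<Longrightarrow> nthd w (j + j)" "\<not> nthd w (flen w + flen w)" using n n' by simp_all
qed

lemma nthd_Cons [simp]: "nthd (b # w) 0 = b" "nthd (b # w) (Suc i) = nthd w i"
  by (simp_all add: nthd_def)

lemma nthd_encode_field:
  "j < length f \<Longrightarrow> nthd (encode_field f @ r) (j + j)"
  "j < length f \<Longrightarrow> nthd (encode_field f @ r) (Suc (j + j)) = f ! j"
  "\<not> nthd (encode_field f @ r) (length f + length f)"
proof (induction f arbitrary: j)
  case (Cons b f)
  have enc: "encode_field (b # f) @ r = True # b # (encode_field f @ r)"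
    by (simp add: encode_field_def)
  {
    case 1
    then show ?case using Cons(1)[of "j - 1"] unfolding enc by (cases j) auto
  next
    case 2
    then show ?case using Cons(2)[of "j - 1"] unfolding enc by (cases j) auto
  next
    case 3
    then show ?case using Cons(3) unfolding enc by auto
  }
qed (simp_all add: encode_field_def)

lemma flen_encode_field: "flen (encode_field f @ r) = length f"
  by (rule flen_eq) (rule nthd_encode_field, assumption, rule nthd_encode_field)

lemma takef_encode_field: "takef (encode_field f @ r) = f"
  by (rule nth_equalityI) (auto simp: takef_def flen_encode_field nthd_encode_field)

lemma length_encode_field: "length (encode_field f) = Suc (Suc (length f + length f))"
  by (induction f) (auto simp: encode_field_def)

lemma skipf_encode_field: "skipf (encode_field f @ r) = r"
  by (simp add: skipf_def flen_encode_field length_encode_field flip: length_encode_field)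

lemma okf_encode_field: "okf (encode_field f @ r)"
proof -
  have "nthd (encode_field f @ r) (Suc (length f + length f)) = False"
    by (induction f) (auto simp: encode_field_def)
  then show ?thesis by (simp add: okf_def flen_encode_field length_encode_field)
qed

lemma okf_split: "okf w \<Longrightarrow> w = encode_field (takef w) @ skipf w"
proof -
  have gen: "w = encode_field (map (\<lambda>j. nthd w (Suc (j + j))) [0..<n]) @ drop (Suc (Suc (n + n))) w"
    if "\<And>j. j < n \<Longrightarrow> nthd w (j + j)" "\<not> nthd w (n + n)" "Suc (n + n) < length w" "\<not> nthd w (Suc (n + n))"
    for n and w :: "bool list"
    using that
  proof (induction n arbitrary: w)
    case 0
    then obtain a b v where w: "w = a # b # v"
      by (cases w; cases "tl w") auto
    with 0 show ?case by (simp add: encode_field_def)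
  next
    case (Suc n)
    then obtain a b v where w: "w = a # b # v"
      by (cases w; cases "tl w") auto
    have a using Suc.prems(1)[of 0] w by simp
    have "v = encode_field (map (\<lambda>j. nthd v (Suc (j + j))) [0..<n]) @ drop (Suc (Suc (n + n))) v"
    proof (rule Suc.IH)
      show "nthd v (j + j)" if "j < n" for j using Suc.prems(1)[of "Suc j"] that w by simp
    qed (use Suc.prems w in simp_all)
    moreover have "map (\<lambda>j. nthd w (Suc (j + j))) [0..<Suc n] = b # map (\<lambda>j. nthd v (Suc (j + j))) [0..<n]"
      by (simp add: w upt_conv_Cons map_Suc_upt[symmetric] comp_def del: upt_Suc)
    ultimately show ?case using w \<open>a\<close> by (simp add: encode_field_def)
  qed
  assume "okf w"
  then show ?thesis
    unfolding takef_def skipf_def okf_def using gen[of "flen w" w] flen_spec by blast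
qed

lemma restf_simps: "restf w 0 = w" "restf w (Suc k) = skipf (restf w k)"
  by (simp_all add: restf_def)

lemma length_restf: "length (restf w k) \<le> length w"
  by (induction k) (auto simp: restf_simps skipf_def)

lemma restf_concat:
  "k \<le> length fs \<Longrightarrow> restf (concat (map encode_field fs)) k = concat (map encode_field (drop k fs))"
proof (induction k)
  case (Suc k)
  then have "drop k fs = fs ! k # drop (Suc k) fs" by (simp add: Cons_nth_drop_Suc)
  then show ?case using Suc by (simp add: restf_simps skipf_encode_field)
qed (simp add: restf_simps)

lemma fld_concat: "k < length fs \<Longrightarrow> fld (concat (map encode_field fs)) k = fs ! k"
  using Cons_nth_drop_Suc[of k fs] by (simp add: fld_def restf_concat takef_encode_field flip: Cons_nth_drop_Suc)

text \<open>Membership concerns the exact word. For soundness, a word that passes the syntactic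
  tests must be the encoding of the fields read from it; that encodings decode correctly is not
  enough.\<close>

lemma concat_fld:
  assumes "\<And>k. k < n \<Longrightarrow> okf (restf w k)" "restf w n = []"
  shows "w = concat (map encode_field (map (fld w) [0..<n]))"
proof -
  have "w = concat (map encode_field (map (fld w) [0..<k])) @ restf w k" if "k \<le> n" for k
    using that
  proof (induction k)
    case (Suc k)
    then have "restf w k = encode_field (fld w k) @ restf w (Suc k)"
      using okf_split[OF assms(1)[of k]] by (simp add: fld_def restf_simps)
    then show ?case using Suc by simp
  qed (simp add: restf_simps)
  from this[of n] show ?thesis using assms(2) by simp
qed

section \<open>Decoding in polynomial time\<close>

lemma ptn_flen: "ptime f \<Longrightarrow> ptn (\<lambda>e. flen (f e))"
  unfolding ptn_def
proof (rule ptime_comp1[where F = "\<lambda>w. replicate (flen w) True"])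
  have "ptn (\<lambda>e. flen (e 0))"
    unfolding flen_def
    by (intro ptn_count ptb_ball ptn_length ptn_Suc ptb_nthd ptn_add ptime_var)
  then show "ptime (\<lambda>e. replicate (flen (e 0)) True)" by (simp add: ptn_def)
qed

lemma ptime_takef: "ptime f \<Longrightarrow> ptime (\<lambda>e. takef (f e))"
proof (rule ptime_comp1[where F = takef])
  show "ptime (\<lambda>e. takef (e 0))"
    unfolding takef_def
    by (intro ptime_tab ptn_flen ptn_length ptn_Suc ptb_nthd ptn_add ptime_var)
qed

lemma ptime_skipf: "ptime f \<Longrightarrow> ptime (\<lambda>e. skipf (f e))"
  unfolding skipf_def by (intro ptime_drop ptn_Suc ptn_add ptn_flen)

lemma ptime_restf: "ptime f \<Longrightarrow> ptn N \<Longrightarrow> ptime (\<lambda>e. restf (f e) (N e))"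
proof -
  assume f: "ptime f" and N: "ptn N"
  have "ptime (\<lambda>e. restf (e 0) (length (e (Suc 0))))"
    unfolding restf_def
    by (rule ptime_rec[where h = "\<lambda>i r e. skipf r" and B = "\<lambda>e. length (e 0)"])
      (intro ptime_var ptime_skipf pbound_var length_restf[unfolded restf_def])+
  from ptime_comp2[where F = "\<lambda>w n. restf w (length n)", OF this f N[unfolded ptn_def]]
  show ?thesis by simp
qed

lemma ptime_fld: "ptime f \<Longrightarrow> ptn N \<Longrightarrow> ptime (\<lambda>e. fld (f e) (N e))"
  unfolding fld_def by (intro ptime_takef ptime_restf)

lemma ptb_okf: "ptime f \<Longrightarrow> ptb (\<lambda>e. okf (f e))"
  unfolding okf_def by (intro ptb_conj ptb_not ptb_less ptb_nthd ptn_Suc ptn_add ptn_flen ptn_length)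

section \<open>The verifier\<close>

text \<open>No leading zeros, the top bit being last: these are exactly the lists produced by
  \<open>nat_bits\<close>.\<close>

definition canon :: "bool list \<Rightarrow> bool" where
  "canon f \<longleftrightarrow> f = [] \<or> nthd f (length f - 1)"

lemma canon_Cons: "canon (b # f) \<longleftrightarrow> (if f = [] then b else canon f)"
  by (cases f) (auto simp: canon_def nthd_def)

lemma val_pos: "canon f \<Longrightarrow> f \<noteq> [] \<Longrightarrow> val f > 0"
proof (induction f)
  case (Cons b f)
  then show ?case by (cases "f = []") (auto simp: canon_Cons)
qed simp

lemma nat_bits_val: "canon f \<Longrightarrow> nat_bits (val f) = f"
proof (induction f)
  case (Cons b f)
  have "val (b # f) > 0" by (rule val_pos) (use Cons in auto)
  moreover have "odd (val (b # f)) = b" "val (b # f) div 2 = val f" by simp_all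
  moreover have "nat_bits (val f) = f"
    using Cons by (cases "f = []") (auto simp: canon_Cons nat_bits_0)
  ultimately show ?case by (simp only: nat_bits_pos)
qed (simp add: nat_bits_0)

lemma canon_nat_bits: "canon (nat_bits n)"
proof (induction n rule: less_induct)
  case (less n)
  show ?case
  proof (cases "n = 0")
    case False
    then have IH: "canon (nat_bits (n div 2))" using less by simp
    have "nat_bits (n div 2) = [] \<Longrightarrow> n = 1"
      using val_nat_bits[of "n div 2"] False by simp
    then show ?thesis using False IH nat_bits_pos[of n] by (auto simp: canon_Cons)
  qed (simp add: nat_bits_0 canon_def)
qed

lemma nat_bits_eq_Nil: "nat_bits n = [] \<longleftrightarrow> n = 0"
  using val_nat_bits[of n] by (auto simp: nat_bits_0)

lemma length_nat_bits: "n < 2 ^ k \<Longrightarrow> length (nat_bits n) \<le> k"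
proof (induction k arbitrary: n)
  case (Suc k)
  then show ?case using Suc.IH[of "n div 2"] nat_bits_pos[of n] by (cases "n = 0") (auto simp: nat_bits_0)
qed (simp add: nat_bits_0)

text \<open>Lowest terms are certified by Bezout coefficients \<open>\<alpha>\<close>, \<open>\<beta>\<close>, so that no gcd is computed.\<close>

definition rat_ok :: "bool list \<Rightarrow> bool list \<Rightarrow> nat \<Rightarrow> nat \<Rightarrow> bool" where
  "rat_ok f g \<alpha> \<beta> \<longleftrightarrow> f \<noteq> [] \<and> canon (tl f) \<and> (tl f = [] \<longrightarrow> \<not> nthd f 0) \<and> g \<noteq> [] \<and> canon g \<and>
     val g * \<alpha> = val (tl f) * \<beta> + 1"

definition rat_of :: "bool list \<Rightarrow> bool list \<Rightarrow> rat" where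
  "rat_of f g = Fract ((if nthd f 0 then -1 else 1) * int (val (tl f))) (int (val g))"

text \<open>The Bezout identity makes numerator and denominator coprime, so
  \<open>quotient_of\<close> returns them as they are written.\<close>

lemma rat_ok_fields:
  assumes "rat_ok f g \<alpha> \<beta>"
  shows "rat_fields (rat_of f g) = [f, g]"
proof -
  define k where "k = (if nthd f 0 then -1 else 1) * int (val (tl f))"
  define d where "d = int (val g)"
  have d: "d > 0" using assms val_pos[of g] by (simp add: d_def rat_ok_def)
  have "coprime (val (tl f)) (val g)"
  proof (rule coprimeI)
    fix x assume x: "x dvd val (tl f)" "x dvd val g"
    have "x dvd val (tl f) * \<beta> + 1" using assms x(2) by (metis dvd_mult2 rat_ok_def)
    then show "is_unit x" using x(1) by (metis dvd_add_right_iff dvd_mult2)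
  qed
  then have "coprime k d" by (simp add: k_def d_def coprime_int_iff)
  then have q: "quotient_of (rat_of f g) = (k, d)"
    using d by (simp add: rat_of_def quotient_of_Fract normalize_stable k_def[symmetric] d_def[symmetric])
  obtain b f' where f: "f = b # f'" using assms by (cases f) (auto simp: rat_ok_def)
  have "canon f'" "f' = [] \<Longrightarrow> \<not> b" using assms by (auto simp: rat_ok_def f)
  then have "(k < 0) = b" "nat_bits (nat \<bar>k\<bar>) = f'"
    using val_pos[of f'] nat_bits_val[of f'] by (auto simp: k_def f abs_mult)
  then show ?thesis
    using assms q by (simp add: rat_fields_def int_bits_def f d_def rat_ok_def nat_bits_val)
qed

lemma rat_fields_ok:
  assumes "rat_fields q = [f, g]"
  obtains \<alpha> \<beta> where "rat_ok f g \<alpha> \<beta>" "\<beta> < val g"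
    "quotient_of q = ((if nthd f 0 then -1 else 1) * int (val (tl f)), int (val g))"
proof -
  obtain k d where q: "quotient_of q = (k, d)" by force
  have d: "d > 0" "coprime k d"
    using q quotient_of_denom_pos quotient_of_coprime by blast+
  have f: "f = (k < 0) # nat_bits (nat \<bar>k\<bar>)" and g: "g = nat_bits (nat d)"
    using assms by (simp_all add: rat_fields_def q int_bits_def)
  define k' d' where "k' = nat \<bar>k\<bar>" and "d' = nat d"
  have d': "d' > 0" using d by (simp add: d'_def)
  have "coprime k' d'"
    using d by (simp add: k'_def d'_def coprime_nat_abs_left_iff)
  then have "gcd d' k' = 1" by (simp add: coprime_commute)
  then obtain x y where xy: "d' * x = k' * y + 1"
    using bezout_nat[of d' k'] d' by auto
  \<comment> \<open>Reduction modulo the denominator keeps the coefficient small; the difference is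
    absorbed by the other coefficient.\<close>
  define \<beta> where "\<beta> = y mod d'"
  have "y = \<beta> + d' * (y div d')" by (simp add: \<beta>_def)
  then have e: "d' * x = k' * \<beta> + 1 + d' * (k' * (y div d'))" using xy by (metis add.commute add.left_commute distrib_left mult.left_commute)
  then have "d' dvd k' * \<beta> + 1" by (metis dvd_add_left_iff dvd_triv_left)
  then obtain \<alpha> where \<alpha>: "d' * \<alpha> = k' * \<beta> + 1" by (metis dvdE)
  have "rat_ok f g \<alpha> \<beta>"
    using \<alpha> d by (auto simp: rat_ok_def f g canon_nat_bits nat_bits_eq_Nil val_nat_bits k'_def d'_def)
  moreover have "\<beta> < val g" using d' by (simp add: \<beta>_def g val_nat_bits d'_def)
  moreover have "quotient_of q = ((if nthd f 0 then -1 else 1) * int (val (tl f)), int (val g))"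
    using d by (simp add: q f g val_nat_bits)
  ultimately show thesis by (rule that)
qed

text \<open>The rows are fields 0 to n - 1, so the first field has length n. Field n is the initial
  state, n + 1 to 2 n are the rewards, and 2 n + 1 to 2 n + 4 the two bounds.\<close>

abbreviation dim :: "bool list \<Rightarrow> nat" where
  "dim x \<equiv> length (fld x 0)"

abbreviation reward :: "bool list \<Rightarrow> nat \<Rightarrow> nat" where
  "reward x i \<equiv> val (fld x (Suc (dim x + i)))"

text \<open>Canonical numerals are demanded because the word itself, not only its meaning, must come
  from an instance. The strict bound on the initial state is written with \<open>1 +\<close> to
  match \<open>ptb_ptv_le\<close>.\<close>

definition instance_ok :: "bool list \<Rightarrow> bool" where
  "instance_ok x \<longleftrightarrow> 1 \<le> dim x \<and> (\<forall>k<dim x + dim x + 5. okf (restf x k)) \<and> restf x (dim x + dim x + 5) = [] \<and>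
     (\<forall>i<dim x. length (fld x i) = dim x \<and> (\<exists>j<dim x. nthd (fld x i) j)) \<and>
     canon (fld x (dim x)) \<and> 1 + val (fld x (dim x)) \<le> dim x \<and>
     (\<forall>i<dim x. canon (fld x (Suc (dim x + i))))"

text \<open>The certificate contains the weights of the two cycles, five walks (to the first cycle, the
  first cycle, to the second cycle, the second cycle, back), their lengths, and the Bezout
  coefficients.\<close>

abbreviation wst :: "bool list \<Rightarrow> nat \<Rightarrow> nat \<Rightarrow> nat" where
  "wst u k j \<equiv> length (fld (fld u (k + 2)) j)"

abbreviation wlen :: "bool list \<Rightarrow> nat \<Rightarrow> nat" where
  "wlen u k \<equiv> length (fld u (k + 7))"

text \<open>The initial state is given in binary and the states of walks in unary, so their equality
  is expressed by two comparisons of values.\<close>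

definition walks_ok :: "bool list \<Rightarrow> bool list \<Rightarrow> bool" where
  "walks_ok x u \<longleftrightarrow>
     (\<forall>k<5. \<forall>j<wlen u k. wst u k j < dim x \<and> wst u k (Suc j) < dim x \<and> nthd (fld x (wst u k j)) (wst u k (Suc j))) \<and>
     wst u 0 0 \<le> val (fld x (dim x)) \<and> val (fld x (dim x)) \<le> wst u 0 0 \<and>
     wst u 0 (wlen u 0) = wst u 1 0 \<and> wst u 1 (wlen u 1) = wst u 1 0 \<and>
     wst u 2 0 = wst u 1 0 \<and> wst u 2 (wlen u 2) = wst u 3 0 \<and> wst u 3 (wlen u 3) = wst u 3 0 \<and>
     wst u 4 0 = wst u 3 0 \<and> wst u 4 (wlen u 4) = wst u 1 0 \<and> 1 \<le> wlen u 1 \<and> 1 \<le> wlen u 3"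

definition mix :: "bool list \<Rightarrow> (nat \<Rightarrow> nat) \<Rightarrow> nat" where
  "mix u g = val (fld u 0) * (\<Sum>j<wlen u 1. g (wst u 1 j)) + val (fld u 1) * (\<Sum>j<wlen u 3. g (wst u 3 j))"

text \<open>The bounds on mean and variance of the mixture, multiplied by the denominators and by
  \<open>L\<close> or its square. A negative numerator changes sides, so all terms are natural
  numbers.\<close>

definition num_ok :: "bool list \<Rightarrow> bool list \<Rightarrow> bool" where
  "num_ok x u \<longleftrightarrow> 1 \<le> val (fld u 0) + val (fld u 1) \<and>
    (let n = dim x; f = fld x (n + n + 1); d = val (fld x (n + n + 2)); k = val (tl f);
         f' = fld x (n + n + 3); d' = val (fld x (n + n + 4)); k' = val (tl f');
         L = mix u (\<lambda>_. 1); S = mix u (reward x); T = mix u (\<lambda>v. reward x v * reward x v) in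
     (if nthd f 0 then 0 else k) * L \<le> d * S + (if nthd f 0 then k else 0) * L \<and>
     d' * (T * L) + (if nthd f' 0 then k' else 0) * (L * L) \<le> d' * (S * S) + (if nthd f' 0 then 0 else k') * (L * L))"

definition verify :: "bool list \<Rightarrow> bool list \<Rightarrow> bool" where
  "verify x u \<longleftrightarrow> instance_ok x \<and>
     rat_ok (fld x (dim x + dim x + 1)) (fld x (dim x + dim x + 2)) (val (fld u 12)) (val (fld u 13)) \<and>
     rat_ok (fld x (dim x + dim x + 3)) (fld x (dim x + dim x + 4)) (val (fld u 14)) (val (fld u 15)) \<and>
     walks_ok x u \<and> num_ok x u"

section \<open>The verifier runs in polynomial time\<close>

lemma ptb_canon: "ptime f \<Longrightarrow> ptb (\<lambda>e. canon (f e))"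
  unfolding canon_def by (intro ptb_disj ptb_null ptb_nthd ptn_diff ptn_length ptn_const)

lemma ptv_length: "ptime f \<Longrightarrow> ptv (\<lambda>e. length (f e))"
  by (intro ptv_ptn ptn_length)

lemma ptb_eqv: "ptv v \<Longrightarrow> ptv w \<Longrightarrow> ptb (\<lambda>e. v e = w e)"
  using ptb_conj[OF ptb_ptv_le[of v w] ptb_ptv_le[of w v]] by (simp add: eq_iff)

lemma ptb_rat_ok:
  "ptime f \<Longrightarrow> ptime g \<Longrightarrow> ptv a \<Longrightarrow> ptv b \<Longrightarrow> ptb (\<lambda>e. rat_ok (f e) (g e) (a e) (b e))"
  unfolding rat_ok_def
  by (intro ptb_conj ptb_imp ptb_not ptb_ne ptb_null ptb_canon ptb_nthd ptb_eqv ptv_mult ptv_add ptv_val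
      ptv_const ptn_const ptime_tl)

lemma ptb_instance_ok: "ptb (\<lambda>e. instance_ok (e 0))"
  unfolding instance_ok_def
  by (intro ptb_conj ptb_ball ptb_bex ptb_okf ptb_null ptb_canon ptb_nthd ptb_le ptb_eq ptb_ptv_le
      ptime_restf ptime_fld ptv_add ptv_val ptv_length ptv_const ptn_length ptn_const ptn_add ptn_Suc ptime_var)

lemma ptb_walks_ok: "ptb (\<lambda>e. walks_ok (e 0) (e (Suc 0)))"
  unfolding walks_ok_def
  by (intro ptb_conj ptb_ball ptb_nthd ptb_le ptb_less ptb_eq ptb_ptv_le
      ptime_fld ptv_val ptv_length ptn_length ptn_const ptn_add ptn_Suc ptime_var)

lemma ptb_num_ok: "ptb (\<lambda>e. num_ok (e 0) (e (Suc 0)))"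
  unfolding num_ok_def mix_def Let_def
  by (intro ptb_conj ptb_nthd ptb_ptv_le ptv_if ptv_sum ptv_mult ptv_add ptv_val ptv_const
      ptime_fld ptime_tl ptn_length ptn_const ptn_add ptn_Suc ptime_var)

lemma ptb_verify: "ptb (\<lambda>e. verify (e 0) (e (Suc 0)))"
  unfolding verify_def
  by (intro ptb_conj ptb_instance_ok ptb_walks_ok ptb_num_ok ptb_rat_ok
      ptime_fld ptv_val ptn_length ptn_const ptn_add ptime_var)

section \<open>Soundness of the verifier\<close>

lemma run_of_certificate:
  fixes b c :: real
  assumes E: "edges G = E" and s: "s \<in> states G"
    and w: "walk E s P0 p" "walk E p C1 p" "walk E p P1 q" "walk E q C2 q" "walk E q P2 p"
    and ne: "C1 \<noteq> []" "C2 \<noteq> []" and x: "x1 + x2 > (0::nat)"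
    and L: "L = real x1 * real (length C1) + real x2 * real (length C2)"
    and S: "S = real x1 * tot \<rho> C1 + real x2 * tot \<rho> C2"
    and T: "T = real x1 * tot2 \<rho> C1 + real x2 * tot2 \<rho> C2"
    and b: "b * L \<le> S" and c: "T * L - S\<^sup>2 \<le> c * L\<^sup>2"
  shows "\<exists>r\<in>runs G. r 0 = s \<and> b \<le> mp \<rho> r \<and> va \<rho> r \<le> c"
proof -
  \<comment> \<open>One run provides the limits for all functions on states, here the reward and the
    squared deviation. A weight may be 0, which covers a single cycle.\<close>
  obtain r where r: "r 0 = s" "\<And>i. (r i, r (Suc i)) \<in> E"
    and avg: "\<And>g :: _ \<Rightarrow> real. (\<lambda>n. 1 / real (n + 1) * (\<Sum>i\<le>n. g (r i))) \<longlonglongrightarrow>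
      (real x1 * sum_list (map g C1) + real x2 * sum_list (map g C2)) /
      (real x1 * real (length C1) + real x2 * real (length C2))"
    by (rule mixed_run[OF w ne x]) (rule that)
  have L0: "L > 0"
  proof -
    have "length C1 > 0" "length C2 > 0" using ne by simp_all
    then have "x1 * length C1 + x2 * length C2 > 0" using x by (cases x1) auto
    then have "real (x1 * length C1 + x2 * length C2) > 0" by (rule of_nat_0_less_iff[THEN iffD2])
    then show ?thesis by (simp add: L)
  qed
  define m where "m = S / L"
  have mp: "mp \<rho> r = m"
    unfolding m_def S L tot_def by (rule mp_eqI) (rule avg)
  have dev: "(\<Sum>v\<leftarrow>C. (real (\<rho> v) - m)\<^sup>2) = tot2 \<rho> C - 2 * m * tot \<rho> C + m\<^sup>2 * real (length C)" for C
    using sum_list_quadratic[of \<rho> m 0 0 0 0 C] by simp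
  have "va \<rho> r = (real x1 * (\<Sum>v\<leftarrow>C1. (real (\<rho> v) - m)\<^sup>2) + real x2 * (\<Sum>v\<leftarrow>C2. (real (\<rho> v) - m)\<^sup>2)) / L"
    unfolding L by (rule va_eqI) (unfold mp, rule avg)
  also have "\<dots> = (T - 2 * m * S + m\<^sup>2 * L) / L"
    unfolding dev S T L by (simp add: algebra_simps)
  also have "\<dots> = (T * L - S\<^sup>2) / L\<^sup>2"
    using L0 by (simp add: m_def power2_eq_square field_simps)
  also have "\<dots> \<le> c"
    using c L0 by (simp add: pos_divide_le_eq)
  finally have "va \<rho> r \<le> c" .
  moreover have "b \<le> m" using b L0 by (simp add: m_def pos_le_divide_eq)
  ultimately show ?thesis
    using r s mp by (intro bexI[of _ r]) (auto simp: runs_def E)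
qed

lemma mean_bound_iff:
  fixes k d L S :: nat
  assumes "d > 0"
  shows "(if neg then 0 else k) * L \<le> d * S + (if neg then k else 0) * L \<longleftrightarrow>
    of_rat (Fract ((if neg then -1 else 1) * int k) (int d)) * real L \<le> real S"
proof -
  have "(if neg then 0 else k) * L \<le> d * S + (if neg then k else 0) * L \<longleftrightarrow>
      real (if neg then 0 else k) * real L \<le> real d * real S + real (if neg then k else 0) * real L"
    by (simp flip: of_nat_mult of_nat_add)
  moreover have "- (real L * real k) \<le> real S * real d"
    by (rule order_trans[of _ 0]) simp_all
  ultimately show ?thesis
    using assms by (cases neg) (auto simp: of_rat_rat field_simps)
qed

lemma variance_bound_iff:
  fixes k d L S T :: nat
  assumes "d > 0"
  shows "d * (T * L) + (if neg then k else 0) * (L * L) \<le> d * (S * S) + (if neg then 0 else k) * (L * L) \<longleftrightarrow>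
    real T * real L - (real S)\<^sup>2 \<le> of_rat (Fract ((if neg then -1 else 1) * int k) (int d)) * (real L)\<^sup>2"
proof -
  have "d * (T * L) + (if neg then k else 0) * (L * L) \<le> d * (S * S) + (if neg then 0 else k) * (L * L) \<longleftrightarrow>
      real d * (real T * real L) + real (if neg then k else 0) * (real L * real L) \<le>
      real d * (real S * real S) + real (if neg then 0 else k) * (real L * real L)"
    by (simp flip: of_nat_mult of_nat_add)
  then show ?thesis
    using assms by (cases neg) (auto simp: of_rat_rat power2_eq_square field_simps)
qed

lemma sum_list_map_upt: "(\<Sum>v\<leftarrow>map f [0..<m]. g v) = (\<Sum>j<m. g (f j))" for g :: "'a \<Rightarrow> real"
  by (simp add: interv_sum_list_conv_sum_set_nat atLeast0LessThan comp_def)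

lemma upt_instance:
  "[0..<n + n + 5] = [0..<n] @ [n] @ map (\<lambda>i. Suc (n + i)) [0..<n] @ [n + n + 1, n + n + 2, n + n + 3, n + n + 4]"
proof -
  have "[0..<n + n + 5] = [0..<n] @ [n..<n + n + 5]"
    using upt_add_eq_append[of 0 n "n + 5"] by (simp add: add.assoc)
  also have "[n..<n + n + 5] = n # [Suc n..<n + n + 5]" by (simp add: upt_conv_Cons)
  also have "[Suc n..<n + n + 5] = [Suc n..<Suc n + n] @ [Suc n + n..<n + n + 5]"
    using upt_add_eq_append[of "Suc n" "Suc n + n" 4] by (simp add: add_ac)
  also have "[Suc n..<Suc n + n] = map (\<lambda>i. Suc (n + i)) [0..<n]"
    using map_add_upt[of "Suc n" n] by (simp add: add_ac)
  also have "[Suc n + n..<n + n + 5] = [n + n + 1, n + n + 2, n + n + 3, n + n + 4]"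
    by (simp add: upt_rec)
  finally show ?thesis by simp
qed

text \<open>Any closed walks and weights that pass the numerical test yield a run; neither
  simplicity of the cycles nor the origin of the weights has to be verified.\<close>

lemma verify_sound:
  assumes v: "verify x u"
  shows "x \<in> variance_stability_problem"
proof -
  define n where "n = dim x"
  define E where "E = {(i, j). i < n \<and> j < n \<and> nthd (fld x i) j}"
  define s where "s = val (fld x n)"
  define \<rho> where "\<rho> = (\<lambda>i. val (fld x (Suc (n + i))))"
  define b where "b = rat_of (fld x (n + n + 1)) (fld x (n + n + 2))"
  define c where "c = rat_of (fld x (n + n + 3)) (fld x (n + n + 4))"
  define G where "G = \<lparr>states = {..<n}, edges = E\<rparr>"
  have I: "instance_ok x" and W: "walks_ok x u" and N: "num_ok x u"
    and rb: "rat_ok (fld x (n + n + 1)) (fld x (n + n + 2)) (val (fld u 12)) (val (fld u 13))"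
    and rc: "rat_ok (fld x (n + n + 3)) (fld x (n + n + 4)) (val (fld u 14)) (val (fld u 15))"
    using v by (simp_all add: verify_def n_def)
  have n: "n \<ge> 1" and ok: "\<forall>k<n + n + 5. okf (restf x k)" "restf x (n + n + 5) = []"
    and row: "\<forall>i<n. length (fld x i) = n \<and> (\<exists>j<n. nthd (fld x i) j)"
    and s: "canon (fld x n)" "1 + s \<le> n" and can: "\<forall>i<n. canon (fld x (Suc (n + i)))"
    using I unfolding instance_ok_def n_def[symmetric] s_def by blast+
  have graph: "is_graph G"
    using n row by (auto simp: is_graph_def G_def E_def lessThan_empty_iff)
  have "instance_fields n E s \<rho> b c = map (fld x) [0..<n + n + 5]"
  proof -
    have "map (\<lambda>j. (i, j) \<in> E) [0..<n] = fld x i" if "i < n" for i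
      using row that by (intro nth_equalityI) (auto simp: E_def nthd_def)
    moreover have "nat_bits (\<rho> i) = fld x (Suc (n + i))" if "i < n" for i
      using can that by (simp add: \<rho>_def nat_bits_val)
    moreover have "nat_bits s = fld x n" using s by (simp add: s_def nat_bits_val)
    ultimately show ?thesis
      unfolding instance_fields_def upt_instance
      using rat_ok_fields[OF rb] rat_ok_fields[OF rc] by (simp add: b_def c_def comp_def)
  qed
  then have enc: "encode_instance n E s \<rho> b c = x"
    unfolding encode_instance_def using concat_fld[of "n + n + 5" x] ok by simp
  define C1 where "C1 = map (wst u 1) [0..<wlen u 1]"
  define C2 where "C2 = map (wst u 3) [0..<wlen u 3]"
  have walk: "walk E (wst u k 0) (map (wst u k) [0..<wlen u k]) (wst u k (wlen u k))" if "k < 5" for k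
    using W that by (intro walk_map_upt) (auto simp: walks_ok_def E_def n_def)
  have ends: "wst u 0 0 = s" "wst u 0 (wlen u 0) = wst u 1 0" "wst u 1 (wlen u 1) = wst u 1 0"
    "wst u 2 0 = wst u 1 0" "wst u 2 (wlen u 2) = wst u 3 0" "wst u 3 (wlen u 3) = wst u 3 0"
    "wst u 4 0 = wst u 3 0" "wst u 4 (wlen u 4) = wst u 1 0" "1 \<le> wlen u 1" "1 \<le> wlen u 3"
    using W unfolding walks_ok_def s_def n_def by (blast intro: le_antisym)+
  define x1 x2 where "x1 = val (fld u 0)" and "x2 = val (fld u 1)"
  define L S T where "L = mix u (\<lambda>_. 1)" and "S = mix u \<rho>" and "T = mix u (\<lambda>v. \<rho> v * \<rho> v)"
  have "\<exists>r\<in>runs G. r 0 = s \<and> of_rat b \<le> mp \<rho> r \<and> va \<rho> r \<le> of_rat c"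
  proof (rule run_of_certificate)
    show "walk E s (map (wst u 0) [0..<wlen u 0]) (wst u 1 0)" using walk[of 0] ends by simp
    show "walk E (wst u 1 0) C1 (wst u 1 0)" using walk[of 1] ends by (simp add: C1_def)
    show "walk E (wst u 1 0) (map (wst u 2) [0..<wlen u 2]) (wst u 3 0)" using walk[of 2] ends by simp
    show "walk E (wst u 3 0) C2 (wst u 3 0)" using walk[of 3] ends by (simp add: C2_def)
    show "walk E (wst u 3 0) (map (wst u 4) [0..<wlen u 4]) (wst u 1 0)" using walk[of 4] ends by simp
    show "C1 \<noteq> []" "C2 \<noteq> []" using ends by (auto simp: C1_def C2_def)
    have "1 \<le> x1 + x2" using N unfolding num_ok_def x1_def x2_def by blast
    then show "x1 + x2 > 0" by linarith
    show "real L = real x1 * real (length C1) + real x2 * real (length C2)"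
      by (simp add: L_def mix_def x1_def x2_def C1_def C2_def)
    show "real S = real x1 * tot \<rho> C1 + real x2 * tot \<rho> C2"
      unfolding S_def mix_def x1_def x2_def C1_def C2_def tot_def sum_list_map_upt by simp
    show "real T = real x1 * tot2 \<rho> C1 + real x2 * tot2 \<rho> C2"
      unfolding T_def mix_def x1_def x2_def C1_def C2_def tot2_def sum_list_map_upt
      by (simp add: power2_eq_square)
    have num: "(if nthd (fld x (n + n + 1)) 0 then 0 else val (tl (fld x (n + n + 1)))) * L \<le>
        val (fld x (n + n + 2)) * S + (if nthd (fld x (n + n + 1)) 0 then val (tl (fld x (n + n + 1))) else 0) * L"
      "val (fld x (n + n + 4)) * (T * L) + (if nthd (fld x (n + n + 3)) 0 then val (tl (fld x (n + n + 3))) else 0) * (L * L) \<le>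
        val (fld x (n + n + 4)) * (S * S) + (if nthd (fld x (n + n + 3)) 0 then 0 else val (tl (fld x (n + n + 3)))) * (L * L)"
      using N unfolding num_ok_def Let_def n_def[symmetric] L_def S_def T_def \<rho>_def by blast+
    have "val (fld x (n + n + 2)) > 0" using rb val_pos by (simp add: rat_ok_def)
    then show "of_rat b * real L \<le> real S"
      using num(1) mean_bound_iff unfolding b_def rat_of_def by blast
    have "val (fld x (n + n + 4)) > 0" using rc val_pos by (simp add: rat_ok_def)
    then show "real T * real L - (real S)\<^sup>2 \<le> of_rat c * (real L)\<^sup>2"
      using num(2) variance_bound_iff unfolding c_def rat_of_def by blast
  qed (use s in \<open>auto simp: G_def\<close>)
  then obtain r where r: "r \<in> runs G" "r 0 = s" "of_rat b \<le> mp \<rho> r" "va \<rho> r \<le> of_rat c" by blast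
  obtain \<sigma> where \<sigma>: "strategy G \<sigma>" "induced_run \<sigma> s = r" using run_strategy[OF graph r(1)] r(2) by auto
  have "achieves \<sigma> (variance_stability G \<rho> b c) s"
    using \<sigma>(2) r by (simp add: achieves_def variance_stability_def)
  then have "let G = \<lparr>states = {..<n}, edges = E\<rparr> in is_graph G \<and> s \<in> states G \<and>
      (\<exists>\<sigma>. strategy G \<sigma> \<and> achieves \<sigma> (variance_stability G \<rho> b c) s)"
    using graph s(2) \<sigma>(1) by (auto simp: Let_def G_def)
  then show ?thesis
    unfolding variance_stability_problem_def using enc by blast
qed

section \<open>Completeness of the verifier and size of certificates\<close>

lemma rtrancl_bounded_walk:
  assumes "finite E" "(a, b) \<in> E\<^sup>*"
  obtains f m where "f 0 = a" "f m = b" "\<And>j. j < m \<Longrightarrow> (f j, f (Suc j)) \<in> E" "m \<le> card E"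
proof -
  obtain m where m: "m \<le> card E" "(a, b) \<in> E ^^ m"
    using assms rtrancl_finite_eq_relpow[OF assms(1)] by auto
  then obtain f where "f 0 = a" "f m = b" "\<forall>j<m. (f j, f (Suc j)) \<in> E"
    unfolding relpow_fun_conv by blast
  then show thesis using m(1) by (intro that[of f m]) auto
qed

lemma all_less_5: "(\<forall>k<5. P k) \<longleftrightarrow> P 0 \<and> P 1 \<and> P 2 \<and> P 3 \<and> P (4 :: nat)"
  by (auto simp: less_Suc_eq numeral_eq_Suc)

lemma length_concat_encode_field:
  assumes "\<And>f. f \<in> set fs \<Longrightarrow> length f \<le> B"
  shows "length (concat (map encode_field fs)) \<le> length fs * (2 * B + 2)"
  using assms
proof (induction fs)
  case (Cons f fs)
  then have "length f \<le> B" "length (concat (map encode_field fs)) \<le> length fs * (2 * B + 2)" by simp_all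
  then show ?case by (simp add: length_encode_field)
qed simp

text \<open>The polynomial adds up six numerals of 4 N + 1 bits, five walks with at most N N + 1
  states in unary, and five lengths in unary, each with the overhead of the field encoding, which is
  nested for walks.\<close>

lemma certificate_encoding:
  fixes F :: "nat \<Rightarrow> nat \<Rightarrow> nat" and m :: "nat \<Rightarrow> nat" and as :: "nat list"
  assumes F: "\<And>k j. k < 5 \<Longrightarrow> j \<le> m k \<Longrightarrow> F k j \<le> N" and m: "\<And>k. k < 5 \<Longrightarrow> m k \<le> N * N"
    and as: "length as = 6" "\<And>a. a \<in> set as \<Longrightarrow> a < 2 ^ (4 * N + 1)"
  obtains u where "length u \<le> poly [:64, 68, 30, 20:] N"
    "\<And>k j. k < 5 \<Longrightarrow> j \<le> m k \<Longrightarrow> wst u k j = F k j" "\<And>k. k < 5 \<Longrightarrow> wlen u k = m k"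
    "val (fld u 0) = as ! 0" "val (fld u 1) = as ! 1" "val (fld u 12) = as ! 2" "val (fld u 13) = as ! 3"
    "val (fld u 14) = as ! 4" "val (fld u 15) = as ! 5"
proof -
  obtain a0 a1 a2 a3 a4 a5 where as_eq: "as = [a0, a1, a2, a3, a4, a5]"
    using as(1) by (auto simp: length_Suc_conv numeral_eq_Suc)
  define wk where "wk = (\<lambda>k. concat (map encode_field (map (\<lambda>j. replicate (F k j) True) [0..<Suc (m k)])))"
  define fsA where "fsA = map nat_bits as"
  define fsB where "fsB = map wk [0..<5]"
  define fsC where "fsC = map (\<lambda>k. replicate (m k) True) [0..<5]"
  define fs where "fs = map nat_bits [a0, a1] @ fsB @ fsC @ map nat_bits [a2, a3, a4, a5]"
  define u where "u = concat (map encode_field fs)"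
  have len: "length fs = 16" by (simp add: fs_def fsB_def fsC_def)
  have fld: "fld u k = fs ! k" if "k < 16" for k
    unfolding u_def using that len by (intro fld_concat) simp
  have B: "fld u (k + 2) = wk k" if "k < 5" for k
    using that fld[of "k + 2"] by (simp add: fs_def fsB_def nth_append)
  have C: "fld u (k + 7) = replicate (m k) True" if "k < 5" for k
    using that fld[of "k + 7"] by (simp add: fs_def fsB_def fsC_def nth_append nth_Cons')
  show thesis
  proof (rule that)
    show "wst u k j = F k j" if "k < 5" "j \<le> m k" for k j
    proof -
      have "fld (wk k) j = map (\<lambda>j. replicate (F k j) True) [0..<Suc (m k)] ! j"
        unfolding wk_def using that by (intro fld_concat) simp
      also have "\<dots> = replicate (F k j) True" using that by (simp del: upt_Suc)
      finally show ?thesis using B that by simp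
    qed
    show "wlen u k = m k" if "k < 5" for k using C that by simp
    show "val (fld u 0) = as ! 0" "val (fld u 1) = as ! 1"
      using fld[of 0] fld[of 1] by (simp_all add: fs_def as_eq val_nat_bits)
    show "val (fld u 12) = as ! 2" "val (fld u 13) = as ! 3" "val (fld u 14) = as ! 4" "val (fld u 15) = as ! 5"
      using fld[of 12] fld[of 13] fld[of 14] fld[of 15]
      by (simp_all add: fs_def fsB_def fsC_def as_eq val_nat_bits nth_append)
    have lA: "length f \<le> 4 * N + 1" if "f \<in> set fsA" for f
      using that as(2) length_nat_bits by (auto simp: fsA_def)
    have lW: "length (wk k) \<le> (N * N + 1) * (2 * N + 2)" if "k < 5" for k
    proof -
      have "length (wk k) \<le> length (map (\<lambda>j. replicate (F k j) True) [0..<Suc (m k)]) * (2 * N + 2)"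
        unfolding wk_def using F[OF that] by (intro length_concat_encode_field) auto
      also have "\<dots> \<le> (N * N + 1) * (2 * N + 2)"
        using m[OF that] by (intro mult_right_mono) auto
      finally show ?thesis .
    qed
    have "length u = length (concat (map encode_field fsA)) + length (concat (map encode_field fsB)) +
        length (concat (map encode_field fsC))"
      by (simp add: u_def fs_def fsA_def as_eq)
    also have "\<dots> \<le> 6 * (2 * (4 * N + 1) + 2) + 5 * (2 * ((N * N + 1) * (2 * N + 2)) + 2) + 5 * (2 * (N * N) + 2)"
    proof (intro add_mono)
      show "length (concat (map encode_field fsA)) \<le> 6 * (2 * (4 * N + 1) + 2)"
        using length_concat_encode_field[of fsA, OF lA] as(1) by (simp add: fsA_def)
      show "length (concat (map encode_field fsB)) \<le> 5 * (2 * ((N * N + 1) * (2 * N + 2)) + 2)"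
      proof -
        have "length fsB = 5" "\<And>f. f \<in> set fsB \<Longrightarrow> length f \<le> (N * N + 1) * (2 * N + 2)"
          using lW by (auto simp: fsB_def simp del: mult_Suc mult_Suc_right)
        then show ?thesis using length_concat_encode_field[of fsB "(N * N + 1) * (2 * N + 2)"] by metis
      qed
      show "length (concat (map encode_field fsC)) \<le> 5 * (2 * (N * N) + 2)"
      proof -
        have "length fsC = 5" "\<And>f. f \<in> set fsC \<Longrightarrow> length f \<le> N * N"
          using m by (auto simp: fsC_def)
        then show ?thesis using length_concat_encode_field[of fsC "N * N"] by metis
      qed
    qed
    also have "\<dots> = poly [:64, 68, 30, 20:] N" by (simp add: algebra_simps)
    finally show "length u \<le> poly [:64, 68, 30, 20:] N" .
  qed
qed

lemma verify_complete:
  assumes x: "x \<in> variance_stability_problem"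
  shows "\<exists>u. length u \<le> poly [:64, 68, 30, 20:] (length x) \<and> verify x u"
proof -
  obtain n E s \<rho> b c \<sigma> where x_def: "x = encode_instance n E s \<rho> b c"
    and G0: "is_graph \<lparr>states = {..<n}, edges = E\<rparr>" "s < n"
    and \<sigma>: "strategy \<lparr>states = {..<n}, edges = E\<rparr> \<sigma>"
      "achieves \<sigma> (variance_stability \<lparr>states = {..<n}, edges = E\<rparr> \<rho> b c) s"
    using x unfolding variance_stability_problem_def Let_def by auto
  define G where "G = \<lparr>states = {..<n}, edges = E\<rparr>"
  have G: "is_graph G" and EG: "edges G = E" and cardG: "card (states G) = n"
    using G0 by (simp_all add: G_def)
  have E: "E \<subseteq> {..<n} \<times> {..<n}" "\<And>i. i < n \<Longrightarrow> \<exists>j. (i, j) \<in> E"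
    using G0(1) by (auto simp: is_graph_def)
  have finE: "finite E" "card E \<le> n * n"
    using E(1) card_mono[OF _ E(1)] finite_subset[OF E(1)] by (simp_all add: card_cartesian_product)
  have n: "n \<ge> 1" using G0(2) by simp

  define fs where "fs = instance_fields n E s \<rho> b c"
  have xfs: "x = concat (map encode_field fs)"
    by (simp add: x_def fs_def encode_instance_def)
  obtain f g f' g' where rb: "rat_fields b = [f, g]" and rc: "rat_fields c = [f', g']"
    by (cases "quotient_of b"; cases "quotient_of c") (simp add: rat_fields_def)
  have fs: "fs = map (\<lambda>i. map (\<lambda>j. (i, j) \<in> E) [0..<n]) [0..<n] @ [nat_bits s] @
      map (\<lambda>i. nat_bits (\<rho> i)) [0..<n] @ [f, g, f', g']"
    by (simp add: fs_def instance_fields_def rb rc)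
  have len: "length fs = n + n + 5" by (simp add: fs)
  have fld: "fld x k = fs ! k" if "k < n + n + 5" for k
    unfolding xfs using that len by (intro fld_concat) simp
  have row: "fld x i = map (\<lambda>j. (i, j) \<in> E) [0..<n]" if "i < n" for i
    using that fld[of i] by (simp add: fs nth_append)
  have dim: "dim x = n" using row[of 0] n by simp
  have fs_s: "fld x n = nat_bits s" using fld[of n] by (simp add: fs nth_append)
  have fs_\<rho>: "fld x (Suc (n + i)) = nat_bits (\<rho> i)" if "i < n" for i
    using that fld[of "Suc (n + i)"] by (simp add: fs nth_append)
  have fs_rat: "fld x (n + n + 1) = f" "fld x (n + n + 2) = g" "fld x (n + n + 3) = f'" "fld x (n + n + 4) = g'"
    using fld[of "n + n + 1"] fld[of "n + n + 2"] fld[of "n + n + 3"] fld[of "n + n + 4"]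
    by (simp_all add: fs nth_append)

  define N where "N = length x"
  \<comment> \<open>A field \<open>h\<close> occupies \<open>2 * length h + 2\<close> bits of the
    input. So \<open>N\<close> bounds the number of states, and 2 to the power \<open>N\<close> all
    numbers in the instance.\<close>
  have lenf: "2 * length h + 2 \<le> N" if "h \<in> set fs" for h
  proof -
    have "length (encode_field h) \<in> set (map length (map encode_field fs))" using that by auto
    then have "length (encode_field h) \<le> length x"
      unfolding xfs length_concat by (intro member_le_sum_list) simp_all
    then show ?thesis by (simp add: length_encode_field N_def)
  qed
  have lt: "val h < 2 ^ N" if "h \<in> set fs" for h
    using val_less[of h] lenf[OF that] power_increasing[of "length h" N "2 :: nat"] by linarith
  have nN: "n \<le> N" "N \<ge> 1"
  proof -
    have "map (\<lambda>j. (0, j) \<in> E) [0..<n] \<in> set fs" using n by (auto simp: fs)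
    from lenf[OF this] show "n \<le> N" "N \<ge> 1" by simp_all
  qed
  have \<rho>_lt: "\<rho> i < 2 ^ N" if "i < n" for i
    using lt[of "nat_bits (\<rho> i)"] that by (simp add: fs val_nat_bits)

  obtain \<alpha> \<beta> where bz: "rat_ok f g \<alpha> \<beta>" "\<beta> < val g"
    and qb: "quotient_of b = ((if nthd f 0 then -1 else 1) * int (val (tl f)), int (val g))"
    by (rule rat_fields_ok[OF rb])
  obtain \<alpha>' \<beta>' where bz': "rat_ok f' g' \<alpha>' \<beta>'" "\<beta>' < val g'"
    and qc: "quotient_of c = ((if nthd f' 0 then -1 else 1) * int (val (tl f')), int (val g'))"
    by (rule rat_fields_ok[OF rc])
  define k d k' d' where "k = val (tl f)" and "d = val g" and "k' = val (tl f')" and "d' = val g'"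
  have d: "d > 0" "d' > 0" using bz(2) bz'(2) by (simp_all add: d_def d'_def)
  have b_eq: "b = Fract ((if nthd f 0 then -1 else 1) * int k) (int d)"
    and c_eq: "c = Fract ((if nthd f' 0 then -1 else 1) * int k') (int d')"
    unfolding Fract_of_int_quotient k_def d_def k'_def d'_def
    using quotient_of_div[OF qb] quotient_of_div[OF qc] .
  have tl_le: "val (tl h) \<le> val h" for h by (cases h) auto
  have kd: "k < 2 ^ N" "d < 2 ^ N" "k' < 2 ^ N" "d' < 2 ^ N"
    using lt[of f] lt[of g] lt[of f'] lt[of g'] tl_le[of f] tl_le[of f']
    by (simp_all add: fs k_def d_def k'_def d'_def)
  have bezout_lt: "\<alpha> < 2 ^ (4 * N + 1) \<and> \<beta> < 2 ^ (4 * N + 1)"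
    if "d * \<alpha> = k * \<beta> + 1" "\<beta> < d" "d < 2 ^ N" "k < 2 ^ N" for \<alpha> \<beta> d k :: nat
  proof -
    have "k * \<beta> \<le> 2 ^ N * 2 ^ N" using that by (intro mult_mono) auto
    moreover have "\<alpha> \<le> d * \<alpha>" using that(2) by simp
    moreover have "2 ^ N * 2 ^ N + 1 < (2 :: nat) ^ (4 * N + 1)"
    proof -
      have "(2 :: nat) ^ N * 2 ^ N = 2 ^ (2 * N)" by (simp add: mult_2 power_add)
      moreover have "(2 :: nat) ^ (2 * N) \<le> 2 ^ (4 * N)" by (intro power_increasing) auto
      moreover have "(2 :: nat) \<le> 2 ^ (4 * N)" using nN(2) self_le_power[of 2 "4 * N"] by simp
      moreover have "(2 :: nat) ^ (4 * N + 1) = 2 * 2 ^ (4 * N)" by simp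
      ultimately show ?thesis by linarith
    qed
    moreover have "(2 :: nat) ^ N \<le> 2 ^ (4 * N + 1)" by (intro power_increasing) auto
    ultimately show ?thesis using that by linarith
  qed

  define r where "r = induced_run \<sigma> s"
  have r: "r \<in> runs G" "mp \<rho> r \<ge> of_rat b" "va \<rho> r \<le> of_rat c" "r 0 = s"
    using \<sigma>(2) by (simp_all add: achieves_def variance_stability_def r_def G_def)
  obtain p q C1 C2 where reach: "(s, p) \<in> E\<^sup>*" "(p, q) \<in> E\<^sup>*" "(q, p) \<in> E\<^sup>*"
    and cyc: "walk E p C1 p" "walk E q C2 q" "C1 \<noteq> []" "C2 \<noteq> []" "length C1 \<le> n" "length C2 \<le> n"
    and opt: "single_ok \<rho> (of_rat b) (of_rat c) C1 \<or> mixed_ok \<rho> (of_rat b) (of_rat c) C1 C2"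
    by (rule certificate_of_run[OF G r(1-3)]) (simp only: EG cardG r(4), rule that)

  define L1 L2 where "L1 = length C1" and "L2 = length C2"
  define F1 F3 where "F1 = (\<lambda>j. (C1 @ [p]) ! j)" and "F3 = (\<lambda>j. (C2 @ [q]) ! j)"
  have C: "C1 = map F1 [0..<L1]" "C2 = map F3 [0..<L2]"
    by (intro nth_equalityI; simp add: F1_def F3_def L1_def L2_def nth_append)+
  have setC: "set C1 \<subseteq> {..<n}" "set C2 \<subseteq> {..<n}"
    using walk_set[OF cyc(1) E(1)] walk_set[OF cyc(2) E(1)] by auto
  define S1 S2 T1 T2 where "S1 = (\<Sum>j<L1. \<rho> (F1 j))" and "S2 = (\<Sum>j<L2. \<rho> (F3 j))"
    and "T1 = (\<Sum>j<L1. \<rho> (F1 j) * \<rho> (F1 j))" and "T2 = (\<Sum>j<L2. \<rho> (F3 j) * \<rho> (F3 j))"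
  have tots: "tot \<rho> C1 = real S1" "tot \<rho> C2 = real S2" "tot2 \<rho> C1 = real T1" "tot2 \<rho> C2 = real T2"
    unfolding S1_def S2_def T1_def T2_def tot_def tot2_def
    by (subst C, subst sum_list_map_upt, simp add: power2_eq_square)+
  have F_lt: "F1 j < n" if "j < L1" for j
  proof -
    have "C1 ! j \<in> set C1" using that by (simp add: L1_def)
    then have "C1 ! j < n" using setC(1) by blast
    then show ?thesis using that by (simp add: F1_def L1_def nth_append)
  qed
  have S1_le: "S1 \<le> n * 2 ^ N"
  proof -
    have "S1 \<le> L1 * 2 ^ N"
      unfolding S1_def
      using sum_bounded_above[of "{..<L1}" "\<lambda>j. \<rho> (F1 j)" "2 ^ N"] \<rho>_lt[OF F_lt] by (simp add: less_imp_le)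
    also have "\<dots> \<le> n * 2 ^ N" using cyc(5) by (intro mult_right_mono) (simp_all add: L1_def)
    finally show ?thesis .
  qed

  \<comment> \<open>A single cycle gets the weights 1 and 0. For two cycles the weights of
    \<open>mixed_ok\<close> are multiplied by the denominator \<open>d\<close> of \<open>b\<close>,
    which makes them integers of polynomial bit length.\<close>
  obtain X1 X2 :: nat where X: "X1 + X2 > 0" "X1 < 2 ^ (4 * N + 1)" "X2 < 2 ^ (4 * N + 1)"
    and mean: "of_rat b * real (X1 * L1 + X2 * L2) \<le> real (X1 * S1 + X2 * S2)"
    and var: "real (X1 * T1 + X2 * T2) * real (X1 * L1 + X2 * L2) - (real (X1 * S1 + X2 * S2))\<^sup>2 \<le>
      of_rat c * (real (X1 * L1 + X2 * L2))\<^sup>2"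
  proof (cases "single_ok \<rho> (of_rat b) (of_rat c) C1")
    case True
    show thesis
    proof (rule that[of 1 0])
      show "1 < (2 :: nat) ^ (4 * N + 1)" by (rule one_less_power) simp_all
    qed (use True in \<open>simp_all add: single_ok_def tots L1_def\<close>)
  next
    case False
    define B where "B = (of_rat b :: real)"
    have *: "real S1 > B * L1" "real S2 < B * L2"
      "(B * L2 - S2) * T1 + (S1 - B * L1) * T2 \<le> (of_rat c + B\<^sup>2) * ((B * L2 - S2) * L1 + (S1 - B * L1) * L2)"
      using opt False by (simp_all add: mixed_ok_def tots L1_def L2_def B_def)
    define K where "K = (if nthd f 0 then - real k else real k)"
    have BK: "B = K / real d" using d by (simp add: B_def b_eq of_rat_rat K_def)
    define Ki where "Ki = (if nthd f 0 then - int k else int k)"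
    define X1 X2 where "X1 = nat (Ki * int L2 - int (d * S2))" and "X2 = nat (int (d * S1) - Ki * int L1)"
    have Kint: "real_of_int Ki = K" by (simp add: K_def Ki_def)
    have pos: "K * L2 - d * S2 > 0" "d * S1 - K * L1 > 0"
      using * d by (simp_all add: BK field_simps)
    \<comment> \<open>Positivity is transferred to the integers, so that \<open>nat\<close>
      preserves the values.\<close>
    have "of_int (Ki * int L2 - int (d * S2)) > (0 :: real)" "of_int (int (d * S1) - Ki * int L1) > (0 :: real)"
      using pos Kint by simp_all
    then have ipos: "Ki * int L2 - int (d * S2) > 0" "int (d * S1) - Ki * int L1 > 0"
      by (simp_all only: of_int_0_less_iff)
    have "real X1 = of_int (Ki * int L2 - int (d * S2))" "real X2 = of_int (int (d * S1) - Ki * int L1)"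
      using ipos by (simp_all add: X1_def X2_def)
    then have X: "real X1 = K * L2 - d * S2" "real X2 = d * S1 - K * L1" using Kint by simp_all
    moreover have "K = d * B" using d by (simp add: BK)
    ultimately have XB: "real X1 = d * (B * L2 - S2)" "real X2 = d * (S1 - B * L1)"
      by (simp_all add: algebra_simps)
    show thesis
    proof (rule that[of X1 X2])
      have "real X1 > 0" using X(1) pos(1) by simp
      then show "X1 + X2 > 0" by simp
      have nlt: "n < 2 ^ N" using nN(1) less_exp[of N] by linarith
      have Lb: "L1 \<le> 2 ^ N" "L2 \<le> 2 ^ N" using cyc(5,6) nlt by (simp_all add: L1_def L2_def)
      have Kk: "K \<le> real k" "- K \<le> real k" by (simp_all add: K_def)
      have "K * L2 \<le> real k * L2" "(- K) * L1 \<le> real k * L1"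
        by (intro mult_right_mono Kk; simp)+
      moreover have "0 \<le> real d * real S2" by simp
      ultimately have "real X1 \<le> real (k * L2)" "real X2 \<le> real (d * S1 + k * L1)"
        unfolding X of_nat_mult of_nat_add by linarith+
      then have le: "X1 \<le> k * L2" "X2 \<le> d * S1 + k * L1" by (simp_all only: of_nat_le_iff)
      have "X1 \<le> k * L2" by (rule le(1))
      also have "\<dots> \<le> 2 ^ N * 2 ^ N" using kd Lb by (intro mult_mono) auto
      also have "\<dots> < 2 ^ (4 * N + 1)"
        unfolding power_add[symmetric] using nN(2) by (intro power_strict_increasing) auto
      finally show "X1 < 2 ^ (4 * N + 1)" .
      have "X2 \<le> d * S1 + k * L1" by (rule le(2))
      \<comment> \<open>\<open>S1\<close> sums at most \<open>n\<close> rewards and takes 2 N bits,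
        and the factor \<open>d\<close> takes N more; 4 N + 1 bits leave room for the sum.\<close>
      also have "\<dots> \<le> 2 ^ N * (2 ^ N * 2 ^ N) + 2 ^ N * 2 ^ N"
      proof (intro add_mono mult_mono)
        have "n * 2 ^ N \<le> 2 ^ N * (2 ^ N :: nat)" using nlt by (intro mult_right_mono) auto
        with S1_le show "S1 \<le> 2 ^ N * 2 ^ N" by (rule order_trans)
      qed (use kd Lb in auto)
      also have "\<dots> < 2 ^ (4 * N + 1)"
      proof -
        have "(2 :: nat) ^ N * (2 ^ N * 2 ^ N) < 2 ^ (4 * N)" "(2 :: nat) ^ N * 2 ^ N < 2 ^ (4 * N)"
          unfolding power_add[symmetric] using nN(2) by (intro power_strict_increasing; simp)+
        then show ?thesis by simp
      qed
      finally show "X2 < 2 ^ (4 * N + 1)" .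
      define L S T where "L = real X1 * L1 + real X2 * L2" and "S = real X1 * S1 + real X2 * S2"
        and "T = real X1 * T1 + real X2 * T2"
      have cast: "real (X1 * L1 + X2 * L2) = L" "real (X1 * S1 + X2 * S2) = S" "real (X1 * T1 + X2 * T2) = T"
        by (simp_all add: L_def S_def T_def)
      \<comment> \<open>The mixture has mean exactly \<open>b\<close>, so a bound on its second
        moment is a bound on its variance.\<close>
      have S: "S = B * L" by (simp add: S_def L_def XB algebra_simps)
      have "real d * ((B * L2 - S2) * T1 + (S1 - B * L1) * T2) \<le>
          real d * ((of_rat c + B\<^sup>2) * ((B * L2 - S2) * L1 + (S1 - B * L1) * L2))"
        by (rule mult_left_mono[OF *(3)]) simp
      then have T: "T \<le> (of_rat c + B\<^sup>2) * L"
        unfolding T_def L_def XB by (simp add: algebra_simps)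
      have "L \<ge> 0" by (simp add: L_def)
      then have "T * L \<le> (of_rat c + B\<^sup>2) * L * L" by (rule mult_right_mono[OF T])
      then show "real (X1 * T1 + X2 * T2) * real (X1 * L1 + X2 * L2) - (real (X1 * S1 + X2 * S2))\<^sup>2 \<le>
          of_rat c * (real (X1 * L1 + X2 * L2))\<^sup>2"
        unfolding cast S by (simp add: power2_eq_square algebra_simps)
      show "of_rat b * real (X1 * L1 + X2 * L2) \<le> real (X1 * S1 + X2 * S2)"
        unfolding cast S B_def by simp
    qed
  qed

  \<comment> \<open>The connecting walks need no more steps than there are edges, so their lengths
    can be written in unary.\<close>
  obtain F0 m0 where F0: "F0 0 = s" "F0 m0 = p" "\<And>j. j < m0 \<Longrightarrow> (F0 j, F0 (Suc j)) \<in> E" "m0 \<le> card E"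
    by (rule rtrancl_bounded_walk[OF finE(1) reach(1)]) (rule that)
  obtain F2 m2 where F2: "F2 0 = p" "F2 m2 = q" "\<And>j. j < m2 \<Longrightarrow> (F2 j, F2 (Suc j)) \<in> E" "m2 \<le> card E"
    by (rule rtrancl_bounded_walk[OF finE(1) reach(2)]) (rule that)
  obtain F4 m4 where F4: "F4 0 = q" "F4 m4 = p" "\<And>j. j < m4 \<Longrightarrow> (F4 j, F4 (Suc j)) \<in> E" "m4 \<le> card E"
    by (rule rtrancl_bounded_walk[OF finE(1) reach(3)]) (rule that)
  have F1: "F1 0 = p" "F1 L1 = p" "\<And>j. j < L1 \<Longrightarrow> (F1 j, F1 (Suc j)) \<in> E"
    using walk_first[OF cyc(1)] walk_nth[OF cyc(1)] by (simp_all add: F1_def L1_def nth_append)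
  have F3: "F3 0 = q" "F3 L2 = q" "\<And>j. j < L2 \<Longrightarrow> (F3 j, F3 (Suc j)) \<in> E"
    using walk_first[OF cyc(2)] walk_nth[OF cyc(2)] by (simp_all add: F3_def L2_def nth_append)
  define F where "F = (\<lambda>k. [F0, F1, F2, F3, F4] ! k)"
  define m where "m = (\<lambda>k. [m0, L1, m2, L2, m4] ! k)"
  have Fe: "\<forall>k<5. \<forall>j<m k. (F k j, F k (Suc j)) \<in> E"
    unfolding all_less_5 F_def m_def using F0 F1 F2 F3 F4 by simp
  have start: "\<forall>k<5. F k 0 < n"
  proof -
    have rE: "(u, v) \<in> E\<^sup>* \<Longrightarrow> u < n \<Longrightarrow> v < n" for u v
      by (induction rule: rtrancl_induct) (use E(1) in auto)
    have "p < n" "q < n" using rE[OF reach(1)] rE[OF reach(2)] G0(2) by auto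
    then show ?thesis unfolding all_less_5 F_def using F0 F1 F2 F3 F4 G0(2) by simp
  qed
  have F_le: "F k j < n" if "k < 5" "j \<le> m k" for k j
    using that start Fe E(1) by (cases j) (auto simp: Suc_le_eq)
  have nn: "n \<le> n * n" by simp
  have m_le: "\<forall>k<5. m k \<le> n * n"
    unfolding all_less_5 m_def using F0(4) F2(4) F4(4) finE(2) cyc(5,6) nn
    by (simp add: L1_def L2_def order_trans[OF _ finE(2)] order_trans[OF _ nn])
  have nnN: "n * n \<le> N * N" using nN by (intro mult_mono) auto
  obtain u where u: "length u \<le> poly [:64, 68, 30, 20:] N"
    "\<And>k j. k < 5 \<Longrightarrow> j \<le> m k \<Longrightarrow> wst u k j = F k j" "\<And>k. k < 5 \<Longrightarrow> wlen u k = m k"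
    "val (fld u 0) = X1" "val (fld u 1) = X2" "val (fld u 12) = \<alpha>" "val (fld u 13) = \<beta>"
    "val (fld u 14) = \<alpha>'" "val (fld u 15) = \<beta>'"
  proof (rule certificate_encoding[of m F N "[X1, X2, \<alpha>, \<beta>, \<alpha>', \<beta>']"])
    show "F k j \<le> N" if "k < 5" "j \<le> m k" for k j using F_le[OF that] nN(1) by simp
    show "m k \<le> N * N" if "k < 5" for k using m_le that nnN order_trans by blast
    have "d * \<alpha> = k * \<beta> + 1" "\<beta> < d" "d' * \<alpha>' = k' * \<beta>' + 1" "\<beta>' < d'"
      using bz bz' by (simp_all add: rat_ok_def k_def d_def k'_def d'_def)
    then show "a < 2 ^ (4 * N + 1)" if "a \<in> set [X1, X2, \<alpha>, \<beta>, \<alpha>', \<beta>']" for a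
      using that X(2,3) bezout_lt[of d \<alpha> k \<beta>] bezout_lt[of d' \<alpha>' k' \<beta>'] kd by auto
  qed (simp, rule that, simp_all)

  have inst: "instance_ok x"
  proof -
    have "okf (restf x j)" if "j < n + n + 5" for j
    proof -
      have "drop j fs = fs ! j # drop (Suc j) fs" using that len by (simp add: Cons_nth_drop_Suc)
      then show ?thesis using that len by (simp add: xfs restf_concat okf_encode_field)
    qed
    moreover have "restf x (n + n + 5) = []" using len by (simp add: xfs restf_concat)
    moreover have "length (fld x i) = n \<and> (\<exists>j<n. nthd (fld x i) j)" if i: "i < n" for i
    proof -
      obtain j where j: "(i, j) \<in> E" "j < n" using E(1) E(2)[OF i] by blast
      then have "nthd (fld x i) j" by (simp add: row[OF i] nthd_def)
      with j show ?thesis by (auto simp: row[OF i])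
    qed
    ultimately show ?thesis
      unfolding instance_ok_def dim using n G0(2) by (simp add: fs_s fs_\<rho> canon_nat_bits val_nat_bits)
  qed
  have wl: "wlen u 0 = m0" "wlen u 1 = L1" "wlen u 2 = m2" "wlen u 3 = L2" "wlen u 4 = m4"
    using u(3)[of 0] u(3)[of 1] u(3)[of 2] u(3)[of 3] u(3)[of 4] by (simp_all add: m_def)
  have ws: "j \<le> m0 \<Longrightarrow> wst u 0 j = F0 j" "j \<le> L1 \<Longrightarrow> wst u 1 j = F1 j" "j \<le> m2 \<Longrightarrow> wst u 2 j = F2 j"
    "j \<le> L2 \<Longrightarrow> wst u 3 j = F3 j" "j \<le> m4 \<Longrightarrow> wst u 4 j = F4 j" for j
    using u(2)[of 0 j] u(2)[of 1 j] u(2)[of 2 j] u(2)[of 3 j] u(2)[of 4 j] by (simp_all add: m_def F_def)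
  have walks: "walks_ok x u"
    unfolding walks_ok_def dim
  proof (intro conjI allI impI)
    fix k j assume kj: "k < 5" "j < wlen u k"
    then have j: "j < m k" using u(3) by simp
    then have e: "(F k j, F k (Suc j)) \<in> E" using Fe kj(1) by blast
    have w: "wst u k j = F k j" "wst u k (Suc j) = F k (Suc j)" using u(2)[OF kj(1)] j by simp_all
    show "wst u k j < n" "wst u k (Suc j) < n" unfolding w using e E(1) by auto
    show "nthd (fld x (wst u k j)) (wst u k (Suc j))"
      unfolding w using e E(1) by (auto simp: row nthd_def)
  next
    show "1 \<le> wlen u 1" "1 \<le> wlen u 3" unfolding wl using cyc by (simp_all add: L1_def L2_def Suc_le_eq)
  qed (unfold wl ws[OF le0] ws[OF order_refl] F0(1,2) F1(1,2) F2(1,2) F3(1,2) F4(1,2) fs_s val_nat_bits,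
      simp_all)
  have reward: "reward x i = \<rho> i" if "i < n" for i using that by (simp add: dim fs_\<rho> val_nat_bits)
  have mix: "mix u h = X1 * (\<Sum>j<L1. h (F1 j)) + X2 * (\<Sum>j<L2. h (F3 j))" for h
    unfolding mix_def wl u(4,5) using ws by simp
  have F3_lt: "F3 j < n" if "j < L2" for j
  proof -
    have "C2 ! j \<in> set C2" using that by (simp add: L2_def)
    then have "C2 ! j < n" using setC(2) by blast
    then show ?thesis using that by (simp add: F3_def L2_def nth_append)
  qed
  have mixes: "mix u (\<lambda>_. 1) = X1 * L1 + X2 * L2" "mix u (reward x) = X1 * S1 + X2 * S2"
    "mix u (\<lambda>v. reward x v * reward x v) = X1 * T1 + X2 * T2"
    unfolding mix S1_def S2_def T1_def T2_def using F_lt F3_lt reward by simp_all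
  have num: "num_ok x u"
    unfolding num_ok_def Let_def mixes unfolding dim fs_rat k_def[symmetric] d_def[symmetric] k'_def[symmetric] d'_def[symmetric] u(4,5)
  proof (intro conjI)
    show "1 \<le> X1 + X2" using X(1) by linarith
  qed (rule iffD2[OF mean_bound_iff[OF d(1)] mean[unfolded b_eq]],
      rule iffD2[OF variance_bound_iff[OF d(2)] var[unfolded c_eq]])
  have "verify x u"
    unfolding verify_def dim fs_rat u(6-9) using inst walks num bz(1) bz'(1) by simp
  then show ?thesis using u(1) by (auto simp: N_def)
qed

theorem theorem7:
  "variance_stability_problem \<in> NP \<and>
   (\<exists>(G :: nat graph) s \<rho> b c.
      is_graph G \<and> s \<in> states G \<and>
      (\<exists>\<sigma>. strategy G \<sigma> \<and> achieves \<sigma> (variance_stability G \<rho> b c) s) \<and>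
      \<not> (\<exists>\<sigma>. strategy G \<sigma> \<and> finite_memory G \<sigma> \<and> achieves \<sigma> (variance_stability G \<rho> b c) s))"
proof
  show "variance_stability_problem \<in> NP"
  proof (rule NP_intro)
    show "ptb (\<lambda>e. verify (e 0) (e 1))" using ptb_verify by simp
    show "x \<in> variance_stability_problem \<longleftrightarrow>
        (\<exists>u. length u \<le> poly [:64, 68, 30, 20:] (length x) \<and> verify x u)" for x
      using verify_sound verify_complete by blast
  qed
  show "\<exists>(G :: nat graph) s \<rho> b c.
      is_graph G \<and> s \<in> states G \<and>
      (\<exists>\<sigma>. strategy G \<sigma> \<and> achieves \<sigma> (variance_stability G \<rho> b c) s) \<and>
      \<not> (\<exists>\<sigma>. strategy G \<sigma> \<and> finite_memory G \<sigma> \<and> achieves \<sigma> (variance_stability G \<rho> b c) s)"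
  proof (rule exI[of _ mem_graph], rule exI[of _ 0], rule exI[of _ mem_reward], rule exI[of _ 1],
      rule exI[of _ 9], intro conjI)
    show "is_graph mem_graph" by (rule mem_graph)
    show "0 \<in> states mem_graph" by (simp add: mem_graph_def)
    show "\<exists>\<sigma>. strategy mem_graph \<sigma> \<and> achieves \<sigma> (variance_stability mem_graph mem_reward 1 9) 0"
      by (rule mem_graph_achievable)
    show "\<not> (\<exists>\<sigma>. strategy mem_graph \<sigma> \<and> finite_memory mem_graph \<sigma> \<and>
        achieves \<sigma> (variance_stability mem_graph mem_reward 1 9) 0)"
      using mem_graph_not_finite_memory by blast
  qed
qed

end
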